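(* The map $\phi$ given by $A\mapsto X$, $B\mapsto Y$, $C\mapsto Z$, and sending the central parameters $k_1,k_2,k_3,l_1,l_2,l_3$ of $\mathcal{A}$ to the elements of $Z_2(sl(3))$ with the same names, extends to a surjective morphism of algebras from $\mathcal{A}$ to $Z_2(sl(3))$.
   Context: **The algebra $Z_2(sl(3))$.** $gl(3)$ is the complex Lie algebra with basis $e_{pq}$, $1\le p,q\le 3$, and $[e_{pq},e_{rs}]=\delta_{qr}e_{ps}-\delta_{sp}e_{rq}$; $sl(3)$ is its quotient by $e_{11}+e_{22}+e_{33}=0$, and $e_{pq}$ also denotes the image in $sl(3)$. In $U(sl(3))\otimes U(sl(3))$ put $e_{pq}^{(1)}=e_{pq}\otimes1$, $e_{pq}^{(2)}=1\otimes e_{pq}$, and let $\delta:U(sl(3))\to U(sl(3))\otimes U(sl(3))$ be the algebra homomorphism $\delta(e_{pq})=e_{pq}^{(1)}+e_{pq}^{(2)}$. Summation over repeated indices is implicit. The polarised traces are $T^{(a_1,\dots,a_d)}=e_{i_2i_1}^{(a_1)}e_{i_3i_2}^{(a_2)}\cdots e_{i_1i_d}^{(a_d)}$, $a_j\in\{1,2\}$, and $Z_2(sl(3))$ is the subalgebra of $U(sl(3))\otimes U(sl(3))$ generated by all of them (it is the centraliser of the image of $\delta$). Casimir elements of $U(sl(3))$: $\overline C^{(3)}=e_{i_1i_2}e_{i_2i_3}e_{i_3i_1}$, $C^{(2)}=e_{i_2i_1}e_{i_1i_2}$, $C^{(3)}=e_{i_2i_1}e_{i_3i_2}e_{i_1i_3}$.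 In $Z_2(sl(3))$ set $$k_1=C^{(2)}\otimes 1,\quad k_2=1\otimes C^{(2)},\quad k_3=\delta(C^{(2)}),$$ $$l_1=\tfrac12(C^{(3)}+\overline C^{(3)})\otimes 1,\quad l_2=1\otimes\tfrac12(C^{(3)}+\overline C^{(3)}),\quad l_3=-\delta\bigl(\tfrac12(C^{(3)}+\overline C^{(3)})\bigr),$$ $$X=\tfrac12(T^{(1,1,2)}-T^{(1,2,2)})+\tfrac13(l_1-l_2),$$ $$Y=T^{(1,1,2,2)}+\tfrac32(T^{(1,1,2)}+T^{(1,2,2)})-\tfrac1{12}(T^{(1,2)})^2-\tfrac5{12}T^{(1,1)}T^{(2,2)}+\tfrac52T^{(1,2)},\qquad Z=[X,Y].$$ **The algebra $\mathcal{A}$.** Here $k_1,k_2,k_3,l_1,l_2,l_3$ are indeterminates (central parameters). $S_3$ acts on $\mathbb{C}[k_1,k_2,k_3,l_1,l_2,l_3]$ by simultaneously permuting the indices of the $k_i$ and of the $l_i$; $Sym^+=\frac16\sum_{\pi\in S_3}\pi$ and $Sym^-=\frac16\sum_{\pi\in S_3}\mathrm{sgn}(\pi)\pi$. $\mathcal{A}$ is the associative unital algebra over $\mathbb{C}[k_1,k_2,k_3,l_1,l_2,l_3]$ generated by $A,B,C$ with defining relations $$[A,B]=C,\quad [A,C]=-6B^2+a_2A^2+a_5A+a_8,\quad [B,C]=-2A^3-a_2\{A,B\}-a_5B+a_6A+a_9,$$ where $\{A,B\}=AB+BA$ and $$a_2=\tfrac12(k_1+k_2+k_3),\qquad a_5=Sym^-(2k_2l_1),$$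 $$a_6=Sym^+\Bigl(\tfrac1{16}(-k_1^3+2k_1^2k_2-6k_1k_2k_3)+\tfrac38(k_1^2-2k_1k_2)+\tfrac16l_1^2-\tfrac53l_1l_2\Bigr),$$ $$a_8=Sym^+\Bigl(\tfrac1{128}(k_1^4-8k_1^3k_2+6k_1^2k_2^2+4k_1^2k_2k_3)-\tfrac1{32}(3k_1^3-6k_1^2k_2+2k_1k_2k_3)-\tfrac1{24}k_1(l_1^2-6l_2^2+4l_1l_2-26l_2l_3)+\tfrac12l_1^2+l_1l_2\Bigr),$$ $$a_9=Sym^-\Bigl(l_2\bigl(-\tfrac49l_1^2+\tfrac1{24}(k_1^3-2k_1^2k_2+k_1k_2^2+9k_1^2k_3)+\tfrac12(k_1^2-k_1k_2)\bigr)\Bigr).$$ *)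

theory Defs
  imports "HOL-Analysis.Analysis" "HOL-Combinatorics.Permutations" "HOL-Library.Poly_Mapping"
begin

section \<open>Complex algebras and complex Lie algebras\<close>

class scaleC =
  fixes scaleC :: "complex \<Rightarrow> 'a \<Rightarrow> 'a"  (infixr "*\<^sub>C" 75)

class complex_vector = scaleC + ab_group_add +
  assumes scaleC_add_right: "a *\<^sub>C (x + y) = a *\<^sub>C x + a *\<^sub>C y"
    and scaleC_add_left: "(a + b) *\<^sub>C x = a *\<^sub>C x + b *\<^sub>C x"
    and scaleC_scaleC: "a *\<^sub>C b *\<^sub>C x = (a * b) *\<^sub>C x"
    and scaleC_one: "1 *\<^sub>C x = x"

text \<open>Associative unital algebras.  The class \<^class>\<open>ring_1\<close> would also demand \<open>0 \<noteq> 1\<close>,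
  which is not part of the notion.\<close>

class complex_algebra = complex_vector + ring + monoid_mult +
  assumes mult_scaleC_left: "(a *\<^sub>C x) * y = a *\<^sub>C (x * y)"
    and mult_scaleC_right: "x * (a *\<^sub>C y) = a *\<^sub>C (x * y)"

class complex_lie_algebra = complex_vector +
  fixes bracket :: "'a \<Rightarrow> 'a \<Rightarrow> 'a"
  assumes bracket_add_left: "bracket (x + y) z = bracket x z + bracket y z"
    and bracket_add_right: "bracket x (y + z) = bracket x y + bracket x z"
    and bracket_scaleC_left: "bracket (a *\<^sub>C x) y = a *\<^sub>C bracket x y"
    and bracket_scaleC_right: "bracket x (a *\<^sub>C y) = a *\<^sub>C bracket x y"
    and bracket_self: "bracket x x = 0"
    and bracket_jacobi:
      "bracket x (bracket y z) + bracket y (bracket z x) + bracket z (bracket x y) = 0"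

definition complex_algebra_hom :: "('a::complex_algebra \<Rightarrow> 'b::complex_algebra) \<Rightarrow> bool" where
  "complex_algebra_hom f \<longleftrightarrow> f 1 = 1 \<and> (\<forall>x y. f (x + y) = f x + f y) \<and>
     (\<forall>x y. f (x * y) = f x * f y) \<and> (\<forall>c x. f (c *\<^sub>C x) = c *\<^sub>C f x)"

inductive_set subalgebra_generated :: "'a::complex_algebra set \<Rightarrow> 'a set" for S where
  generator: "x \<in> S \<Longrightarrow> x \<in> subalgebra_generated S"
| one: "1 \<in> subalgebra_generated S"
| add: "x \<in> subalgebra_generated S \<Longrightarrow> y \<in> subalgebra_generated S
    \<Longrightarrow> x + y \<in> subalgebra_generated S"
| mult: "x \<in> subalgebra_generated S \<Longrightarrow> y \<in> subalgebra_generated S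
    \<Longrightarrow> x * y \<in> subalgebra_generated S"
| scaleC: "x \<in> subalgebra_generated S \<Longrightarrow> c *\<^sub>C x \<in> subalgebra_generated S"

definition commutator :: "'a::ring \<Rightarrow> 'a \<Rightarrow> 'a" where
  "commutator x y = x * y - y * x"

lemma scaleC_zero_right [simp]: "a *\<^sub>C (0::'a::complex_vector) = 0"
  using scaleC_add_right[of a "0::'a" 0] by simp

lemma scaleC_zero_left [simp]: "0 *\<^sub>C (x::'a::complex_vector) = 0"
  using scaleC_add_left[of 0 0 x] by simp

lemma scaleC_minus_right: "a *\<^sub>C (- x) = - (a *\<^sub>C (x::'a::complex_vector))"
proof -
  have "a *\<^sub>C (- x) + a *\<^sub>C x = 0"
    by (simp flip: scaleC_add_right)
  then show ?thesis
    by (simp add: eq_neg_iff_add_eq_0)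
qed

lemma scaleC_diff_right: "a *\<^sub>C (x - y) = a *\<^sub>C x - a *\<^sub>C (y::'a::complex_vector)"
  using scaleC_add_right[of a x "- y"] by (simp add: scaleC_minus_right)

lemma scaleC_sum_right: "a *\<^sub>C sum f A = (\<Sum>x\<in>A. a *\<^sub>C (f x :: 'b::complex_vector))"
  by (induction A rule: infinite_finite_induct) (simp_all add: scaleC_add_right)

instantiation complex :: complex_algebra
begin

definition scaleC_complex :: "complex \<Rightarrow> complex \<Rightarrow> complex" where
  "scaleC_complex a x = a * x"

instance
  by standard (simp_all add: scaleC_complex_def algebra_simps)

end

lemma
  assumes "complex_algebra_hom f"
  shows complex_algebra_hom_one: "f 1 = 1"
    and complex_algebra_hom_add: "f (x + y) = f x + f y"
    and complex_algebra_hom_mult: "f (x * y) = f x * f y"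
    and complex_algebra_hom_scaleC: "f (c *\<^sub>C x) = c *\<^sub>C f x"
  using assms by (simp_all add: complex_algebra_hom_def)

lemma complex_algebra_hom_zero:
  assumes "complex_algebra_hom f" shows "f 0 = 0"
  using complex_algebra_hom_add[OF assms, of 0 0] by simp

lemma complex_algebra_hom_diff:
  assumes "complex_algebra_hom f" shows "f (x - y) = f x - f y"
  using complex_algebra_hom_add[OF assms, of "x - y" y] by (simp add: algebra_simps)


section \<open>Monoid algebras\<close>

text \<open>For an (additively written, not necessarily commutative) monoid \<open>M\<close> and a ring \<open>R\<close>, the type
  \<open>M \<Rightarrow>\<^sub>0 R\<close> carries the convolution product, i.e. it is the monoid algebra \<open>R[M]\<close>.\<close>

instantiation poly_mapping :: (monoid_add, "{ring_1, complex_algebra}") complex_algebra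
begin

lift_definition scaleC_poly_mapping :: "complex \<Rightarrow> ('a \<Rightarrow>\<^sub>0 'b) \<Rightarrow> ('a \<Rightarrow>\<^sub>0 'b)"
  is "\<lambda>c f k. c *\<^sub>C f k"
  by (rule finite_subset[rotated]) auto

lemma scaleC_poly_mapping_eq: "c *\<^sub>C f = Poly_Mapping.single 0 (c *\<^sub>C 1) * (f :: 'a \<Rightarrow>\<^sub>0 'b)"
proof -
  have "c *\<^sub>C f = Poly_Mapping.map ((*) (c *\<^sub>C 1)) f"
    by transfer (auto simp: fun_eq_iff when_def mult_scaleC_left)
  then show ?thesis
    by (simp add: mult_map_scale_conv_mult)
qed

instance
proof
  fix a b :: complex and x y :: "'a \<Rightarrow>\<^sub>0 'b"
  show "a *\<^sub>C (x + y) = a *\<^sub>C x + a *\<^sub>C y"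
    by transfer (simp add: fun_eq_iff scaleC_add_right)
  show "(a + b) *\<^sub>C x = a *\<^sub>C x + b *\<^sub>C x"
    by transfer (simp add: fun_eq_iff scaleC_add_left)
  show "a *\<^sub>C b *\<^sub>C x = (a * b) *\<^sub>C x"
    by transfer (simp add: fun_eq_iff scaleC_scaleC)
  show "1 *\<^sub>C x = x"
    by transfer (simp add: fun_eq_iff scaleC_one)
  show "(a *\<^sub>C x) * y = a *\<^sub>C (x * y)"
    by (simp add: scaleC_poly_mapping_eq mult.assoc)
  have "Poly_Mapping.single 0 (a *\<^sub>C 1) * x = x * Poly_Mapping.single 0 (a *\<^sub>C 1)"
  proof (rule poly_mapping_eqI)
    fix k
    have "Poly_Mapping.lookup (Poly_Mapping.single 0 (a *\<^sub>C 1) * x) k = a *\<^sub>C Poly_Mapping.lookup x k"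
      by (simp flip: scaleC_poly_mapping_eq add: scaleC_poly_mapping.rep_eq)
    moreover have "Poly_Mapping.lookup (x * Poly_Mapping.single 0 (a *\<^sub>C 1)) k = a *\<^sub>C Poly_Mapping.lookup x k"
    proof -
      have "Poly_Mapping.lookup (x * Poly_Mapping.single 0 (a *\<^sub>C 1)) k
          = (\<Sum>l. Poly_Mapping.lookup x l * (\<Sum>q. (a *\<^sub>C 1 when 0 = q when k = l + q)))"
        by (simp add: times_poly_mapping.rep_eq prod_fun_def lookup_single)
      also have "\<dots> = (\<Sum>l. Poly_Mapping.lookup x l * (a *\<^sub>C 1 when k = l))"
      proof (rule Sum_any.cong)
        fix l
        have "(\<Sum>q. (a *\<^sub>C (1::'b) when 0 = q when k = l + q)) = (\<Sum>q::'a. (a *\<^sub>C 1 when k = l when q = 0))"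
          by (rule Sum_any.cong) (auto simp: when_def)
        then show "Poly_Mapping.lookup x l * (\<Sum>q. (a *\<^sub>C 1 when 0 = q when k = l + q)) = Poly_Mapping.lookup x l * (a *\<^sub>C 1 when k = l)"
          by simp
      qed
      also have "\<dots> = a *\<^sub>C Poly_Mapping.lookup x k"
        by (simp add: mult_when mult_scaleC_right)
      finally show ?thesis .
    qed
    ultimately show "Poly_Mapping.lookup (Poly_Mapping.single 0 (a *\<^sub>C 1) * x) k
        = Poly_Mapping.lookup (x * Poly_Mapping.single 0 (a *\<^sub>C 1)) k"
      by simp
  qed
  then show "x * (a *\<^sub>C y) = a *\<^sub>C (x * y)"
    by (metis scaleC_poly_mapping_eq mult.assoc)
qed

end

lemma scaleC_single [simp]: "c *\<^sub>C Poly_Mapping.single k x = Poly_Mapping.single k (c *\<^sub>C x)"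
  by (rule poly_mapping_eqI) (simp add: scaleC_poly_mapping.rep_eq lookup_single when_def)

definition linear_extension :: "('m \<Rightarrow> 'b::complex_vector) \<Rightarrow> ('m \<Rightarrow>\<^sub>0 complex) \<Rightarrow> 'b" where
  "linear_extension g f = (\<Sum>m\<in>Poly_Mapping.keys f. Poly_Mapping.lookup f m *\<^sub>C g m)"

lemma linear_extension_zero [simp]: "linear_extension g 0 = 0"
  by (simp add: linear_extension_def)

lemma linear_extension_single [simp]: "linear_extension g (Poly_Mapping.single m c) = c *\<^sub>C g m"
  by (simp add: linear_extension_def)

lemma linear_extension_add: "linear_extension g (p + q) = linear_extension g p + linear_extension g q"
  unfolding linear_extension_def
  by (rule setsum_keys_plus_distrib) (simp_all add: scaleC_add_left)

lemma poly_mapping_single_induct [case_names single add]: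
  fixes f :: "'m \<Rightarrow>\<^sub>0 'c::comm_monoid_add"
  assumes single: "\<And>m c. P (Poly_Mapping.single m c)"
    and add: "\<And>p q. P p \<Longrightarrow> P q \<Longrightarrow> P (p + q)"
  shows "P f"
proof -
  have *: "P (\<Sum>m\<in>A. Poly_Mapping.single m (Poly_Mapping.lookup f m))" for A
  proof (induction A rule: infinite_finite_induct)
    case (infinite A)
    then show ?case using single[of undefined 0] by simp
  next
    case empty
    then show ?case using single[of undefined 0] by simp
  next
    case (insert m A)
    then show ?case by (simp add: single add)
  qed
  have "f = (\<Sum>m\<in>Poly_Mapping.keys f. Poly_Mapping.single m (Poly_Mapping.lookup f m))"
  proof (rule poly_mapping_eqI)
    fix k
    have "Poly_Mapping.lookup (\<Sum>m\<in>Poly_Mapping.keys f. Poly_Mapping.single m (Poly_Mapping.lookup f m)) k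
        = (\<Sum>m\<in>Poly_Mapping.keys f. if m = k then Poly_Mapping.lookup f m else 0)"
      by (simp add: lookup_sum lookup_single when_def)
    also have "\<dots> = Poly_Mapping.lookup f k"
      by (simp add: in_keys_iff)
    finally show "Poly_Mapping.lookup f k = Poly_Mapping.lookup (\<Sum>m\<in>Poly_Mapping.keys f. Poly_Mapping.single m (Poly_Mapping.lookup f m)) k"
      by simp
  qed
  with *[of "Poly_Mapping.keys f"] show ?thesis by simp
qed

lemma linear_extension_scaleC:
  fixes f :: "'m::monoid_add \<Rightarrow>\<^sub>0 complex"
  shows "linear_extension g (c *\<^sub>C f) = c *\<^sub>C linear_extension g f"
  by (induction f rule: poly_mapping_single_induct)
    (simp_all add: scaleC_complex_def scaleC_scaleC scaleC_add_right linear_extension_add)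

lemma complex_algebra_hom_linear_extension:
  fixes g :: "'m::monoid_add \<Rightarrow> 'b::complex_algebra"
  assumes "g 0 = 1" and "\<And>m n. g (m + n) = g m * g n"
  shows "complex_algebra_hom (linear_extension g)"
proof -
  have "linear_extension g (p * q) = linear_extension g p * linear_extension g q" for p q
  proof (induction p rule: poly_mapping_single_induct)
    case (single m c)
    show ?case
    proof (induction q rule: poly_mapping_single_induct)
      case (single n d)
      then show ?case
        by (simp add: mult_single assms mult_scaleC_left mult_scaleC_right scaleC_scaleC mult.commute)
    qed (simp add: distrib_left linear_extension_add)
  qed (simp add: distrib_right linear_extension_add)
  moreover have "linear_extension g 1 = 1"
    using linear_extension_single[of g 0 1] by (simp add: assms scaleC_one)
  ultimately show ?thesis
    by (simp add: complex_algebra_hom_def linear_extension_add linear_extension_scaleC)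
qed

text \<open>Words form the free monoid, so \<open>'a fword \<Rightarrow>\<^sub>0 R\<close> is the free associative \<open>R\<close>-algebra on \<open>'a\<close>.\<close>

datatype 'a fword = Word (letters: "'a list")

instantiation fword :: (type) monoid_add
begin

definition zero_fword :: "'a fword" where "zero_fword = Word []"

definition plus_fword :: "'a fword \<Rightarrow> 'a fword \<Rightarrow> 'a fword" where
  "plus_fword u v = Word (letters u @ letters v)"

instance
  by standard (simp_all add: zero_fword_def plus_fword_def)

end

definition free_gen :: "'a \<Rightarrow> ('a fword \<Rightarrow>\<^sub>0 'r::zero_neq_one)" where
  "free_gen x = Poly_Mapping.single (Word [x]) 1"

definition free_eval :: "('a \<Rightarrow> 'b::complex_algebra) \<Rightarrow> ('a fword \<Rightarrow>\<^sub>0 complex) \<Rightarrow> 'b" where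
  "free_eval f = linear_extension (\<lambda>w. prod_list (map f (letters w)))"

lemma complex_algebra_hom_free_eval: "complex_algebra_hom (free_eval f)"
  unfolding free_eval_def
  by (rule complex_algebra_hom_linear_extension) (simp_all add: zero_fword_def plus_fword_def)

lemma free_eval_free_gen [simp]: "free_eval f (free_gen x) = f x"
  by (simp add: free_eval_def free_gen_def scaleC_one)


section \<open>Quotients by two-sided ideals\<close>

inductive_set ideal_generated :: "'a::ring_1 set \<Rightarrow> 'a set" for S where
  zero: "0 \<in> ideal_generated S"
| generator: "s \<in> S \<Longrightarrow> a * s * b \<in> ideal_generated S"
| add: "x \<in> ideal_generated S \<Longrightarrow> y \<in> ideal_generated S \<Longrightarrow> x + y \<in> ideal_generated S"

definition cong_ideal :: "'a::ring_1 set \<Rightarrow> 'a \<Rightarrow> 'a \<Rightarrow> bool" where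
  "cong_ideal S x y \<longleftrightarrow> x - y \<in> ideal_generated S"

lemma ideal_generated_mult_left: "x \<in> ideal_generated S \<Longrightarrow> c * x \<in> ideal_generated S"
proof (induction rule: ideal_generated.induct)
  case (generator s a b)
  then show ?case
    using ideal_generated.generator[of s S "c * a" b] by (simp add: mult.assoc)
qed (auto intro: ideal_generated.intros simp: distrib_left)

lemma ideal_generated_mult_right: "x \<in> ideal_generated S \<Longrightarrow> x * c \<in> ideal_generated S"
proof (induction rule: ideal_generated.induct)
  case (generator s a b)
  then show ?case
    using ideal_generated.generator[of s S a "b * c"] by (simp add: mult.assoc)
qed (auto intro: ideal_generated.intros simp: distrib_right)

lemma ideal_generated_uminus: "x \<in> ideal_generated S \<Longrightarrow> - x \<in> ideal_generated S"
  using ideal_generated_mult_left[of x S "- 1"] by simp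

lemma ideal_generated_superset: "s \<in> S \<Longrightarrow> s \<in> ideal_generated S"
  using ideal_generated.generator[of s S 1 1] by simp

lemma cong_ideal_relation: "x - y \<in> S \<Longrightarrow> cong_ideal S x y"
  by (simp add: cong_ideal_def ideal_generated_superset)

lemma equivp_cong_ideal: "equivp (cong_ideal S)"
proof (rule equivpI)
  show "reflp (cong_ideal S)"
    by (simp add: reflp_def cong_ideal_def ideal_generated.zero)
  show "symp (cong_ideal S)"
    unfolding symp_def cong_ideal_def using ideal_generated_uminus by fastforce
  show "transp (cong_ideal S)"
    unfolding transp_def cong_ideal_def
    using ideal_generated.add by (metis diff_add_cancel add_diff_eq)
qed

lemma cong_ideal_add:
  "cong_ideal S a b \<Longrightarrow> cong_ideal S c d \<Longrightarrow> cong_ideal S (a + c) (b + d)"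
  unfolding cong_ideal_def using ideal_generated.add by (metis add_diff_add)

lemma cong_ideal_uminus: "cong_ideal S a b \<Longrightarrow> cong_ideal S (- a) (- b)"
  unfolding cong_ideal_def using ideal_generated_uminus[of "a - b" S]
  by (simp add: algebra_simps)

lemma cong_ideal_diff:
  "cong_ideal S a b \<Longrightarrow> cong_ideal S c d \<Longrightarrow> cong_ideal S (a - c) (b - d)"
  using cong_ideal_add[OF _ cong_ideal_uminus] by fastforce

lemma cong_ideal_mult:
  assumes "cong_ideal S a b" "cong_ideal S c d" shows "cong_ideal S (a * c) (b * d)"
proof -
  have "(a - b) * c + b * (c - d) \<in> ideal_generated S"
    using assms unfolding cong_ideal_def
    by (intro ideal_generated.add ideal_generated_mult_left ideal_generated_mult_right)
  then show ?thesis
    by (simp add: cong_ideal_def algebra_simps)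
qed

lemma cong_ideal_scaleC:
  fixes a b :: "'m::monoid_add \<Rightarrow>\<^sub>0 'r::{ring_1, complex_algebra}"
  assumes "cong_ideal S a b" shows "cong_ideal S (c *\<^sub>C a) (c *\<^sub>C b)"
  using assms ideal_generated_mult_left[of "a - b" S]
  by (simp add: cong_ideal_def scaleC_poly_mapping_eq right_diff_distrib)

lemma hom_cong_ideal:
  fixes f :: "'a::{ring_1, complex_algebra} \<Rightarrow> 'b::complex_algebra"
  assumes f: "complex_algebra_hom f" and S: "\<And>s. s \<in> S \<Longrightarrow> f s = 0" and "cong_ideal S x y"
  shows "f x = f y"
proof -
  have "f z = 0" if "z \<in> ideal_generated S" for z
    using that
    by induction
      (simp_all add: S complex_algebra_hom_zero[OF f] complex_algebra_hom_add[OF f] complex_algebra_hom_mult[OF f])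
  then have "f (x - y) = 0"
    using assms(3) by (simp add: cong_ideal_def)
  then show ?thesis
    by (simp add: complex_algebra_hom_diff[OF f])
qed


section \<open>The universal enveloping algebra\<close>

definition uea_relations :: "('g::complex_lie_algebra fword \<Rightarrow>\<^sub>0 complex) set" where
  "uea_relations =
     {free_gen (x + y) - (free_gen x + free_gen y) | x y. True} \<union>
     {free_gen (c *\<^sub>C x) - c *\<^sub>C free_gen x | c x. True} \<union>
     {commutator (free_gen x) (free_gen y) - free_gen (bracket x y) | x y. True}"

text \<open>The linearity relations turn the free algebra on the underlying set of \<open>'g\<close> into the tensor
  algebra of the vector space \<open>'g\<close>.\<close>

quotient_type (overloaded) 'g uea = "'g::complex_lie_algebra fword \<Rightarrow>\<^sub>0 complex" / "cong_ideal uea_relations"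
  by (rule equivp_cong_ideal)

instantiation uea :: (complex_lie_algebra) complex_algebra
begin

lift_definition zero_uea :: "'a uea" is 0 .
lift_definition one_uea :: "'a uea" is 1 .
lift_definition plus_uea :: "'a uea \<Rightarrow> 'a uea \<Rightarrow> 'a uea" is "(+)" by (rule cong_ideal_add)
lift_definition uminus_uea :: "'a uea \<Rightarrow> 'a uea" is uminus by (rule cong_ideal_uminus)
lift_definition minus_uea :: "'a uea \<Rightarrow> 'a uea \<Rightarrow> 'a uea" is "(-)" by (rule cong_ideal_diff)
lift_definition times_uea :: "'a uea \<Rightarrow> 'a uea \<Rightarrow> 'a uea" is "(*)" by (rule cong_ideal_mult)
lift_definition scaleC_uea :: "complex \<Rightarrow> 'a uea \<Rightarrow> 'a uea" is scaleC by (rule cong_ideal_scaleC)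

instance
  by (standard; transfer)
    (simp_all add: algebra_simps scaleC_add_right scaleC_add_left scaleC_scaleC scaleC_one
      mult_scaleC_left mult_scaleC_right cong_ideal_def ideal_generated.zero)

end

lift_definition uea_of :: "'g::complex_lie_algebra \<Rightarrow> 'g uea" is free_gen .

lemma uea_of_add: "uea_of (x + y) = uea_of x + uea_of y"
  by transfer (rule cong_ideal_relation, unfold uea_relations_def, blast)

lemma uea_of_scaleC: "uea_of (c *\<^sub>C x) = c *\<^sub>C uea_of x"
  by transfer (rule cong_ideal_relation, unfold uea_relations_def, blast)

lemma uea_of_bracket: "commutator (uea_of x) (uea_of y) = uea_of (bracket x y)"
  unfolding commutator_def
  by transfer (rule cong_ideal_relation, unfold uea_relations_def commutator_def, blast)


section \<open>The tensor product of two algebras\<close>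

text \<open>The monoid algebra of the multiplicative monoid \<open>A \<times> B\<close> is the free vector space on \<open>A \<times> B\<close>
  with \<open>(a, b) (a', b') = (a a', b b')\<close>.  The span of the bilinearity relations is stable under
  multiplication by the basis elements on both sides, so the two-sided ideal generated by them is
  just their span, and the quotient is the usual tensor product over the complex numbers.\<close>

datatype ('a, 'b) pure_pair = Pure (left: 'a) (right: 'b)

instantiation pure_pair :: (monoid_mult, monoid_mult) monoid_add
begin

definition zero_pure_pair :: "('a, 'b) pure_pair" where "zero_pure_pair = Pure 1 1"

definition plus_pure_pair :: "('a, 'b) pure_pair \<Rightarrow> ('a, 'b) pure_pair \<Rightarrow> ('a, 'b) pure_pair" where
  "plus_pure_pair u v = Pure (left u * left v) (right u * right v)"

instance
  by standard (simp_all add: zero_pure_pair_def plus_pure_pair_def mult.assoc)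

end

definition pure :: "'a \<Rightarrow> 'b \<Rightarrow> (('a, 'b) pure_pair \<Rightarrow>\<^sub>0 complex)" where
  "pure a b = Poly_Mapping.single (Pure a b) 1"

definition tensor_relations ::
    "(('a::complex_algebra, 'b::complex_algebra) pure_pair \<Rightarrow>\<^sub>0 complex) set" where
  "tensor_relations =
     {pure (a + a') b - (pure a b + pure a' b) | a a' b. True} \<union>
     {pure a (b + b') - (pure a b + pure a b') | a b b'. True} \<union>
     {pure (c *\<^sub>C a) b - c *\<^sub>C pure a b | c a b. True} \<union>
     {pure a (c *\<^sub>C b) - c *\<^sub>C pure a b | c a b. True}"

quotient_type (overloaded) ('a, 'b) tensor =
    "('a::complex_algebra, 'b::complex_algebra) pure_pair \<Rightarrow>\<^sub>0 complex" / "cong_ideal tensor_relations"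
  by (rule equivp_cong_ideal)

instantiation tensor :: (complex_algebra, complex_algebra) complex_algebra
begin

lift_definition zero_tensor :: "('a, 'b) tensor" is 0 .
lift_definition one_tensor :: "('a, 'b) tensor" is 1 .
lift_definition plus_tensor :: "('a, 'b) tensor \<Rightarrow> ('a, 'b) tensor \<Rightarrow> ('a, 'b) tensor" is "(+)"
  by (rule cong_ideal_add)
lift_definition uminus_tensor :: "('a, 'b) tensor \<Rightarrow> ('a, 'b) tensor" is uminus
  by (rule cong_ideal_uminus)
lift_definition minus_tensor :: "('a, 'b) tensor \<Rightarrow> ('a, 'b) tensor \<Rightarrow> ('a, 'b) tensor" is "(-)"
  by (rule cong_ideal_diff)
lift_definition times_tensor :: "('a, 'b) tensor \<Rightarrow> ('a, 'b) tensor \<Rightarrow> ('a, 'b) tensor" is "(*)"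
  by (rule cong_ideal_mult)
lift_definition scaleC_tensor :: "complex \<Rightarrow> ('a, 'b) tensor \<Rightarrow> ('a, 'b) tensor" is scaleC
  by (rule cong_ideal_scaleC)

instance
  by (standard; transfer)
    (simp_all add: algebra_simps scaleC_add_right scaleC_add_left scaleC_scaleC scaleC_one
      mult_scaleC_left mult_scaleC_right cong_ideal_def ideal_generated.zero)

end

lift_definition tens :: "'a::complex_algebra \<Rightarrow> 'b::complex_algebra \<Rightarrow> ('a, 'b) tensor"
  (infixr "\<otimes>" 75) is pure .

lemma tens_add_left: "(a + a') \<otimes> b = a \<otimes> b + a' \<otimes> b"
  by transfer (rule cong_ideal_relation, unfold tensor_relations_def, blast)

lemma tens_add_right: "a \<otimes> (b + b') = a \<otimes> b + a \<otimes> b'"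
  by transfer (rule cong_ideal_relation, unfold tensor_relations_def, blast)

lemma tens_scaleC_left: "(c *\<^sub>C a) \<otimes> b = c *\<^sub>C (a \<otimes> b)"
  by transfer (rule cong_ideal_relation, unfold tensor_relations_def, blast)

lemma tens_scaleC_right: "a \<otimes> (c *\<^sub>C b) = c *\<^sub>C (a \<otimes> b)"
  by transfer (rule cong_ideal_relation, unfold tensor_relations_def, blast)

lemma tens_mult: "(a \<otimes> b) * (a' \<otimes> b') = (a * a') \<otimes> (b * b')"
  by transfer (simp add: pure_def mult_single plus_pure_pair_def cong_ideal_def ideal_generated.zero)

lemma tens_one: "1 \<otimes> 1 = 1"
  by transfer (simp add: pure_def cong_ideal_def ideal_generated.zero flip: zero_pure_pair_def)

lemma tens_diff_left: "(a - a') \<otimes> b = a \<otimes> b - a' \<otimes> b"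
  using tens_add_left[of "a - a'" a' b] by (simp add: algebra_simps)

lemma tens_diff_right: "a \<otimes> (b - b') = a \<otimes> b - a \<otimes> b'"
  using tens_add_right[of a "b - b'" b'] by (simp add: algebra_simps)

text \<open>The homomorphism \<open>\<delta>\<close>, determined by \<open>x \<mapsto> x \<otimes> 1 + 1 \<otimes> x\<close> on the Lie algebra.\<close>

lift_definition coproduct :: "'g::complex_lie_algebra uea \<Rightarrow> ('g uea, 'g uea) tensor"
  is "free_eval (\<lambda>x. uea_of x \<otimes> 1 + 1 \<otimes> uea_of x)"
proof -
  let ?d = "\<lambda>x::'g. uea_of x \<otimes> 1 + 1 \<otimes> uea_of x :: ('g uea, 'g uea) tensor"
  fix p q :: "'g fword \<Rightarrow>\<^sub>0 complex"
  assume "cong_ideal uea_relations p q"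
  note hom = complex_algebra_hom_free_eval[of ?d]
  show "free_eval ?d p = free_eval ?d q"
  proof (rule hom_cong_ideal[OF hom _ \<open>cong_ideal uea_relations p q\<close>])
    fix s :: "'g fword \<Rightarrow>\<^sub>0 complex"
    assume "s \<in> uea_relations"
    then consider
        (add) x y where "s = free_gen (x + y) - (free_gen x + free_gen y)"
      | (scaleC) c x where "s = free_gen (c *\<^sub>C x) - c *\<^sub>C free_gen x"
      | (bracket) x y where "s = commutator (free_gen x) (free_gen y) - free_gen (bracket x y)"
      unfolding uea_relations_def by blast
    then show "free_eval ?d s = 0"
    proof cases
      case add
      then show ?thesis
        by (simp add: complex_algebra_hom_diff[OF hom] complex_algebra_hom_add[OF hom]
            uea_of_add tens_add_left tens_add_right)
    next
      case scaleC
      then show ?thesis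
        by (simp add: complex_algebra_hom_diff[OF hom] complex_algebra_hom_scaleC[OF hom]
            uea_of_scaleC tens_scaleC_left tens_scaleC_right scaleC_add_right)
    next
      case bracket
      then show ?thesis
        by (simp add: complex_algebra_hom_diff[OF hom] complex_algebra_hom_mult[OF hom]
            commutator_def tens_mult tens_diff_left tens_diff_right distrib_left distrib_right
            flip: uea_of_bracket)
    qed
  qed
qed

lemma complex_algebra_hom_coproduct: "complex_algebra_hom (coproduct :: 'g::complex_lie_algebra uea \<Rightarrow> _)"
proof -
  note hom = complex_algebra_hom_free_eval
  have "coproduct (1 :: 'g uea) = 1"
    by transfer (rule complex_algebra_hom_one[OF hom])
  moreover have "coproduct (x + y) = coproduct x + coproduct y" for x y :: "'g uea"
    by transfer (rule complex_algebra_hom_add[OF hom])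
  moreover have "coproduct (x * y) = coproduct x * coproduct y" for x y :: "'g uea"
    by transfer (rule complex_algebra_hom_mult[OF hom])
  moreover have "coproduct (c *\<^sub>C x) = c *\<^sub>C coproduct x" for c and x :: "'g uea"
    by transfer (rule complex_algebra_hom_scaleC[OF hom])
  ultimately show ?thesis
    by (simp add: complex_algebra_hom_def)
qed

lemma coproduct_uea_of [simp]: "coproduct (uea_of x) = uea_of x \<otimes> 1 + 1 \<otimes> uea_of x"
  by transfer simp


section \<open>The Lie algebra \<open>sl(3)\<close>\<close>

text \<open>\<open>gl(3)\<close> is realised by matrices with the commutator, \<open>sl(3)\<close> is its quotient by the scalar
  matrices \<^term>\<open>mat c\<close>.  Indices live in the three-element type \<open>3\<close>, where \<open>3 = 0\<close>.\<close>

quotient_type sl3 = "complex^3^3" / "\<lambda>M N. \<exists>c. M - N = mat c"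
proof (rule equivpI)
  have "mat 0 = (0 :: complex^3^3)"
    by (simp add: mat_def vec_eq_iff)
  then show "reflp (\<lambda>M N :: complex^3^3. \<exists>c. M - N = mat c)"
    by (metis (mono_tags, lifting) diff_self reflpI)
  show "symp (\<lambda>M N :: complex^3^3. \<exists>c. M - N = mat c)"
  proof (rule sympI, elim exE)
    fix M N :: "complex^3^3" and c
    assume "M - N = mat c"
    moreover have "mat (- c) = - (mat c :: complex^3^3)"
      by (simp add: mat_def vec_eq_iff)
    ultimately have "N - M = mat (- c)"
      by (metis minus_diff_eq)
    then show "\<exists>c. N - M = mat c" ..
  qed
  show "transp (\<lambda>M N :: complex^3^3. \<exists>c. M - N = mat c)"
  proof (rule transpI, elim exE)
    fix M N P :: "complex^3^3" and c d
    assume "M - N = mat c" "N - P = mat d"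
    moreover have "mat (c + d) = (mat c + mat d :: complex^3^3)"
      by (simp add: mat_def vec_eq_iff)
    ultimately have "M - P = mat (c + d)"
      by (metis diff_add_cancel add_diff_eq)
    then show "\<exists>c. M - P = mat c" ..
  qed
qed

lemma
  fixes M :: "complex^3^3"
  shows mat_matrix_mult: "mat c ** M = (\<chi> i j. c * M $ i $ j)"
    and matrix_mult_mat: "M ** mat c = (\<chi> i j. c * M $ i $ j)"
  by (simp_all add: matrix_matrix_mult_def mat_def vec_eq_iff if_distrib if_distribR mult.commute cong: if_cong)

lemma matrix_add_rdistrib: "(A + B) ** C = A ** C + B ** (C :: complex^3^3)"
  by (simp add: matrix_matrix_mult_def vec_eq_iff distrib_right sum.distrib)

lemma matrix_diff_rdistrib: "(A - B) ** C = A ** C - B ** (C :: complex^3^3)"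
  by (simp add: matrix_matrix_mult_def vec_eq_iff left_diff_distrib sum_subtractf)

lemma matrix_diff_ldistrib: "A ** (B - C) = A ** B - A ** (C :: complex^3^3)"
  by (simp add: matrix_matrix_mult_def vec_eq_iff right_diff_distrib sum_subtractf)

instantiation sl3 :: complex_lie_algebra
begin

lift_definition zero_sl3 :: sl3 is 0 .

lift_definition plus_sl3 :: "sl3 \<Rightarrow> sl3 \<Rightarrow> sl3" is "(+)"
proof (elim exE)
  fix M M' N N' :: "complex^3^3" and c d
  assume "M - M' = mat c" "N - N' = mat d"
  then have "M + N - (M' + N') = mat (c + d)"
    by (simp add: mat_def vec_eq_iff algebra_simps)
  then show "\<exists>c. M + N - (M' + N') = mat c" ..
qed

lift_definition uminus_sl3 :: "sl3 \<Rightarrow> sl3" is uminus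
proof (elim exE)
  fix M M' :: "complex^3^3" and c
  assume "M - M' = mat c"
  then have "- M - - M' = mat (- c)"
    by (simp add: mat_def vec_eq_iff algebra_simps)
  then show "\<exists>c. - M - - M' = mat c" ..
qed

definition minus_sl3 :: "sl3 \<Rightarrow> sl3 \<Rightarrow> sl3" where "minus_sl3 x y = x + - y"

lift_definition scaleC_sl3 :: "complex \<Rightarrow> sl3 \<Rightarrow> sl3" is "\<lambda>a M. \<chi> i j. a * M $ i $ j"
proof (elim exE)
  fix a :: complex and M M' :: "complex^3^3" and c
  assume "M - M' = mat c"
  then have "(\<chi> i j. a * M $ i $ j) - (\<chi> i j. a * M' $ i $ j) = mat (a * c)"
    by (simp add: mat_def vec_eq_iff flip: right_diff_distrib)
  then show "\<exists>c. (\<chi> i j. a * M $ i $ j) - (\<chi> i j. a * M' $ i $ j) = mat c" ..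
qed

lift_definition bracket_sl3 :: "sl3 \<Rightarrow> sl3 \<Rightarrow> sl3" is "\<lambda>M N. M ** N - N ** M"
proof (elim exE)
  fix M M' N N' :: "complex^3^3" and c d
  assume "M - M' = mat c" "N - N' = mat d"
  then have M: "M = M' + mat c" and N: "N = N' + mat d"
    by (simp_all add: algebra_simps)
  have "M ** N - N ** M - (M' ** N' - N' ** M') = mat 0"
    by (simp add: M N matrix_add_ldistrib matrix_add_rdistrib mat_matrix_mult
        matrix_mult_mat) (simp add: mat_def vec_eq_iff algebra_simps)
  then show "\<exists>c. M ** N - N ** M - (M' ** N' - N' ** M') = mat c" ..
qed

instance
proof
  have refl: "\<exists>c. M - N = mat c" if "M = N" for M N :: "complex^3^3"
    using that by (intro exI[of _ 0]) (simp add: mat_def vec_eq_iff)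
  fix a b :: complex and x y z :: sl3
  show "x + y + z = x + (y + z)" by transfer (rule refl, simp add: add.assoc)
  show "x + y = y + x" by transfer (rule refl, simp add: add.commute)
  show "0 + x = x" by transfer (rule refl, simp)
  show "- x + x = 0" by transfer (rule refl, simp)
  show "x - y = x + - y" by (simp add: minus_sl3_def)
  show "a *\<^sub>C (x + y) = a *\<^sub>C x + a *\<^sub>C y"
    by transfer (rule refl, simp add: vec_eq_iff algebra_simps)
  show "(a + b) *\<^sub>C x = a *\<^sub>C x + b *\<^sub>C x"
    by transfer (rule refl, simp add: vec_eq_iff algebra_simps)
  show "a *\<^sub>C b *\<^sub>C x = (a * b) *\<^sub>C x"
    by transfer (rule refl, simp add: vec_eq_iff algebra_simps)
  show "1 *\<^sub>C x = x"
    by transfer (rule refl, simp add: vec_eq_iff)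
  show "bracket (x + y) z = bracket x z + bracket y z"
    by transfer (rule refl, simp add: matrix_add_ldistrib matrix_add_rdistrib)
  show "bracket x (y + z) = bracket x y + bracket x z"
    by transfer (rule refl, simp add: matrix_add_ldistrib matrix_add_rdistrib)
  show "bracket (a *\<^sub>C x) y = a *\<^sub>C bracket x y"
    by transfer (rule refl, simp add: matrix_matrix_mult_def vec_eq_iff sum_3 algebra_simps)
  show "bracket x (a *\<^sub>C y) = a *\<^sub>C bracket x y"
    by transfer (rule refl, simp add: matrix_matrix_mult_def vec_eq_iff sum_3 algebra_simps)
  show "bracket x x = 0"
    by transfer (rule refl, simp)
  show "bracket x (bracket y z) + bracket y (bracket z x) + bracket z (bracket x y) = 0"
    by transfer (rule refl, simp add: matrix_diff_ldistrib matrix_diff_rdistrib matrix_mul_assoc)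
qed

end

lift_definition e_sl3 :: "3 \<Rightarrow> 3 \<Rightarrow> sl3" is "\<lambda>p q. \<chi> i j. if i = p \<and> j = q then 1 else 0" .

lemma matrix_unit_mult:
  "(\<chi> i j. if i = p \<and> j = q then 1 else 0) ** (\<chi> i j. if i = r \<and> j = s then 1 else 0) =
   ((\<chi> i j. if q = r \<and> i = p \<and> j = s then 1 else 0) :: complex^3^3)"
proof -
  have "(\<Sum>k\<in>UNIV. (if i = p \<and> k = q then 1 else 0) * (if k = r \<and> j = s then 1 else 0)) =
      (if q = r \<and> i = p \<and> j = s then 1 else (0::complex))" for i j
  proof -
    have "(\<Sum>k\<in>UNIV. (if i = p \<and> k = q then 1 else 0) * (if k = r \<and> j = s then 1 else 0)) =
        (\<Sum>k\<in>UNIV. if k = q then (if q = r \<and> i = p \<and> j = s then 1 else (0::complex)) else 0)"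
      by (rule sum.cong) auto
    then show ?thesis by simp
  qed
  then show ?thesis
    by (simp add: matrix_matrix_mult_def)
qed

lemma bracket_e_sl3:
  "bracket (e_sl3 p q) (e_sl3 r s) =
     (if q = r then e_sl3 p s else 0) - (if s = p then e_sl3 r q else 0)"
proof -
  have "bracket (e_sl3 p q) (e_sl3 r s) =
     (if q = r then 1 else 0) *\<^sub>C e_sl3 p s + (- (if s = p then 1 else 0)) *\<^sub>C e_sl3 r q"
    by (transfer, rule exI[of _ 0]) (simp add: matrix_unit_mult, simp add: vec_eq_iff mat_def)
  moreover have "(- 1) *\<^sub>C x = - x" for x :: sl3
    by transfer (rule exI[of _ 0], simp add: vec_eq_iff mat_def)
  ultimately show ?thesis
    by (simp add: scaleC_one)
qed

lemma e_sl3_trace: "e_sl3 1 1 + e_sl3 2 2 + e_sl3 3 3 = 0"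
  by (transfer, rule exI[of _ 1]) (simp add: vec_eq_iff mat_def forall_3)


section \<open>The algebra \<open>Z\<^sub>2(sl(3))\<close>\<close>

definition E :: "3 \<Rightarrow> 3 \<Rightarrow> sl3 uea" where
  "E p q = uea_of (e_sl3 p q)"

definition casimir2 :: "sl3 uea" where
  "casimir2 = (\<Sum>i\<^sub>1\<in>UNIV. \<Sum>i\<^sub>2\<in>UNIV. E i\<^sub>2 i\<^sub>1 * E i\<^sub>1 i\<^sub>2)"

definition casimir3 :: "sl3 uea" where
  "casimir3 = (\<Sum>i\<^sub>1\<in>UNIV. \<Sum>i\<^sub>2\<in>UNIV. \<Sum>i\<^sub>3\<in>UNIV. E i\<^sub>2 i\<^sub>1 * E i\<^sub>3 i\<^sub>2 * E i\<^sub>1 i\<^sub>3)"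

definition casimir3_bar :: "sl3 uea" where
  "casimir3_bar = (\<Sum>i\<^sub>1\<in>UNIV. \<Sum>i\<^sub>2\<in>UNIV. \<Sum>i\<^sub>3\<in>UNIV. E i\<^sub>1 i\<^sub>2 * E i\<^sub>2 i\<^sub>3 * E i\<^sub>3 i\<^sub>1)"

type_synonym usl3_2 = "(sl3 uea, sl3 uea) tensor"

datatype leg = Fst | Snd

fun E_leg :: "leg \<Rightarrow> 3 \<Rightarrow> 3 \<Rightarrow> usl3_2" where
  "E_leg Fst p q = E p q \<otimes> 1"
| "E_leg Snd p q = 1 \<otimes> E p q"

text \<open>\<open>T\<^bsup>(a\<^sub>1,\<dots>,a\<^sub>d)\<^esup>\<close>: the list \<open>js\<close> holds the summation indices \<open>i\<^sub>1,\<dots>,i\<^sub>d\<close>, and \<open>i\<^bsub>d+1\<^esub> = i\<^sub>1\<close>.\<close>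

definition polarised_trace :: "leg list \<Rightarrow> usl3_2" where
  "polarised_trace as =
     (\<Sum>js | length js = length as.
        prod_list (map (\<lambda>m. E_leg (as ! m) (js ! (Suc m mod length as)) (js ! m)) [0..<length as]))"

abbreviation "T11 \<equiv> polarised_trace [Fst, Fst]"
abbreviation "T12 \<equiv> polarised_trace [Fst, Snd]"
abbreviation "T22 \<equiv> polarised_trace [Snd, Snd]"
abbreviation "T112 \<equiv> polarised_trace [Fst, Fst, Snd]"
abbreviation "T122 \<equiv> polarised_trace [Fst, Snd, Snd]"
abbreviation "T1122 \<equiv> polarised_trace [Fst, Fst, Snd, Snd]"

definition Z2_sl3 :: "usl3_2 set" where
  "Z2_sl3 = subalgebra_generated {polarised_trace as | as. as \<noteq> []}"

definition k_elem :: "3 \<Rightarrow> usl3_2" where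
  "k_elem i = (if i = 1 then casimir2 \<otimes> 1 else if i = 2 then 1 \<otimes> casimir2 else coproduct casimir2)"

definition l_elem :: "3 \<Rightarrow> usl3_2" where
  "l_elem i = (let c = (1/2) *\<^sub>C (casimir3 + casimir3_bar) in
     if i = 1 then c \<otimes> 1 else if i = 2 then 1 \<otimes> c else - coproduct c)"

definition X_elem :: usl3_2 where
  "X_elem = (1/2) *\<^sub>C (T112 - T122) + (1/3) *\<^sub>C (l_elem 1 - l_elem 2)"

definition Y_elem :: usl3_2 where
  "Y_elem = T1122 + (3/2) *\<^sub>C (T112 + T122) - (1/12) *\<^sub>C T12\<^sup>2 - (5/12) *\<^sub>C (T11 * T22) + (5/2) *\<^sub>C T12"

definition Z_elem :: usl3_2 where
  "Z_elem = commutator X_elem Y_elem"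


section \<open>The algebra \<open>\<A>\<close>\<close>

datatype param = K 3 | L 3

text \<open>The polynomial ring in the six indeterminates; exponents are finitely supported maps from
  \<^typ>\<open>param\<close> to the naturals.\<close>

type_synonym ppoly = "(param \<Rightarrow>\<^sub>0 nat) \<Rightarrow>\<^sub>0 complex"

definition var :: "param \<Rightarrow> ppoly" where
  "var v = Poly_Mapping.single (Poly_Mapping.single v 1) 1"

definition perm_act :: "(3 \<Rightarrow> 3) \<Rightarrow> ppoly \<Rightarrow> ppoly" where
  "perm_act \<pi> = linear_extension (\<lambda>m.
     (\<Prod>i\<in>UNIV. var (K (\<pi> i)) ^ Poly_Mapping.lookup m (K i)) * (\<Prod>i\<in>UNIV. var (L (\<pi> i)) ^ Poly_Mapping.lookup m (L i)))"

lemma complex_algebra_hom_perm_act: "complex_algebra_hom (perm_act \<pi>)"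
  unfolding perm_act_def
  by (rule complex_algebra_hom_linear_extension)
    (simp_all add: lookup_add power_add prod.distrib mult_ac)

lemma perm_act_var:
  "perm_act \<pi> (var (K i)) = var (K (\<pi> i))" "perm_act \<pi> (var (L i)) = var (L (\<pi> i))"
proof -
  have *: "(\<Prod>j\<in>UNIV. f j ^ (if i = j then 1 else 0)) = f i" for f :: "3 \<Rightarrow> ppoly"
  proof -
    have "(\<Prod>j\<in>UNIV. f j ^ (if i = j then 1 else 0)) = (\<Prod>j\<in>UNIV. if i = j then f j else 1)"
      by (rule prod.cong) simp_all
    also have "\<dots> = f i"
      by (rule trans[OF prod.delta'[OF finite]]) simp
    finally show ?thesis .
  qed
  have sameK: "Poly_Mapping.lookup (Poly_Mapping.single (K i) (1::nat)) (K j) = (if i = j then 1 else 0)" for j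
    by (simp add: lookup_single when_def)
  have otherK: "Poly_Mapping.lookup (Poly_Mapping.single (K i) (1::nat)) (L j) = 0" for j
    by (simp add: lookup_single when_def)
  show "perm_act \<pi> (var (K i)) = var (K (\<pi> i))"
    unfolding perm_act_def var_def[of "K i"] linear_extension_single sameK otherK scaleC_one
    by (simp only: * power_0 prod.neutral_const mult_1_right)
  have sameL: "Poly_Mapping.lookup (Poly_Mapping.single (L i) (1::nat)) (L j) = (if i = j then 1 else 0)" for j
    by (simp add: lookup_single when_def)
  have otherL: "Poly_Mapping.lookup (Poly_Mapping.single (L i) (1::nat)) (K j) = 0" for j
    by (simp add: lookup_single when_def)
  show "perm_act \<pi> (var (L i)) = var (L (\<pi> i))"
    unfolding perm_act_def var_def[of "L i"] linear_extension_single sameL otherL scaleC_one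
    by (simp only: * power_0 prod.neutral_const mult_1_left)
qed

definition sym_plus :: "ppoly \<Rightarrow> ppoly" where
  "sym_plus f = (1/6) *\<^sub>C (\<Sum>\<pi> | \<pi> permutes UNIV. perm_act \<pi> f)"

definition sym_minus :: "ppoly \<Rightarrow> ppoly" where
  "sym_minus f = (1/6) *\<^sub>C (\<Sum>\<pi> | \<pi> permutes UNIV. of_int (sign \<pi>) * perm_act \<pi> f)"

abbreviation "k\<^sub>1 \<equiv> var (K 1)"
abbreviation "k\<^sub>2 \<equiv> var (K 2)"
abbreviation "k\<^sub>3 \<equiv> var (K 3)"
abbreviation "l\<^sub>1 \<equiv> var (L 1)"
abbreviation "l\<^sub>2 \<equiv> var (L 2)"
abbreviation "l\<^sub>3 \<equiv> var (L 3)"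

definition a\<^sub>2 :: ppoly where
  "a\<^sub>2 = (1/2) *\<^sub>C (k\<^sub>1 + k\<^sub>2 + k\<^sub>3)"

definition a\<^sub>5 :: ppoly where
  "a\<^sub>5 = sym_minus (2 * k\<^sub>2 * l\<^sub>1)"

definition a\<^sub>6 :: ppoly where
  "a\<^sub>6 = sym_plus (
     (1/16) *\<^sub>C (- (k\<^sub>1^3) + 2 * k\<^sub>1^2 * k\<^sub>2 - 6 * k\<^sub>1 * k\<^sub>2 * k\<^sub>3)
     + (3/8) *\<^sub>C (k\<^sub>1^2 - 2 * k\<^sub>1 * k\<^sub>2)
     + (1/6) *\<^sub>C l\<^sub>1^2 - (5/3) *\<^sub>C (l\<^sub>1 * l\<^sub>2))"

definition a\<^sub>8 :: ppoly where
  "a\<^sub>8 = sym_plus (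
     (1/128) *\<^sub>C (k\<^sub>1^4 - 8 * k\<^sub>1^3 * k\<^sub>2 + 6 * k\<^sub>1^2 * k\<^sub>2^2 + 4 * k\<^sub>1^2 * k\<^sub>2 * k\<^sub>3)
     - (1/32) *\<^sub>C (3 * k\<^sub>1^3 - 6 * k\<^sub>1^2 * k\<^sub>2 + 2 * k\<^sub>1 * k\<^sub>2 * k\<^sub>3)
     - (1/24) *\<^sub>C (k\<^sub>1 * (l\<^sub>1^2 - 6 * l\<^sub>2^2 + 4 * l\<^sub>1 * l\<^sub>2 - 26 * l\<^sub>2 * l\<^sub>3))
     + (1/2) *\<^sub>C l\<^sub>1^2 + l\<^sub>1 * l\<^sub>2)"

definition a\<^sub>9 :: ppoly where
  "a\<^sub>9 = sym_minus (l\<^sub>2 * (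
     (- 4/9) *\<^sub>C l\<^sub>1^2
     + (1/24) *\<^sub>C (k\<^sub>1^3 - 2 * k\<^sub>1^2 * k\<^sub>2 + k\<^sub>1 * k\<^sub>2^2 + 9 * k\<^sub>1^2 * k\<^sub>3)
     + (1/2) *\<^sub>C (k\<^sub>1^2 - k\<^sub>1 * k\<^sub>2)))"

datatype A_gen = GenA | GenB | GenC

type_synonym free_A = "A_gen fword \<Rightarrow>\<^sub>0 ppoly"

definition const :: "ppoly \<Rightarrow> free_A" where
  "const = Poly_Mapping.single 0"

definition A_relations :: "free_A set" where
  "A_relations = (let A = free_gen GenA; B = free_gen GenB; C = free_gen GenC in
     {commutator A B - C,
      commutator A C - (- 6 * B^2 + const a\<^sub>2 * A^2 + const a\<^sub>5 * A + const a\<^sub>8),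
      commutator B C - (- 2 * A^3 - const a\<^sub>2 * (A * B + B * A) - const a\<^sub>5 * B + const a\<^sub>6 * A + const a\<^sub>9)})"

quotient_type alg_A = free_A / "cong_ideal A_relations"
  by (rule equivp_cong_ideal)

instantiation alg_A :: complex_algebra
begin

lift_definition zero_alg_A :: alg_A is 0 .
lift_definition one_alg_A :: alg_A is 1 .
lift_definition plus_alg_A :: "alg_A \<Rightarrow> alg_A \<Rightarrow> alg_A" is "(+)" by (rule cong_ideal_add)
lift_definition uminus_alg_A :: "alg_A \<Rightarrow> alg_A" is uminus by (rule cong_ideal_uminus)
lift_definition minus_alg_A :: "alg_A \<Rightarrow> alg_A \<Rightarrow> alg_A" is "(-)" by (rule cong_ideal_diff)
lift_definition times_alg_A :: "alg_A \<Rightarrow> alg_A \<Rightarrow> alg_A" is "(*)" by (rule cong_ideal_mult)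
lift_definition scaleC_alg_A :: "complex \<Rightarrow> alg_A \<Rightarrow> alg_A" is scaleC by (rule cong_ideal_scaleC)

instance
  by (standard; transfer)
    (simp_all add: algebra_simps scaleC_add_right scaleC_add_left scaleC_scaleC scaleC_one
      mult_scaleC_left mult_scaleC_right cong_ideal_def ideal_generated.zero)

end

lift_definition gen_A :: "A_gen \<Rightarrow> alg_A" is free_gen .

lift_definition central_A :: "param \<Rightarrow> alg_A" is "\<lambda>v. const (var v)" .

end

theory Submission
  imports Defs
begin

text \<open>Let \<open>a\<close> and \<open>b\<close> be the \<open>3 \<times> 3\<close> matrices formed by the generators of the two tensor factors, shifted
  by the identity.  Antisymmetrising over four indices with three values gives noncommutative
  Cayley--Hamilton identities for \<open>a\<close> and \<open>b\<close>.  They reduce every word in \<open>a\<close> and \<open>b\<close> to a combination of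
  18 normal words, with coefficients in the algebra generated by the Casimir elements and by the traces
  of \<open>ab\<close>, \<open>aab\<close>, \<open>abb\<close>, \<open>aabb\<close> and \<open>aababb\<close>.  Up to central summands, \<open>X\<close> and \<open>Y\<close> are the traces of \<open>aab\<close>
  and \<open>aabb\<close>, and the trace of a word reduced in this way is a polynomial in these nine elements.  So the
  defining relations of \<open>\<A>\<close> become identities of such polynomials, which are verified by evaluating the
  reduction, and the nine elements are recovered successively from the images of the generators of \<open>\<A>\<close>.\<close>

section \<open>Matrices over a noncommutative algebra\<close>

text \<open>The shift by the identity gives each matrix trace 3, which is also its size; this
  cancels the quadratic term of its cubic identity and leaves
  \<open>a * a * a = diag \<kappa> * a + diag \<nu>\<close>. The obstacle is that little commutes:
  the entries of \<open>a\<close> do not commute with each other, traces are not cyclic, and a trace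
  such as that of \<open>aab\<close> commutes neither with \<open>a\<close> nor with
  \<open>b\<close>. What helps is that entries of \<open>a\<close> commute with entries of
  \<open>b\<close>, and that the commutator of such a trace with a letter is again a combination of
  words, so coefficients can be collected on the left. Cyclicity survives for \<open>a + b\<close>,
  because all words are tensor operators for the diagonal action; this supplies missing traces. The
  trace of \<open>aababb\<close> is recovered from \<open>Z\<close>: it occurs linearly, with a
  nonzero constant coefficient, in the commutator of the traces of \<open>aab\<close> and
  \<open>aabb\<close>. The procedures are built so that a row is added only when it can be
  justified. Soundness is therefore proved in general, while completeness of the tables and the
  identities themselves are left to one evaluation over the integers.\<close>

datatype 'a mat3 = Mat (ent: "3 \<Rightarrow> 3 \<Rightarrow> 'a")

instantiation mat3 :: (complex_algebra) complex_algebra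
begin
definition "0 = Mat (\<lambda>i j. 0)"
definition "1 = Mat (\<lambda>i j. if i = j then 1 else 0)"
definition "M + N = Mat (\<lambda>i j. ent M i j + ent N i j)"
definition "- M = Mat (\<lambda>i j. - ent M i j)"
definition "M - N = Mat (\<lambda>i j. ent M i j - ent N i j)"
definition "M * N = Mat (\<lambda>i j. \<Sum>k\<in>UNIV. ent M i k * ent N k j)"
definition "c *\<^sub>C M = Mat (\<lambda>i j. c *\<^sub>C ent M i j)"

instance
proof
  fix x y z :: "'a mat3" and c d :: complex
  show "x * y * z = x * (y * z)"
    by (auto simp: times_mat3_def fun_eq_iff sum_distrib_left sum_distrib_right mult.assoc intro: sum.swap)
  have "(\<Sum>k\<in>UNIV. (if i = k then 1 else 0) * f k) = f i"
    and "(\<Sum>k\<in>UNIV. f k * (if k = i then 1 else 0)) = f i" for i :: 3 and f :: "3 \<Rightarrow> 'a"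
    by (simp_all add: if_distrib if_distribR cong: if_cong)
  then show "1 * x = x" "x * 1 = x"
    by (simp_all add: times_mat3_def one_mat3_def)
  show "(c *\<^sub>C x) * y = c *\<^sub>C (x * y)" "x * (c *\<^sub>C y) = c *\<^sub>C (x * y)"
    by (simp_all add: times_mat3_def scaleC_mat3_def mult_scaleC_left mult_scaleC_right scaleC_sum_right)
qed (simp_all add: zero_mat3_def plus_mat3_def uminus_mat3_def minus_mat3_def times_mat3_def
    scaleC_mat3_def algebra_simps sum.distrib scaleC_add_right scaleC_add_left scaleC_scaleC scaleC_one)
end

lemma ent_simps [simp]:
  "ent 0 i j = 0" "ent 1 i j = (if i = j then 1 else 0)"
  "ent (M + N) i j = ent M i j + ent N i j" "ent (M - N) i j = ent M i j - ent N i j"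
  "ent (- M) i j = - ent M i j" "ent (c *\<^sub>C M) i j = c *\<^sub>C ent M i j"
  by (simp_all add: zero_mat3_def one_mat3_def plus_mat3_def minus_mat3_def uminus_mat3_def scaleC_mat3_def)

lemma ent_mult: "ent (M * N) i j = (\<Sum>k\<in>UNIV. ent M i k * ent N k j)"
  by (simp add: times_mat3_def)

lemma mat3_eqI: "(\<And>i j. ent M i j = ent N i j) \<Longrightarrow> M = N"
  by (simp add: mat3.expand fun_eq_iff)

text \<open>Scalars of a noncommutative algebra have to act as matrices on both sides, since
  \<open>diag z * M\<close> and \<open>M * diag z\<close> differ.\<close>

definition diag :: "'a::complex_algebra \<Rightarrow> 'a mat3" where
  "diag z = Mat (\<lambda>i j. if i = j then z else 0)"

lemma ent_diag [simp]: "ent (diag z) i j = (if i = j then z else 0)"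
  by (simp add: diag_def)

lemma sum_if_mult [simp]:
  fixes f :: "3 \<Rightarrow> 'a::complex_algebra"
  shows "(\<Sum>k\<in>UNIV. (if i = k then z else 0) * f k) = z * f i"
    "(\<Sum>k\<in>UNIV. (if k = i then z else 0) * f k) = z * f i"
    "(\<Sum>k\<in>UNIV. f k * (if k = i then z else 0)) = f i * z"
    "(\<Sum>k\<in>UNIV. f k * (if i = k then z else 0)) = f i * z"
  by (simp_all add: if_distrib if_distribR cong: if_cong)

lemma ent_diag_mult [simp]:
  "ent (diag z * M) i j = z * ent M i j" "ent (M * diag z) i j = ent M i j * z"
  by (simp_all add: ent_mult)

lemma complex_algebra_hom_diag: "complex_algebra_hom diag"
  unfolding complex_algebra_hom_def by (auto intro!: mat3_eqI)

lemmas diag_simps = complex_algebra_hom_one[OF complex_algebra_hom_diag]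
  complex_algebra_hom_add[OF complex_algebra_hom_diag] complex_algebra_hom_mult[OF complex_algebra_hom_diag]
  complex_algebra_hom_scaleC[OF complex_algebra_hom_diag] complex_algebra_hom_zero[OF complex_algebra_hom_diag]
  complex_algebra_hom_diff[OF complex_algebra_hom_diag]

definition tr :: "'a::complex_algebra mat3 \<Rightarrow> 'a" where
  "tr M = (\<Sum>i\<in>UNIV. ent M i i)"

lemma scaleC_numeral_Bit:
  fixes x :: "'a::complex_vector"
  shows "numeral (num.Bit0 n) *\<^sub>C x = numeral n *\<^sub>C x + numeral n *\<^sub>C x"
    "numeral (num.Bit1 n) *\<^sub>C x = numeral n *\<^sub>C x + numeral n *\<^sub>C x + x"
    "numeral num.One *\<^sub>C x = x"
  by (simp_all only: numeral.simps scaleC_add_left scaleC_one)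

lemma tr_simps:
  "tr 0 = 0" "tr (M + N) = tr M + tr N" "tr (M - N) = tr M - tr N" "tr (- M) = - tr M"
  "tr (c *\<^sub>C M) = c *\<^sub>C tr M" "tr (diag z * M) = z * tr M" "tr (M * diag z) = tr M * z"
  by (simp_all add: tr_def sum.distrib sum_subtractf sum_negf scaleC_sum_right sum_distrib_left sum_distrib_right)

lemma tr_one: "tr 1 = 3 *\<^sub>C 1"
  by (simp add: tr_def sum_3 scaleC_numeral_Bit del: numeral_One)

text \<open>The entries are multiplied in the order opposite to that of \<^term>\<open>N * M\<close>.\<close>

definition rmult :: "'a::complex_algebra mat3 \<Rightarrow> 'a mat3 \<Rightarrow> 'a mat3" (infixl "\<odot>" 70) where
  "M \<odot> N = Mat (\<lambda>i j. \<Sum>k\<in>UNIV. ent M k j * ent N i k)"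

lemma ent_rmult: "ent (M \<odot> N) i j = (\<Sum>k\<in>UNIV. ent M k j * ent N i k)"
  by (simp add: rmult_def)

text \<open>Here \<open>U\<close> and \<open>W\<close> close up into a trace around an entry of
  \<open>V\<close>; without commutation rules the entries of \<open>W\<close> cannot be moved to the
  left of \<open>V\<close>.\<close>

definition tr_around :: "'a::complex_algebra mat3 \<Rightarrow> 'a mat3 \<Rightarrow> 'a mat3 \<Rightarrow> 'a mat3" where
  "tr_around U V W = Mat (\<lambda>i j. \<Sum>x\<in>UNIV. \<Sum>y\<in>UNIV. ent U x y * ent V i j * ent W y x)"

lemma ent_tr_around:
  "ent (tr_around U V W) i j = (\<Sum>x\<in>UNIV. \<Sum>y\<in>UNIV. ent U x y * ent V i j * ent W y x)"
  by (simp add: tr_around_def)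

text \<open>Antisymmetrising over four indices with three values gives zero.\<close>

lemma polarised_cayley_hamilton:
  fixes U V W :: "'a::complex_algebra mat3"
  shows "U * V * W + U * (V \<odot> W) + (U \<odot> V) * W + U \<odot> (V * W) + (U * V) \<odot> W + (U \<odot> V) \<odot> W
      + U * diag (tr V * tr W) + diag (tr U) * V * diag (tr W) + diag (tr U * tr V) * W
      + diag (tr U * tr (V * W)) + diag (tr (U * V) * tr W) + diag (tr (U * diag (tr V) * W))
    = (U * V + U \<odot> V) * diag (tr W) + U * diag (tr V) * W + (U * diag (tr V)) \<odot> W
      + diag (tr U) * (V * W + V \<odot> W)
      + U * diag (tr (V * W)) + tr_around U V W + diag (tr (U * V)) * W
      + diag (tr U * tr V * tr W) + diag (tr (U * V * W)) + diag (tr ((U \<odot> V) * W))" (is "?M = ?N")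
proof (rule mat3_eqI)
  fix i j :: 3
  \<comment> \<open>The terms are the 24 permutations of \<open>U\<close>, \<open>V\<close>,
    \<open>W\<close> and the open index pair: on the left the odd ones (six 4-cycles, six
    transpositions), on the right the even ones (the identity, eight 3-cycles, three double
    transpositions). Every term keeps the entries in the order \<open>U\<close>, \<open>V\<close>,
    \<open>W\<close>, so expanding the sums suffices and nothing has to be commuted.\<close>
  have "\<forall>i j. ent ?M i j = ent ?N i j"
    unfolding forall_3
    by (intro conjI; simp add: ent_mult ent_rmult ent_tr_around tr_def sum_3; simp only: distrib_left distrib_right mult.assoc add_ac)
  then show "ent ?M i j = ent ?N i j" by blast
qed

lemma rmult_simps:
  "(M + N) \<odot> P = M \<odot> P + N \<odot> P" "P \<odot> (M + N) = P \<odot> M + P \<odot> N"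
  "(M - N) \<odot> P = M \<odot> P - N \<odot> P" "P \<odot> (M - N) = P \<odot> M - P \<odot> N"
  "(c *\<^sub>C M) \<odot> P = c *\<^sub>C (M \<odot> P)" "P \<odot> (c *\<^sub>C M) = c *\<^sub>C (P \<odot> M)" "1 \<odot> P = P" "P \<odot> 1 = P"
  by (rule mat3_eqI; simp add: ent_rmult algebra_simps sum.distrib sum_subtractf scaleC_sum_right
      mult_scaleC_left mult_scaleC_right)+

section \<open>Commutation rules for matrices transforming under gl(3)\<close>

definition entries_commute :: "'a::complex_algebra mat3 \<Rightarrow> 'a mat3 \<Rightarrow> bool" where
  "entries_commute P Q \<longleftrightarrow> (\<forall>p q i j. ent P p q * ent Q i j = ent Q i j * ent P p q)"

lemma entries_commuteD: "entries_commute P Q \<Longrightarrow> ent P p q * ent Q i j = ent Q i j * ent P p q"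
  by (simp add: entries_commute_def)

lemma entries_commute_sym: "entries_commute P Q \<Longrightarrow> entries_commute Q P"
  by (simp add: entries_commute_def)

lemma entries_commute_mult:
  assumes "entries_commute P Q" "entries_commute P R"
  shows "entries_commute P (Q * R)"
proof -
  have "ent P p q * (ent Q i k * ent R k j) = ent Q i k * ent R k j * ent P p q" for p q i j k
  proof -
    have "ent P p q * (ent Q i k * ent R k j) = ent Q i k * (ent P p q * ent R k j)"
      by (simp add: entries_commuteD[OF assms(1)] flip: mult.assoc)
    then show ?thesis
      by (simp add: entries_commuteD[OF assms(2)] mult.assoc)
  qed
  then show ?thesis
    by (simp add: entries_commute_def ent_mult sum_distrib_left sum_distrib_right)
qed

text \<open>\<open>M\<close> transforms under the adjoint action of the entries of \<open>d\<close> as \<open>d\<close> itself does when these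
  entries satisfy the relations of \<open>gl(3)\<close>.\<close>

definition tensor_op :: "'a::complex_algebra mat3 \<Rightarrow> 'a mat3 \<Rightarrow> bool" where
  "tensor_op d M \<longleftrightarrow> (\<forall>p q i j. ent d p q * ent M i j =
     ent M i j * ent d p q + (if p = j then ent M i q else 0) - (if i = q then ent M p j else 0))"

lemma tensor_opD:
  "tensor_op d M \<Longrightarrow> ent d p q * ent M i j =
     ent M i j * ent d p q + (if p = j then ent M i q else 0) - (if i = q then ent M p j else 0)"
  by (simp add: tensor_op_def)

lemma tensor_op_one: "tensor_op d 1"
  by (auto simp: tensor_op_def)

lemma tensor_op_add: "tensor_op d M \<Longrightarrow> tensor_op d N \<Longrightarrow> tensor_op d (M + N)"
  by (simp add: tensor_op_def distrib_left distrib_right)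

text \<open>The Leibniz rule: the corrections at the contracted index are
  \<open>ent M i q * ent N p j\<close> with opposite signs and cancel.\<close>

lemma tensor_op_mult:
  assumes M: "tensor_op d M" and N: "tensor_op d N"
  shows "tensor_op d (M * N)"
proof -
  have "ent d p q * ent (M * N) i j = ent (M * N) i j * ent d p q
      + (if p = j then ent (M * N) i q else 0) - (if i = q then ent (M * N) p j else 0)" for p q i j
  proof -
    have "ent d p q * ent (M * N) i j = (\<Sum>k\<in>UNIV. (ent d p q * ent M i k) * ent N k j)"
      by (simp add: ent_mult sum_distrib_left mult.assoc)
    also have "\<dots> = (\<Sum>k\<in>UNIV. ent M i k * (ent d p q * ent N k j)
        + (if p = k then ent M i q else 0) * ent N k j - (if i = q then ent M p k * ent N k j else 0))"
      by (intro sum.cong refl) (simp add: tensor_opD[OF M] algebra_simps)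
    also have "\<dots> = (\<Sum>k\<in>UNIV. ent M i k * (ent d p q * ent N k j)) + ent M i q * ent N p j
        - (if i = q then ent (M * N) p j else 0)"
      by (simp add: sum.distrib sum_subtractf ent_mult)
    also have "(\<Sum>k\<in>UNIV. ent M i k * (ent d p q * ent N k j)) = (\<Sum>k\<in>UNIV. ent M i k * ent N k j * ent d p q
        + (if p = j then ent M i k * ent N k q else 0) - ent M i k * (if k = q then ent N p j else 0))"
      by (intro sum.cong refl) (simp add: tensor_opD[OF N] algebra_simps)
    also have "\<dots> = ent (M * N) i j * ent d p q + (if p = j then ent (M * N) i q else 0) - ent M i q * ent N p j"
      by (simp add: sum.distrib sum_subtractf ent_mult sum_distrib_right)
    finally show ?thesis by (simp add: algebra_simps)
  qed
  then show ?thesis by (simp add: tensor_op_def)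
qed

lemma tensor_op_add_left:
  assumes "tensor_op d M" "entries_commute e M" shows "tensor_op (d + e) M"
  using assms by (simp add: tensor_op_def entries_commute_def distrib_left distrib_right)

lemma tensor_op_trace:
  assumes "tensor_op d M" shows "ent d p q * tr M = tr M * ent d p q"
  by (simp add: tr_def sum_distrib_left sum_distrib_right tensor_opD[OF assms] sum.distrib sum_subtractf)

lemma tensor_op_trace_diag:
  assumes "tensor_op d M" shows "d * diag (tr M) = diag (tr M) * d"
  by (rule mat3_eqI) (simp add: tensor_op_trace[OF assms])

text \<open>Reordering the entries costs \<open>ent M k k - ent M i i\<close>, which vanishes after
  summation over both indices. This is the form of cyclicity that remains available.\<close>

lemma tensor_op_trace_mult:
  assumes "tensor_op d M" shows "tr (d * M) = tr (M * d)"
proof -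
  have "tr (d * M) = (\<Sum>i\<in>UNIV. \<Sum>k\<in>UNIV. ent M k i * ent d i k + (ent M k k - ent M i i))"
    by (simp add: tr_def ent_mult tensor_opD[OF assms] algebra_simps)
  also have "\<dots> = (\<Sum>k\<in>UNIV. \<Sum>i\<in>UNIV. ent M k i * ent d i k)"
    using sum.swap[of "\<lambda>k i. ent M k i * ent d i k" UNIV UNIV] sum.swap[of "\<lambda>i k. ent M k k" UNIV UNIV]
    by (simp add: sum.distrib sum_subtractf)
  finally show ?thesis by (simp add: tr_def ent_mult)
qed

lemma tr_mult_commute:
  assumes "entries_commute P Q" shows "tr (P * Q) = tr (Q * P)"
  by (simp add: tr_def ent_mult entries_commuteD[OF assms]) (rule sum.swap)

lemma rmult_commute:
  assumes "entries_commute P Q" shows "P \<odot> Q = Q * P"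
  by (rule mat3_eqI) (simp add: ent_mult ent_rmult entries_commuteD[OF assms])

lemma sum_const_3: "(\<Sum>k\<in>(UNIV::3 set). c) = 3 *\<^sub>C (c::'a::complex_vector)"
  by (simp add: sum_3 scaleC_numeral_Bit del: numeral_One)

text \<open>One correction occurs once for each value of the contracted index, whence the factor 3;
  the other one sums up to the trace.\<close>

lemma rmult_tensor_op:
  assumes "tensor_op a M"
  shows "a \<odot> M = M * a + 3 *\<^sub>C M - diag (tr M)" "M \<odot> a = a * M + 3 *\<^sub>C M - diag (tr M)"
proof -
  show "a \<odot> M = M * a + 3 *\<^sub>C M - diag (tr M)"
    by (rule mat3_eqI) (simp add: ent_mult ent_rmult tensor_opD[OF assms] sum.distrib sum_subtractf
        sum_const_3 tr_def)
  have *: "ent M k j * ent a i k = ent a i k * ent M k j - (if i = j then ent M k k else 0) + ent M i j" for i j k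
    by (simp add: tensor_opD[OF assms])
  show "M \<odot> a = a * M + 3 *\<^sub>C M - diag (tr M)"
    by (rule mat3_eqI) (simp add: ent_mult ent_rmult * sum.distrib sum_subtractf sum_const_3 tr_def)
qed

text \<open>Only the factor \<open>M\<close> is affected by \<open>a\<close>, so the factor 3 of
  \<open>rmult_tensor_op\<close> becomes the trace of \<open>Q\<close>.\<close>

lemma rmult_tensor_op_mult:
  assumes M: "tensor_op a M" and Q: "entries_commute a Q"
  shows "a \<odot> (M * Q) = M * Q * a + M * diag (tr Q) - diag (tr (M * Q))"
proof (rule mat3_eqI)
  fix i j
  have "ent (a \<odot> (M * Q)) i j = (\<Sum>k\<in>UNIV. \<Sum>m\<in>UNIV. ent a k j * ent M i m * ent Q m k)"
    by (simp add: ent_mult ent_rmult sum_distrib_left mult.assoc)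
  also have "\<dots> = (\<Sum>k\<in>UNIV. \<Sum>m\<in>UNIV. ent M i m * ent Q m k * ent a k j
      + (if k = m then ent M i j else 0) * ent Q m k - (if i = j then ent M k m * ent Q m k else 0))"
    by (intro sum.cong refl)
      (simp add: tensor_opD[OF M] algebra_simps, simp add: entries_commuteD[OF Q])
  also have "\<dots> = ent (M * Q * a + M * diag (tr Q) - diag (tr (M * Q))) i j"
    by (simp add: sum.distrib sum_subtractf ent_mult sum_distrib_left sum_distrib_right tr_def)
  finally show "ent (a \<odot> (M * Q)) i j = ent (M * Q * a + M * diag (tr Q) - diag (tr (M * Q))) i j" .
qed

lemma tr_around_commute:
  assumes "entries_commute V W" shows "tr_around U V W = diag (tr (U * W)) * V"
proof (rule mat3_eqI)
  fix i j
  have "ent (tr_around U V W) i j = (\<Sum>x\<in>UNIV. \<Sum>y\<in>UNIV. ent U x y * ent W y x * ent V i j)"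
    by (simp add: ent_tr_around mult.assoc entries_commuteD[OF assms])
  then show "ent (tr_around U V W) i j = ent (diag (tr (U * W)) * V) i j"
    by (simp add: tr_def ent_mult sum_distrib_right)
qed

text \<open>Moving the middle entry past the last one costs one correction for each of its indices;
  they add up to \<open>a * a\<close> and \<open>a \<odot> a\<close>.\<close>

lemma tr_around_self:
  assumes "tensor_op a a" shows "tr_around a a a = diag (tr (a * a)) * a + a * a - a \<odot> a"
proof (rule mat3_eqI)
  fix i j
  have "ent (tr_around a a a) i j = (\<Sum>x\<in>UNIV. \<Sum>y\<in>UNIV. ent a x y * ent a y x * ent a i j
      + ent a x y * (if i = x then ent a y j else 0) - ent a x y * (if y = j then ent a i x else 0))"
    unfolding ent_tr_around mult.assoc tensor_opD[OF assms, of i j]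
    by (simp add: algebra_simps)
  also have "\<dots> = ent (diag (tr (a * a)) * a + a * a - a \<odot> a) i j"
  proof -
    have "(\<Sum>x\<in>UNIV. \<Sum>y\<in>UNIV. ent a x y * (if i = x then ent a y j else 0)) = (\<Sum>y\<in>UNIV. ent a i y * ent a y j)"
      by (subst sum.swap) simp
    then show ?thesis
      by (simp add: sum.distrib sum_subtractf tr_def ent_mult ent_rmult sum_distrib_right)
  qed
  finally show "ent (tr_around a a a) i j = ent (diag (tr (a * a)) * a + a * a - a \<odot> a) i j" .
qed

text \<open>Under \<open>a\<close> alone only the factor \<open>P\<close> transforms, so the trace
  is not invariant; the defect is a commutator of matrices. This rule is what moves coefficients
  past letters.\<close>

lemma ad_trace:
  assumes P: "tensor_op a P" and Q: "entries_commute a Q" and PQ: "entries_commute P Q"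
  shows "diag (tr (P * Q)) * a = a * diag (tr (P * Q)) + P * Q - Q * P"
proof (rule mat3_eqI)
  fix i j
  have "ent a i j * tr (P * Q) = (\<Sum>p\<in>UNIV. \<Sum>q\<in>UNIV. ent P p q * ent Q q p * ent a i j
     + (if i = q then ent P p j else 0) * ent Q q p - (if p = j then ent P i q * ent Q q p else 0))"
    unfolding tr_def ent_mult sum_distrib_left
    by (intro sum.cong refl, simp add: tensor_opD[OF P] algebra_simps flip: mult.assoc)
      (simp add: mult.assoc entries_commuteD[OF Q])
  also have "\<dots> = tr (P * Q) * ent a i j + (\<Sum>p\<in>UNIV. ent P p j * ent Q i p) - ent (P * Q) i j"
  proof -
    have "(\<Sum>p\<in>UNIV. \<Sum>q\<in>UNIV. if p = j then ent P i q * ent Q q p else 0) = ent (P * Q) i j"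
      by (subst sum.swap) (simp add: ent_mult)
    then show ?thesis
      by (simp add: sum.distrib sum_subtractf tr_def ent_mult sum_distrib_right)
  qed
  also have "(\<Sum>p\<in>UNIV. ent P p j * ent Q i p) = ent (Q * P) i j"
    by (simp add: ent_mult entries_commuteD[OF PQ])
  finally show "ent (diag (tr (P * Q)) * a) i j = ent (a * diag (tr (P * Q)) + P * Q - Q * P) i j"
    by (simp add: algebra_simps)
qed

lemma scaleC_cancel: "c *\<^sub>C x = c *\<^sub>C y \<Longrightarrow> c \<noteq> 0 \<Longrightarrow> x = (y::'b::complex_vector)"
  by (metis scaleC_scaleC scaleC_one left_inverse)

lemma scaleC_one_mult: "(c *\<^sub>C 1) * x = c *\<^sub>C (x::'a::complex_algebra)" "x * (c *\<^sub>C 1) = c *\<^sub>C x"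
  by (simp_all add: mult_scaleC_left mult_scaleC_right)

lemmas matrix_expand = algebra_simps scaleC_add_right scaleC_diff_right scaleC_minus_right
  mult_scaleC_left mult_scaleC_right scaleC_scaleC scaleC_one diag_simps

section \<open>Cayley-Hamilton identities for one matrix\<close>

locale gl3_matrix =
  fixes a :: "'a::complex_algebra mat3"
  assumes tensor_op_self: "tensor_op a a" and tr_self: "tr a = 3 *\<^sub>C 1"
begin

lemmas tensor_op_square = tensor_op_mult[OF tensor_op_self tensor_op_self]

lemmas tensor_op_cube = tensor_op_mult[OF tensor_op_square tensor_op_self]

text \<open>These are the coefficients of the cubic identity \<open>cube\<close>; with trace 3,
  taking its trace forces
  \<open>tr (a * a * a) = 3 *\<^sub>C \<kappa> + 3 *\<^sub>C \<nu>\<close>.\<close>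

definition \<kappa> :: 'a where "\<kappa> = (1/2) *\<^sub>C (tr (a * a) - 1)"

definition \<nu> :: 'a where "\<nu> = (1/3) *\<^sub>C tr (a * a * a) - \<kappa>"

lemma tr_square: "tr (a * a) = 2 *\<^sub>C \<kappa> + 1"
  by (simp add: \<kappa>_def scaleC_scaleC scaleC_one)

lemma tr_cube: "tr (a * a * a) = 3 *\<^sub>C \<kappa> + 3 *\<^sub>C \<nu>"
  by (simp add: \<nu>_def scaleC_diff_right scaleC_scaleC scaleC_one)

lemma rmult_self: "a \<odot> a = a * a + 3 *\<^sub>C a - 3 *\<^sub>C 1"
  by (simp add: rmult_tensor_op[OF tensor_op_self] tr_self diag_simps)

lemma ad_kappa: "diag \<kappa> * a = a * diag \<kappa>"
  using tensor_op_trace_diag[OF tensor_op_square]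
  by (simp add: \<kappa>_def diag_simps algebra_simps mult_scaleC_left mult_scaleC_right)

lemma ad_nu: "diag \<nu> * a = a * diag \<nu>"
  using tensor_op_trace_diag[OF tensor_op_cube] ad_kappa
  by (simp add: \<nu>_def diag_simps algebra_simps mult_scaleC_left mult_scaleC_right)

end

text \<open>Opaque vectors leave only linear arithmetic. They stand for: \<open>x1\<close>,
  \<open>x2\<close>, \<open>x3\<close> the products \<open>aaQ\<close>, \<open>aQa\<close>,
  \<open>Qaa\<close>; \<open>x4\<close>, \<open>x5\<close>, \<open>x6\<close> the products
  \<open>aQ\<close>, \<open>Qa\<close>, \<open>Q\<close>; \<open>d0\<close>, \<open>d1\<close>,
  \<open>d2\<close> the trace of \<open>Q\<close> times 1, \<open>a\<close>, \<open>aa\<close>;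
  \<open>e\<close>, \<open>e1\<close> the trace of \<open>aQ\<close> times 1, \<open>a\<close>;
  \<open>k0\<close>, \<open>k6\<close> the multiples by \<open>\<kappa>\<close>; \<open>y\<close>
  the trace of \<open>aaQ\<close>. With two equal arguments the polarised identity is twice the
  desired one.\<close>

lemma quadratic_relation_aux:
  fixes x1 :: "'v::complex_vector"
  assumes "x1 + x2 + (x1 + 3 *\<^sub>C x4 - 3 *\<^sub>C x6) + (x2 + d1 - e) + x3 + (x3 + 3 *\<^sub>C x5 - 3 *\<^sub>C x6)
      + 3 *\<^sub>C d1 + 3 *\<^sub>C d1 + 9 *\<^sub>C x6 + 3 *\<^sub>C e + (2 *\<^sub>C k0 + d0) + 3 *\<^sub>C e
    = (2 *\<^sub>C d2 + 3 *\<^sub>C d1 - 3 *\<^sub>C d0) + 3 *\<^sub>C x4 + 3 *\<^sub>C x5 + (3 *\<^sub>C x4 + 3 *\<^sub>C x5)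
      + (e1 - x4 + x5) + e1 + (2 *\<^sub>C k6 + x6) + 9 *\<^sub>C d0 + y + (y + 3 *\<^sub>C e - 3 *\<^sub>C d0)"
  shows "x1 + x2 + x3 + x6 + 2 *\<^sub>C d1 + e + k0 = x4 + 2 *\<^sub>C x5 + k6 + d2 + e1 + d0 + y"
    (is "?m = ?n")
proof -
  have "2 *\<^sub>C ?m = 2 *\<^sub>C ?n"
    using assms by (simp add: scaleC_numeral_Bit algebra_simps del: numeral_One)
  then show ?thesis
    by (rule scaleC_cancel) simp
qed

text \<open>\<open>x\<close>, \<open>s\<close> are the cube and the square of \<open>a\<close>, and
  \<open>t\<close> is the trace of the square. With three equal arguments the polarised identity
  counts six times. On each side \<open>s\<close> occurs 18 times: on the left through reordering in
  size 3, on the right through the trace 3.\<close>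

lemma cube_aux:
  fixes x :: "'v::complex_vector"
  assumes "x + (x + 3 *\<^sub>C s - 3 *\<^sub>C a) + (x + 3 *\<^sub>C s - 3 *\<^sub>C a) + (x + 3 *\<^sub>C s - t) + (x + 3 *\<^sub>C s - t)
     + (x + 3 *\<^sub>C s - t + 3 *\<^sub>C (s + 3 *\<^sub>C a - 3 *\<^sub>C o1) - 3 *\<^sub>C a)
     + 9 *\<^sub>C a + 9 *\<^sub>C a + 9 *\<^sub>C a + 3 *\<^sub>C t + 3 *\<^sub>C t + 3 *\<^sub>C t
    = (3 *\<^sub>C s + 3 *\<^sub>C (s + 3 *\<^sub>C a - 3 *\<^sub>C o1)) + 3 *\<^sub>C s + 3 *\<^sub>C (s + 3 *\<^sub>C a - 3 *\<^sub>C o1)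
     + (3 *\<^sub>C s + 3 *\<^sub>C (s + 3 *\<^sub>C a - 3 *\<^sub>C o1))
     + (2 *\<^sub>C k1 + a) + ((2 *\<^sub>C k1 + a) + s - (s + 3 *\<^sub>C a - 3 *\<^sub>C o1)) + (2 *\<^sub>C k1 + a) + 27 *\<^sub>C o1
     + (3 *\<^sub>C k + 3 *\<^sub>C n) + ((3 *\<^sub>C k + 3 *\<^sub>C n) + 3 *\<^sub>C t - 9 *\<^sub>C o1)"
    and t: "t = 2 *\<^sub>C k + o1"
  shows "x = k1 + n"
proof -
  have "6 *\<^sub>C x = 6 *\<^sub>C (k1 + n)"
    using assms(1) unfolding t by (simp add: scaleC_numeral_Bit algebra_simps scaleC_add_right scaleC_diff_right del: numeral_One)
  then show ?thesis
    by (rule scaleC_cancel) simp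
qed

context gl3_matrix
begin

text \<open>The polarised identity at \<open>a\<close>, \<open>a\<close>, \<open>Q\<close>. Its
  instances at \<open>Q = b\<close> and \<open>Q = b * b\<close>, together with the one where the
  roles of \<open>a\<close> and \<open>b\<close> are exchanged, are all the mixed relations between
  the two matrices.\<close>

lemma quadratic_relation:
  assumes Q: "entries_commute a Q"
  shows "a * a * Q + a * Q * a + Q * a * a + Q + 2 *\<^sub>C (diag (tr Q) * a) + diag (tr (a * Q)) + diag \<kappa> * diag (tr Q)
    = a * Q + 2 *\<^sub>C (Q * a) + diag \<kappa> * Q + diag (tr Q) * (a * a) + diag (tr (a * Q)) * a + diag (tr Q)
      + diag (tr (a * a * Q))"
proof -
  have Q2: "entries_commute (a * a) Q"
    using Q by (blast intro: entries_commute_sym entries_commute_mult)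
  have trQ: "a * diag (tr Q) = diag (tr Q) * a"
    by (rule mat3_eqI) (simp add: tr_def sum_distrib_left sum_distrib_right entries_commuteD[OF Q])
  then have trQ': "a * (diag (tr Q) * M) = diag (tr Q) * (a * M)" for M
    by (metis mult.assoc)
  note [simp] = rmult_self rmult_simps rmult_commute[OF Q] rmult_commute[OF Q2] tr_self tr_square trQ trQ'
  note [simp] = diag_simps scaleC_one_mult scaleC_scaleC
  have "a * (a \<odot> Q) = a * Q * a" "(a \<odot> a) * Q = a * a * Q + 3 *\<^sub>C (a * Q) - 3 *\<^sub>C Q"
    "(a * a) \<odot> Q = Q * a * a" "(a \<odot> a) \<odot> Q = Q * a * a + 3 *\<^sub>C (Q * a) - 3 *\<^sub>C Q"
    "a * diag (tr a * tr Q) = 3 *\<^sub>C (diag (tr Q) * a)" "diag (tr a) * a * diag (tr Q) = 3 *\<^sub>C (diag (tr Q) * a)"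
    "diag (tr a * tr a) * Q = 9 *\<^sub>C Q" "diag (tr a * tr (a * Q)) = 3 *\<^sub>C diag (tr (a * Q))"
    "diag (tr (a * a) * tr Q) = 2 *\<^sub>C (diag \<kappa> * diag (tr Q)) + diag (tr Q)"
    "diag (tr (a * diag (tr a) * Q)) = 3 *\<^sub>C diag (tr (a * Q))"
    "(a * a + a \<odot> a) * diag (tr Q) = 2 *\<^sub>C (diag (tr Q) * (a * a)) + 3 *\<^sub>C (diag (tr Q) * a) - 3 *\<^sub>C diag (tr Q)"
    "a * diag (tr a) * Q = 3 *\<^sub>C (a * Q)" "(a * diag (tr a)) \<odot> Q = 3 *\<^sub>C (Q * a)"
    "diag (tr a) * (a * Q + a \<odot> Q) = 3 *\<^sub>C (a * Q) + 3 *\<^sub>C (Q * a)"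
    "diag (tr (a * a)) * Q = 2 *\<^sub>C (diag \<kappa> * Q) + Q" "diag (tr a * tr a * tr Q) = 9 *\<^sub>C diag (tr Q)"
    "diag (tr ((a \<odot> a) * Q)) = diag (tr (a * a * Q)) + 3 *\<^sub>C diag (tr (a * Q)) - 3 *\<^sub>C diag (tr Q)"
    by (simp_all add: distrib_left distrib_right left_diff_distrib right_diff_distrib mult_scaleC_left
        mult_scaleC_right mult.assoc tr_simps scaleC_add_right scaleC_numeral_Bit(1)[of num.One] scaleC_one)
  moreover have "a \<odot> (a * Q) = a * Q * a + diag (tr Q) * a - diag (tr (a * Q))"
    by (simp add: rmult_tensor_op_mult[OF tensor_op_self Q])
  moreover have "a * diag (tr (a * Q)) = diag (tr (a * Q)) * a - a * Q + Q * a"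
    using ad_trace[OF tensor_op_self Q Q] by simp
  moreover have "tr_around a a Q = diag (tr (a * Q)) * a"
    by (rule tr_around_commute[OF Q])
  ultimately show ?thesis
    using polarised_cayley_hamilton[of a a Q] by (intro quadratic_relation_aux) (simp only:)
qed

lemma cube: "a * a * a = diag \<kappa> * a + diag \<nu>"
proof -
  note sq = tensor_op_square
  note [simp] = rmult_self rmult_simps tr_self rmult_tensor_op[OF sq]
  note [simp] = diag_simps scaleC_one_mult scaleC_scaleC
  have tr_diag: "diag (tr (a * a)) * a = 2 *\<^sub>C (diag \<kappa> * a) + a"
    by (simp add: tr_square distrib_right mult_scaleC_left)
  have "a * (a \<odot> a) = a * a * a + 3 *\<^sub>C (a * a) - 3 *\<^sub>C a" "(a \<odot> a) * a = a * a * a + 3 *\<^sub>C (a * a) - 3 *\<^sub>C a"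
    "a \<odot> (a * a) = a * a * a + 3 *\<^sub>C (a * a) - diag (tr (a * a))"
    "(a * a) \<odot> a = a * a * a + 3 *\<^sub>C (a * a) - diag (tr (a * a))"
    "(a \<odot> a) \<odot> a = a * a * a + 3 *\<^sub>C (a * a) - diag (tr (a * a)) + 3 *\<^sub>C (a * a + 3 *\<^sub>C a - 3 *\<^sub>C 1) - 3 *\<^sub>C a"
    "a * diag (tr a * tr a) = 9 *\<^sub>C a" "diag (tr a) * a * diag (tr a) = 9 *\<^sub>C a" "diag (tr a * tr a) * a = 9 *\<^sub>C a"
    "diag (tr a * tr (a * a)) = 3 *\<^sub>C diag (tr (a * a))" "diag (tr (a * a) * tr a) = 3 *\<^sub>C diag (tr (a * a))"
    "diag (tr (a * diag (tr a) * a)) = 3 *\<^sub>C diag (tr (a * a))"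
    "(a * a + a \<odot> a) * diag (tr a) = 3 *\<^sub>C (a * a) + 3 *\<^sub>C (a * a + 3 *\<^sub>C a - 3 *\<^sub>C 1)"
    "a * diag (tr a) * a = 3 *\<^sub>C (a * a)" "(a * diag (tr a)) \<odot> a = 3 *\<^sub>C (a * a + 3 *\<^sub>C a - 3 *\<^sub>C 1)"
    "diag (tr a) * (a * a + a \<odot> a) = 3 *\<^sub>C (a * a) + 3 *\<^sub>C (a * a + 3 *\<^sub>C a - 3 *\<^sub>C 1)"
    "diag (tr a * tr a * tr a) = 27 *\<^sub>C 1"
    "diag (tr (a * a * a)) = 3 *\<^sub>C diag \<kappa> + 3 *\<^sub>C diag \<nu>"
    "diag (tr ((a \<odot> a) * a)) = 3 *\<^sub>C diag \<kappa> + 3 *\<^sub>C diag \<nu> + 3 *\<^sub>C diag (tr (a * a)) - 9 *\<^sub>C 1"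
    by (simp_all add: distrib_left distrib_right left_diff_distrib right_diff_distrib mult_scaleC_left
        mult_scaleC_right mult.assoc tr_simps scaleC_add_right scaleC_diff_right tr_cube[unfolded mult.assoc])
  moreover have "a * diag (tr (a * a)) = 2 *\<^sub>C (diag \<kappa> * a) + a"
    using tensor_op_trace_diag[OF sq] tr_diag by simp
  moreover have "tr_around a a a = (2 *\<^sub>C (diag \<kappa> * a) + a) + a * a - (a * a + 3 *\<^sub>C a - 3 *\<^sub>C 1)"
    using tr_diag by (simp add: tr_around_self[OF tensor_op_self])
  ultimately show ?thesis
    using polarised_cayley_hamilton[of a a a] tr_diag
    by (intro cube_aux[of "a * a * a" "a * a" a "diag (tr (a * a))" 1 "diag \<kappa> * a" "diag \<kappa>" "diag \<nu>"])
      (simp_all only:, simp add: tr_square)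
qed

end

lemma scaleC_minus_left: "(- c) *\<^sub>C x = - (c *\<^sub>C (x::'a::complex_vector))"
  using scaleC_add_left[of "- c" c x] by (simp add: eq_neg_iff_add_eq_0)

section \<open>Reduction of words in two matrices\<close>

datatype sc = K1 | N1 | K2 | N2 | T | S | U | Y | H

type_synonym word = "leg list"
type_synonym smon = "sc list"
type_synonym spoly = "(int \<times> smon) list"
type_synonym svec = "(word \<times> spoly) list"
type_synonym wpoly = "(int \<times> word) list"

fun eval_mon :: "(sc \<Rightarrow> 'a::complex_algebra) \<Rightarrow> smon \<Rightarrow> 'a" where
  "eval_mon \<sigma> [] = 1"
| "eval_mon \<sigma> (x # m) = \<sigma> x * eval_mon \<sigma> m"

fun eval_poly :: "(sc \<Rightarrow> 'a::complex_algebra) \<Rightarrow> spoly \<Rightarrow> 'a" where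
  "eval_poly \<sigma> [] = 0"
| "eval_poly \<sigma> ((c, m) # p) = of_int c *\<^sub>C eval_mon \<sigma> m + eval_poly \<sigma> p"

text \<open>Words are stored in reverse: the head of the list is the last factor.\<close>

fun eval_word :: "(leg \<Rightarrow> 'a::complex_algebra mat3) \<Rightarrow> word \<Rightarrow> 'a mat3" where
  "eval_word \<mu> [] = 1"
| "eval_word \<mu> (x # w) = eval_word \<mu> w * \<mu> x"

fun eval_wpoly :: "(leg \<Rightarrow> 'a::complex_algebra mat3) \<Rightarrow> wpoly \<Rightarrow> 'a mat3" where
  "eval_wpoly \<mu> [] = 0"
| "eval_wpoly \<mu> ((c, w) # p) = of_int c *\<^sub>C eval_word \<mu> w + eval_wpoly \<mu> p"

fun eval_vec :: "(leg \<Rightarrow> 'a::complex_algebra mat3) \<Rightarrow> (sc \<Rightarrow> 'a) \<Rightarrow> svec \<Rightarrow> 'a mat3" where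
  "eval_vec \<mu> \<sigma> [] = 0"
| "eval_vec \<mu> \<sigma> ((w, p) # v) = diag (eval_poly \<sigma> p) * eval_word \<mu> w + eval_vec \<mu> \<sigma> v"

fun rank :: "sc \<Rightarrow> nat" where
  "rank K1 = 0" | "rank N1 = 1" | "rank K2 = 2" | "rank N2 = 3" | "rank T = 4" | "rank S = 5"
| "rank U = 6" | "rank Y = 7" | "rank H = 8"

fun central :: "sc \<Rightarrow> bool" where
  "central U = False" | "central Y = False" | "central H = False" | "central K1 = True"
| "central N1 = True" | "central K2 = True" | "central N2 = True" | "central T = True" | "central S = True"

text \<open>Central letters are merged by rank and come first; the letters \<open>U\<close>,
  \<open>Y\<close>, \<open>H\<close> follow in the order of multiplication.\<close>

fun mult_mon :: "smon \<Rightarrow> smon \<Rightarrow> smon" where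
  "mult_mon [] n = n"
| "mult_mon (x # m) [] = x # m"
| "mult_mon (x # m) (y # n) =
    (if central y then if rank x < rank y then x # mult_mon m (y # n) else y # mult_mon (x # m) n
     else x # mult_mon m (y # n))"

text \<open>Together with \<open>less_mon\<close> this is the degree-lexicographic order in a single
  pass: \<open>b\<close> remembers the first difference and decides if the lengths agree.\<close>

fun less_len :: "bool \<Rightarrow> smon \<Rightarrow> smon \<Rightarrow> bool" where
  "less_len b [] [] = b"
| "less_len b [] (y # n) = True"
| "less_len b (x # m) [] = False"
| "less_len b (x # m) (y # n) = less_len b m n"

fun less_mon :: "smon \<Rightarrow> smon \<Rightarrow> bool" where
  "less_mon m [] = False"
| "less_mon [] (y # n) = True"
| "less_mon (x # m) (y # n) = (if x = y then less_mon m n else less_len (rank x < rank y) m n)"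

fun less_word :: "word \<Rightarrow> word \<Rightarrow> bool" where
  "less_word v [] = False"
| "less_word [] (y # w) = True"
| "less_word (x # v) (y # w) = (if x = y then less_word v w else x = Fst)"

fun cons_poly :: "int \<Rightarrow> smon \<Rightarrow> spoly \<Rightarrow> spoly" where
  "cons_poly c m p = (if c = 0 then p else (c, m) # p)"

fun padd :: "spoly \<Rightarrow> spoly \<Rightarrow> spoly" where
  "padd [] q = q"
| "padd ((c, m) # p) [] = (c, m) # p"
| "padd ((c, m) # p) ((d, n) # q) =
    (if m = n then cons_poly (c + d) m (padd p q)
     else if less_mon m n then (c, m) # padd p ((d, n) # q) else (d, n) # padd ((c, m) # p) q)"

fun pmon :: "int \<Rightarrow> smon \<Rightarrow> spoly \<Rightarrow> spoly" where
  "pmon c m [] = []"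
| "pmon c m ((d, n) # q) = (c * d, mult_mon m n) # pmon c m q"

fun pmult :: "spoly \<Rightarrow> spoly \<Rightarrow> spoly" where
  "pmult [] q = []"
| "pmult ((c, m) # p) q = padd (pmon c m q) (pmult p q)"

text \<open>The integer division may round; \<open>pivot\<close> and \<open>add_trace\<close> test
  exactness by multiplying back.\<close>

fun pdiv :: "int \<Rightarrow> spoly \<Rightarrow> spoly" where
  "pdiv d [] = []"
| "pdiv d ((c, m) # p) = (c div d, m) # pdiv d p"

fun cons_vec :: "word \<Rightarrow> spoly \<Rightarrow> svec \<Rightarrow> svec" where
  "cons_vec w [] v = v"
| "cons_vec w (t # p) v = (w, t # p) # v"

fun vadd :: "svec \<Rightarrow> svec \<Rightarrow> svec" where
  "vadd [] q = q"
| "vadd ((v, p) # ps) [] = (v, p) # ps"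
| "vadd ((v, p) # ps) ((w, q) # qs) =
    (if v = w then cons_vec v (padd p q) (vadd ps qs)
     else if less_word v w then (v, p) # vadd ps ((w, q) # qs) else (w, q) # vadd ((v, p) # ps) qs)"

fun vscale :: "spoly \<Rightarrow> svec \<Rightarrow> svec" where
  "vscale p [] = []"
| "vscale p ((w, q) # v) = (w, pmult p q) # vscale p v"

fun vdiv :: "int \<Rightarrow> svec \<Rightarrow> svec" where
  "vdiv d [] = []"
| "vdiv d ((w, q) # v) = (w, pdiv d q) # vdiv d v"

type_synonym table = "(word \<times> svec) list"

text \<open>A word without a row stays unreduced, which is sound; that no such word is left without
  a trace is tested by \<open>closed_under\<close>.\<close>

fun vrow :: "table \<Rightarrow> word \<Rightarrow> spoly \<Rightarrow> svec" where
  "vrow [] w p = [(w, p)]"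
| "vrow ((v, r) # tab) w p = (if v = w then vscale p r else vrow tab w p)"

fun vstep :: "table \<Rightarrow> leg \<Rightarrow> svec \<Rightarrow> svec" where
  "vstep tab x [] = []"
| "vstep tab x ((w, p) # v) = vadd (vrow tab (x # w) p) (vstep tab x v)"

fun vword :: "table \<Rightarrow> word \<Rightarrow> svec" where
  "vword tab [] = [([], [(1, [])])]"
| "vword tab (x # w) = vstep tab x (vword tab w)"

fun vwords :: "table \<Rightarrow> wpoly \<Rightarrow> word \<Rightarrow> svec" where
  "vwords tab [] w = []"
| "vwords tab ((c, u) # us) w = vadd (vscale [(c, [])] (vword tab (w @ u))) (vwords tab us w)"

fun wpoly_cons :: "leg \<Rightarrow> wpoly \<Rightarrow> wpoly" where
  "wpoly_cons x [] = []"
| "wpoly_cons x ((c, w) # p) = (c, x # w) # wpoly_cons x p"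

fun wpoly_times :: "int \<Rightarrow> word \<Rightarrow> wpoly \<Rightarrow> wpoly" where
  "wpoly_times d u [] = []"
| "wpoly_times d u ((c, w) # p) = (d * c, w @ u) # wpoly_times d u p"

text \<open>The commutator with the letter \<open>a\<close>. For \<open>b\<close> it has the
  opposite sign, since these traces commute with \<open>a + b\<close>; this is the role of
  \<open>leg_sign\<close>.\<close>

fun ad_img :: "sc \<Rightarrow> wpoly" where
  "ad_img T = [(1, [Snd, Fst]), (- 1, [Fst, Snd])]"
| "ad_img U = [(1, [Snd, Fst, Fst]), (- 1, [Fst, Fst, Snd])]"
| "ad_img S = [(1, [Snd, Fst, Fst]), (- 1, [Fst, Fst, Snd]), (1, [Snd, Snd, Fst]), (- 1, [Fst, Snd, Snd])]"
| "ad_img Y = [(1, [Snd, Snd, Fst, Fst]), (- 1, [Fst, Fst, Snd, Snd])]"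
| "ad_img x = []"

fun leg_sign :: "leg \<Rightarrow> int" where
  "leg_sign Fst = 1"
| "leg_sign Snd = - 1"

fun ad_word :: "sc \<Rightarrow> word \<Rightarrow> wpoly" where
  "ad_word z [] = []"
| "ad_word z (x # w) = wpoly_cons x (ad_word z w) @ wpoly_times (leg_sign x) w (ad_img z)"

fun ad_words :: "sc \<Rightarrow> wpoly \<Rightarrow> wpoly" where
  "ad_words z [] = []"
| "ad_words z ((c, w) # p) = wpoly_times c [] (ad_word z w) @ ad_words z p"

text \<open>The combination \<open>us\<close> stands to the left of the coefficient; each letter of
  the coefficient is pulled out in front at the price of a derivation applied to
  \<open>us\<close>.\<close>

fun lmons :: "table \<Rightarrow> smon \<Rightarrow> wpoly \<Rightarrow> word \<Rightarrow> svec" where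
  "lmons tab [] us w = vwords tab us w"
| "lmons tab (x # m) us w = vadd (vscale [(1, [x])] (lmons tab m us w)) (vscale [(- 1, [])] (lmons tab m (ad_words x us) w))"

type_synonym raw = "(int \<times> smon \<times> word) list"

fun eval_raw :: "(leg \<Rightarrow> 'a::complex_algebra mat3) \<Rightarrow> (sc \<Rightarrow> 'a) \<Rightarrow> raw \<Rightarrow> 'a mat3" where
  "eval_raw \<mu> \<sigma> [] = 0"
| "eval_raw \<mu> \<sigma> ((c, m, w) # r) = of_int c *\<^sub>C (diag (eval_mon \<sigma> m) * eval_word \<mu> w) + eval_raw \<mu> \<sigma> r"

fun lraw :: "table \<Rightarrow> word \<Rightarrow> raw \<Rightarrow> svec" where
  "lraw tab v [] = []"
| "lraw tab v ((c, m, w) # r) = vadd (vscale [(c, [])] (lmons tab m [(1, v)] w)) (lraw tab v r)"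

fun coeff :: "word \<Rightarrow> svec \<Rightarrow> spoly" where
  "coeff w [] = []"
| "coeff w ((v, p) # r) = (if v = w then p else coeff w r)"

fun delete :: "word \<Rightarrow> svec \<Rightarrow> svec" where
  "delete w [] = []"
| "delete w ((v, p) # r) = (if v = w then r else (v, p) # delete w r)"

fun add_row :: "bool \<Rightarrow> word \<Rightarrow> svec \<Rightarrow> table \<Rightarrow> table" where
  "add_row b w r tab = (if b then (w, r) # tab else tab)"

text \<open>A relation is solved for its leading word only if the coefficient there is a nonzero
  constant that divides the rest exactly; otherwise the table stays as it is. This makes soundness
  independent of the shape of the relation.\<close>

fun pivot :: "spoly \<Rightarrow> word \<Rightarrow> svec \<Rightarrow> table \<Rightarrow> table" where
  "pivot [(c, [])] w v tab = add_row (c \<noteq> 0 \<and> vscale [(- c, [])] (vdiv (- c) v) = v) w (vdiv (- c) v) tab"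
| "pivot p w v tab = tab"

fun add_relation :: "word \<Rightarrow> svec \<Rightarrow> table \<Rightarrow> table" where
  "add_relation w v tab = pivot (coeff w v) w (delete w v) tab"

fun tables :: "(word \<times> word \<times> raw) list \<Rightarrow> table \<Rightarrow> table" where
  "tables [] tab = tab"
| "tables ((v, l, r) # xs) tab = tables xs (add_relation (l @ v) (lraw tab v r) tab)"

text \<open>\<open>H\<close> will be the trace of \<open>aababb\<close>, which is not presented as a
  word in \<open>a\<close> times a word in \<open>b\<close>, so \<open>ad_trace\<close> does not
  give its commutators with letters.\<close>

fun movable :: "sc \<Rightarrow> bool" where
  "movable H = False"
| "movable x = True"

fun movable_raw :: "raw \<Rightarrow> bool" where
  "movable_raw [] = True"
| "movable_raw ((c, m, w) # r) = (list_all movable m \<and> movable_raw r)"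

section \<open>Soundness of the reduction\<close>

lemma eval_word_append: "eval_word \<mu> (v @ w) = eval_word \<mu> w * eval_word \<mu> v"
  by (induction v) (simp_all add: mult.assoc)

text \<open>The coefficients of a vector stand to the left of the words, so that they can be taken out of the
  trace; \<open>ad\<close> moves them there.\<close>

locale trace_calculus =
  fixes \<mu> :: "leg \<Rightarrow> 'a::complex_algebra mat3" and \<sigma> :: "sc \<Rightarrow> 'a"
  assumes central: "\<And>x y. central x \<Longrightarrow> \<sigma> x * \<sigma> y = \<sigma> y * \<sigma> x"
    and ad: "\<And>z x. movable z \<Longrightarrow> diag (\<sigma> z) * \<mu> x = \<mu> x * diag (\<sigma> z) + of_int (leg_sign x) *\<^sub>C eval_wpoly \<mu> (ad_img z)"
begin

abbreviation "em \<equiv> eval_mon \<sigma>"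
abbreviation "ep \<equiv> eval_poly \<sigma>"
abbreviation "ew \<equiv> eval_word \<mu>"
abbreviation "ewp \<equiv> eval_wpoly \<mu>"
abbreviation "ev \<equiv> eval_vec \<mu> \<sigma>"

lemma central_mon: "central x \<Longrightarrow> em m * \<sigma> x = \<sigma> x * em m"
  by (induction m) (simp_all add: mult.assoc, metis central mult.assoc)

lemma eval_mult_mon: "em (mult_mon m n) = em m * em n"
proof (induction m n rule: mult_mon.induct)
  case (3 x m y n)
  then show ?case
    using central_mon[of y "x # m"] by (simp add: mult.assoc) (metis mult.assoc)
qed (simp_all add: mult.assoc)

lemma eval_padd: "ep (padd p q) = ep p + ep q"
  by (induction p q rule: padd.induct) (auto simp: algebra_simps simp flip: scaleC_add_left of_int_add)

lemma eval_pmon: "ep (pmon c m p) = of_int c *\<^sub>C (em m * ep p)"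
  by (induction c m p rule: pmon.induct)
    (simp_all add: eval_mult_mon algebra_simps mult_scaleC_left mult_scaleC_right scaleC_scaleC scaleC_add_right)

lemma eval_pmult: "ep (pmult p q) = ep p * ep q"
  by (induction p q rule: pmult.induct)
    (simp_all add: eval_padd eval_pmon distrib_right mult_scaleC_left)

lemma eval_cons_vec: "ev (cons_vec w p v) = diag (ep p) * ew w + ev v"
  by (cases p) (simp_all add: diag_simps)

lemma eval_vadd: "ev (vadd v w) = ev v + ev w"
  by (induction v w rule: vadd.induct)
    (auto simp: eval_padd eval_cons_vec diag_simps algebra_simps)

lemma eval_vscale: "ev (vscale p v) = diag (ep p) * ev v"
  by (induction p v rule: vscale.induct) (simp_all add: eval_pmult diag_simps distrib_left mult.assoc)

lemma eval_vscale_const: "ev (vscale [(c, [])] v) = of_int c *\<^sub>C ev v"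
  by (simp add: eval_vscale diag_simps mult_scaleC_left)

definition sound :: "table \<Rightarrow> bool" where
  "sound tab \<longleftrightarrow> (\<forall>(w, v)\<in>set tab. ev v = ew w)"

lemma eval_vrow: "sound tab \<Longrightarrow> ev (vrow tab w p) = diag (ep p) * ew w"
  by (induction tab w p rule: vrow.induct) (auto simp: sound_def eval_vscale)

lemma eval_vstep: "sound tab \<Longrightarrow> ev (vstep tab x v) = ev v * \<mu> x"
  by (induction tab x v rule: vstep.induct) (simp_all add: eval_vadd eval_vrow distrib_right mult.assoc)

lemma eval_vword: "sound tab \<Longrightarrow> ev (vword tab w) = ew w"
  by (induction tab w rule: vword.induct) (simp_all add: eval_vstep diag_simps scaleC_one)

lemma eval_vwords: "sound tab \<Longrightarrow> ev (vwords tab p w) = ewp p * ew w"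
  by (induction tab p w rule: vwords.induct)
    (simp_all add: eval_vadd eval_vscale_const eval_vword eval_word_append distrib_right mult_scaleC_left)

lemma eval_wpoly_append: "ewp (p @ q) = ewp p + ewp q"
  by (induction p) (auto simp: add.assoc)

lemma eval_wpoly_cons: "ewp (wpoly_cons x p) = ewp p * \<mu> x"
  by (induction x p rule: wpoly_cons.induct) (simp_all add: distrib_right mult_scaleC_left)

lemma eval_wpoly_times: "ewp (wpoly_times d u p) = of_int d *\<^sub>C (ew u * ewp p)"
  by (induction d u p rule: wpoly_times.induct)
    (simp_all add: eval_word_append distrib_left mult_scaleC_right scaleC_add_right scaleC_scaleC)

lemma ad_word: "movable z \<Longrightarrow> ew w * diag (\<sigma> z) = diag (\<sigma> z) * ew w - ewp (ad_word z w)"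
proof (induction w)
  case (Cons x w)
  have "ew (x # w) * diag (\<sigma> z) = ew w * (\<mu> x * diag (\<sigma> z))"
    by (simp add: mult.assoc)
  also have "\<mu> x * diag (\<sigma> z) = diag (\<sigma> z) * \<mu> x - of_int (leg_sign x) *\<^sub>C ewp (ad_img z)"
    using ad[OF Cons.prems, of x] by simp
  also have "ew w * \<dots> = (ew w * diag (\<sigma> z)) * \<mu> x - of_int (leg_sign x) *\<^sub>C (ew w * ewp (ad_img z))"
    by (simp add: right_diff_distrib mult.assoc mult_scaleC_right)
  also have "ew w * diag (\<sigma> z) = diag (\<sigma> z) * ew w - ewp (ad_word z w)"
    using Cons by simp
  finally show ?case
    by (simp add: left_diff_distrib mult.assoc eval_wpoly_append eval_wpoly_cons eval_wpoly_times)
qed simp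

lemma ad_words: "movable z \<Longrightarrow> ewp p * diag (\<sigma> z) = diag (\<sigma> z) * ewp p - ewp (ad_words z p)"
  by (induction z p rule: ad_words.induct)
    (simp_all add: distrib_left distrib_right mult_scaleC_left mult_scaleC_right ad_word eval_wpoly_append
      eval_wpoly_times scaleC_diff_right)

lemma eval_lmons:
  "sound tab \<Longrightarrow> list_all movable m \<Longrightarrow> ev (lmons tab m p w) = ewp p * diag (em m) * ew w"
proof (induction tab m p w rule: lmons.induct)
  case (2 tab x m p w)
  have "ewp p * diag (em (x # m)) * ew w = (ewp p * diag (\<sigma> x)) * diag (em m) * ew w"
    by (simp add: diag_simps mult.assoc)
  also have "\<dots> = diag (\<sigma> x) * (ewp p * diag (em m) * ew w) - ewp (ad_words x p) * diag (em m) * ew w"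
    using 2 by (simp add: ad_words left_diff_distrib mult.assoc)
  finally show ?case
    using 2 by (simp add: eval_vadd eval_vscale_const, simp add: eval_vscale diag_simps scaleC_one scaleC_minus_left)
qed (simp add: eval_vwords diag_simps)

lemma eval_lraw: "sound tab \<Longrightarrow> movable_raw r \<Longrightarrow> ev (lraw tab v r) = ew v * eval_raw \<mu> \<sigma> r"
  by (induction tab v r rule: lraw.induct)
    (simp_all add: eval_vadd eval_vscale_const eval_lmons scaleC_one distrib_left mult_scaleC_right mult.assoc)

lemma eval_delete: "ev v = diag (ep (coeff w v)) * ew w + ev (delete w v)"
  by (induction w v rule: delete.induct) (auto simp: diag_simps algebra_simps)

lemma sound_pivot:
  "sound tab \<Longrightarrow> diag (ep p) * ew w + ev v = 0 \<Longrightarrow> sound (pivot p w v tab)"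
proof (induction p w v tab rule: pivot.induct)
  case (1 c w v tab)
  show ?case
  proof (cases "c \<noteq> 0 \<and> vscale [(- c, [])] (vdiv (- c) v) = v")
    case True
    then have "ev v = (- of_int c) *\<^sub>C ev (vdiv (- c) v)"
      by (metis eval_vscale_const of_int_minus)
    then have "of_int c *\<^sub>C ew w = of_int c *\<^sub>C ev (vdiv (- c) v)"
      using 1(2) by (simp add: diag_simps mult_scaleC_left scaleC_minus_left)
    then have "ew w = ev (vdiv (- c) v)"
      by (rule scaleC_cancel) (use True in simp)
    with True 1(1) show ?thesis by (simp add: sound_def)
  qed (use 1 in auto)
qed simp_all

lemma sound_tables:
  "sound tab \<Longrightarrow> \<forall>(v, l, r)\<in>set xs. movable_raw r \<and> eval_raw \<mu> \<sigma> r = 0 \<Longrightarrow> sound (tables xs tab)"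
proof (induction xs tab rule: tables.induct)
  case (2 v l r xs tab)
  have "ev (lraw tab v r) = 0"
    using 2 by (simp add: eval_lraw)
  then have "sound (add_relation (l @ v) (lraw tab v r) tab)"
    using 2(2) eval_delete[of "lraw tab v r" "l @ v"] by (simp add: sound_pivot)
  then show ?case using 2 by simp
qed simp

end

section \<open>Traces of words\<close>

type_synonym ttable = "(word \<times> spoly) list"

text \<open>A word of unknown trace contributes zero here and is collected by \<open>rest\<close>;
  if it is the only one, \<open>add_trace\<close> solves for it.\<close>

fun vtr :: "ttable \<Rightarrow> svec \<Rightarrow> spoly" where
  "vtr tt [] = []"
| "vtr tt ((w, p) # v) = padd (pmult p (coeff w tt)) (vtr tt v)"

fun known :: "ttable \<Rightarrow> word \<Rightarrow> bool" where
  "known [] w = False"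
| "known ((v, p) # tt) w = (v = w \<or> known tt w)"

fun rest :: "ttable \<Rightarrow> svec \<Rightarrow> svec" where
  "rest tt [] = []"
| "rest tt ((w, p) # v) = (if known tt w then rest tt v else (w, p) # rest tt v)"

fun add_trace :: "svec \<Rightarrow> spoly \<Rightarrow> ttable \<Rightarrow> ttable" where
  "add_trace [(w, [(c, [])])] q tt = (if c \<noteq> 0 \<and> pmult [(- c, [])] (pdiv (- c) q) = q then (w, pdiv (- c) q) # tt else tt)"
| "add_trace v q tt = tt"

fun solve_trace :: "svec \<Rightarrow> ttable \<Rightarrow> ttable" where
  "solve_trace v tt = add_trace (rest tt v) (vtr tt v) tt"

fun ttables :: "table \<Rightarrow> wpoly list \<Rightarrow> ttable \<Rightarrow> ttable" where
  "ttables tab [] tt = tt"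
| "ttables tab (p # ps) tt = ttables tab ps (solve_trace (vwords tab p []) tt)"

context trace_calculus
begin

definition trace_sound :: "ttable \<Rightarrow> bool" where
  "trace_sound tt \<longleftrightarrow> (\<forall>(w, p)\<in>set tt. tr (ew w) = ep p)"

lemma trace_coeff:
  "trace_sound tt \<Longrightarrow> known tt w \<Longrightarrow> ep (coeff w tt) = tr (ew w)"
  by (induction tt w rule: known.induct) (auto simp: trace_sound_def)

lemma coeff_unknown: "\<not> known tt w \<Longrightarrow> coeff w tt = []"
  by (induction tt w rule: known.induct) auto

lemma pmult_Nil: "pmult p [] = []"
  by (induction p "[] :: spoly" rule: pmult.induct) simp_all

lemma trace_vec: "trace_sound tt \<Longrightarrow> tr (ev v) = ep (vtr tt v) + tr (ev (rest tt v))"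
proof (induction tt v rule: vtr.induct)
  case (2 tt w p v)
  then show ?case
    by (cases "known tt w")
      (simp_all add: tr_simps eval_padd eval_pmult trace_coeff coeff_unknown pmult_Nil add.assoc)
qed (simp add: tr_simps)

lemma trace_sound_add:
  "trace_sound tt \<Longrightarrow> tr (ev v) + ep q = 0 \<Longrightarrow> trace_sound (add_trace v q tt)"
proof (induction v q tt rule: add_trace.induct)
  case (1 w c q tt)
  show ?case
  proof (cases "c \<noteq> 0 \<and> pmult [(- c, [])] (pdiv (- c) q) = q")
    case True
    then have "ep q = (- of_int c) *\<^sub>C ep (pdiv (- c) q)"
      using arg_cong[of "pmult [(- c, [])] (pdiv (- c) q)" q ep] unfolding eval_pmult
      by (simp add: mult_scaleC_left)
    then have "of_int c *\<^sub>C tr (ew w) = of_int c *\<^sub>C ep (pdiv (- c) q)"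
      using 1(2) by (simp add: tr_simps mult_scaleC_left scaleC_minus_left)
    then have "tr (ew w) = ep (pdiv (- c) q)"
      by (rule scaleC_cancel) (use True in simp)
    with True 1(1) show ?thesis by (simp add: trace_sound_def)
  qed (use 1 in auto)
qed simp_all

lemma trace_sound_ttables:
  "trace_sound tt \<Longrightarrow> sound tab \<Longrightarrow> \<forall>p\<in>set ps. tr (ewp p) = 0 \<Longrightarrow> trace_sound (ttables tab ps tt)"
proof (induction tab ps tt rule: ttables.induct)
  case (2 tab p ps tt)
  have "tr (ev (vwords tab p [])) = 0"
    using 2 by (simp add: eval_vwords)
  then have "trace_sound (solve_trace (vwords tab p []) tt)"
    using 2(2) trace_vec[of tt "vwords tab p []"] by (simp add: trace_sound_add add.commute)
  then show ?case using 2 by simp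
qed simp

lemma trace_wpoly:
  assumes "trace_sound tt" "sound tab" "rest tt (vwords tab p []) = []"
  shows "tr (ewp p) = ep (vtr tt (vwords tab p []))"
  using trace_vec[of tt "vwords tab p []"] assms by (simp add: eval_vwords tr_simps)

end

section \<open>Two gl(3) matrices with commuting entries\<close>

lemma tensor_op_entries_commute_trace:
  assumes "entries_commute e M" shows "ent e p q * tr M = tr M * ent e p q"
  by (simp add: tr_def sum_distrib_left sum_distrib_right entries_commuteD[OF assms])

locale gl3_pair = A: gl3_matrix a + B: gl3_matrix b for a b :: "'a::complex_algebra mat3" +
  assumes entries_commute: "entries_commute a b"
begin

fun matrix_of :: "leg \<Rightarrow> 'a mat3" where
  "matrix_of Fst = a"
| "matrix_of Snd = b"

text \<open>\<open>S\<close> is used in place of the trace of \<^term>\<open>a * b * b\<close> because it commutes with all traces of words.\<close>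

fun scalar_of :: "sc \<Rightarrow> 'a" where
  "scalar_of K1 = A.\<kappa>"
| "scalar_of N1 = A.\<nu>"
| "scalar_of K2 = B.\<kappa>"
| "scalar_of N2 = B.\<nu>"
| "scalar_of T = tr (a * b)"
| "scalar_of S = tr (a * a * b) + tr (a * b * b)"
| "scalar_of U = tr (a * a * b)"
| "scalar_of Y = tr (a * a * b * b)"
| "scalar_of H = tr (a * a * b * a * b * b)"

abbreviation "word_of \<equiv> eval_word matrix_of"

lemma entries_commute': "entries_commute b a"
  by (rule entries_commute_sym[OF entries_commute])

lemma entries_commute_squares:
  "entries_commute a (b * b)" "entries_commute (a * a) b" "entries_commute (a * a) (b * b)"
  "entries_commute b (a * a)" "entries_commute (b * b) a"  "entries_commute (b * b) (a * a)"
  using entries_commute entries_commute' by (meson entries_commute_mult entries_commute_sym)+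

lemma ad_scalar:
  assumes "tensor_op a P" "tensor_op b Q" "entries_commute a Q" "entries_commute b P" "entries_commute P Q"
  shows "diag (tr (P * Q)) * a = a * diag (tr (P * Q)) + P * Q - Q * P"
    "diag (tr (P * Q)) * b = b * diag (tr (P * Q)) + Q * P - P * Q"
  using ad_trace[of a P Q] ad_trace[of b Q P] assms tr_mult_commute[of P Q] entries_commute_sym[of P Q]
  by simp_all

lemmas ad_scalars = ad_scalar[OF A.tensor_op_self B.tensor_op_self entries_commute entries_commute' entries_commute]
  ad_scalar[OF A.tensor_op_square B.tensor_op_self entries_commute entries_commute_squares(4) entries_commute_squares(2)]
  ad_scalar[OF A.tensor_op_self B.tensor_op_square entries_commute_squares(1) entries_commute' entries_commute_squares(1)]
  ad_scalar[OF A.tensor_op_square B.tensor_op_square entries_commute_squares(1) entries_commute_squares(4) entries_commute_squares(3)]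

lemma casimir_commute:
  assumes "x \<in> {K1, N1, K2, N2}"
  shows "diag (scalar_of x) * a = a * diag (scalar_of x)" "diag (scalar_of x) * b = b * diag (scalar_of x)"
proof -
  have *: "diag (tr M) * N = N * diag (tr M)" if "entries_commute N M" for M N :: "'a mat3"
    by (rule mat3_eqI) (simp add: tensor_op_entries_commute_trace[OF that])
  note cubes = entries_commute_mult[OF entries_commute_squares(1) entries_commute]
    entries_commute_mult[OF entries_commute_squares(4) entries_commute']
  show "diag (scalar_of x) * a = a * diag (scalar_of x)" "diag (scalar_of x) * b = b * diag (scalar_of x)"
    using assms A.ad_kappa A.ad_nu B.ad_kappa B.ad_nu *[OF entries_commute_squares(1)] *[OF entries_commute_squares(4)]
      *[OF cubes(1)] *[OF cubes(2)]
    by (auto simp: A.\<kappa>_def B.\<kappa>_def A.\<nu>_def B.\<nu>_def diag_simps left_diff_distrib right_diff_distrib mult_scaleC_left mult_scaleC_right)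
qed

lemma ad_letter:
  assumes "movable z"
  shows "diag (scalar_of z) * matrix_of x = matrix_of x * diag (scalar_of z)
    + of_int (leg_sign x) *\<^sub>C eval_wpoly matrix_of (ad_img z)"
proof (cases "z \<in> {K1, N1, K2, N2}")
  case True
  then show ?thesis
    using casimir_commute[OF True] by (cases x) auto
next
  case False
  with assms have "z \<in> {T, S, U, Y}" by (cases z) auto
  then show ?thesis
    using ad_scalars
    by (cases x) (auto simp: scaleC_one scaleC_minus_left scaleC_add_right mult.assoc diag_simps algebra_simps)
qed

definition d :: "'a mat3" where "d = a + b"

lemma tensor_op_d: "tensor_op d a" "tensor_op d b"
  unfolding d_def
  using tensor_op_add_left[OF A.tensor_op_self entries_commute'] tensor_op_add_left[OF B.tensor_op_self entries_commute]
  by (simp_all add: add.commute)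

lemma tensor_op_d_word: "tensor_op d (word_of w)"
proof (induction w)
  case (Cons x w)
  then show ?case using tensor_op_d by (cases x) (simp_all add: tensor_op_mult)
qed (simp add: tensor_op_one)

lemma tensor_op_d_self: "tensor_op d d"
  using tensor_op_d by (simp add: d_def tensor_op_add)

lemma trace_d_commute: "tr (d * word_of w) = tr (word_of w * d)"
  by (rule tensor_op_trace_mult[OF tensor_op_d_word])

text \<open>On words, \<open>T\<close> and \<open>S\<close> act by the inner derivations of \<open>d\<close> and \<open>d\<^sup>2\<close>.\<close>

lemma ad_inner:
  assumes "diag z * a = a * diag z + a * e - e * a" "diag z * b = b * diag z + b * e - e * b"
  shows "diag z * word_of w = word_of w * diag z + word_of w * e - e * word_of w"
proof (induction w)
  case (Cons x w)
  have x: "diag z * matrix_of x = matrix_of x * diag z + matrix_of x * e - e * matrix_of x"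
    using assms by (cases x) simp_all
  have "diag z * word_of (x # w) = (diag z * word_of w) * matrix_of x"
    by (simp add: mult.assoc)
  also have "\<dots> = word_of w * (diag z * matrix_of x) + word_of w * e * matrix_of x - e * word_of w * matrix_of x"
    unfolding Cons by (simp add: algebra_simps)
  also have "\<dots> = word_of (x # w) * diag z + word_of (x # w) * e - e * word_of (x # w)"
    by (simp add: x algebra_simps)
  finally show ?case .
qed (simp add: diag_simps)

text \<open>An inner derivation by \<open>e\<close> changes the trace of a word by
  \<open>tr (w * e) - tr (e * w)\<close>. For \<open>e = d\<close> and \<open>e = d * d\<close> this
  vanishes, as \<open>d\<close> may be moved cyclically around words.\<close>

lemma trace_commute_central:
  assumes "central z" shows "scalar_of z * tr (word_of w) = tr (word_of w) * scalar_of z"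
proof (cases "z \<in> {K1, N1, K2, N2}")
  case True
  then have "diag (scalar_of z) * word_of w = word_of w * diag (scalar_of z) + word_of w * 0 - 0 * word_of w"
    by (intro ad_inner) (simp_all add: casimir_commute)
  from arg_cong[OF this, of tr] show ?thesis by (simp add: tr_simps)
next
  case False
  with assms have "z = T \<or> z = S" by (cases z) auto
  then show ?thesis
  proof
    assume "z = T"
    then have "diag (scalar_of z) * word_of w = word_of w * diag (scalar_of z) + word_of w * d - d * word_of w"
      using ad_scalars by (intro ad_inner) (simp_all add: d_def algebra_simps)
    from arg_cong[OF this, of tr] show ?thesis by (simp add: tr_simps trace_d_commute)
  next
    assume "z = S"
    \<comment> \<open>In the commutator of \<open>a\<close> with \<open>d * d\<close> the terms
      \<open>aba\<close> cancel, leaving exactly what the traces of \<open>aab\<close> and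
      \<open>abb\<close> contribute together.\<close>
    then have "diag (scalar_of z) * word_of w = word_of w * diag (scalar_of z) + word_of w * (d * d) - d * d * word_of w"
      using ad_scalars by (intro ad_inner) (simp_all add: d_def diag_simps algebra_simps)
    from arg_cong[OF this, of tr]
    have "scalar_of z * tr (word_of w) = tr (word_of w) * scalar_of z + tr (word_of w * (d * d)) - tr (d * d * word_of w)"
      by (simp add: tr_simps)
    moreover have "tr (d * d * word_of w) = tr (d * word_of w * d)"
      using tensor_op_trace_mult[OF tensor_op_mult[OF tensor_op_d_self tensor_op_d_word]] by (simp add: mult.assoc)
    moreover have "\<dots> = tr (word_of w * (d * d))"
      using tensor_op_trace_mult[OF tensor_op_mult[OF tensor_op_d_word tensor_op_d_self]] by (simp add: mult.assoc)
    ultimately show ?thesis by simp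
  qed
qed

lemma scalar_of_commute:
  assumes "central z" shows "scalar_of z * scalar_of y = scalar_of y * scalar_of z"
proof -
  note c = trace_commute_central[OF assms]
  have "scalar_of z * tr M = tr M * scalar_of z"
    if "M \<in> {a * a, b * b, a * a * a, b * b * b, a * b, a * a * b, a * b * b, a * a * b * b, a * a * b * a * b * b}" for M
    using that c[of "[Fst, Fst]"] c[of "[Snd, Snd]"] c[of "[Fst, Fst, Fst]"] c[of "[Snd, Snd, Snd]"]
      c[of "[Snd, Fst]"] c[of "[Snd, Fst, Fst]"] c[of "[Snd, Snd, Fst]"] c[of "[Snd, Snd, Fst, Fst]"]
      c[of "[Snd, Snd, Fst, Snd, Fst, Fst]"]
    by auto
  then show ?thesis
    by (cases y) (simp_all add: A.\<kappa>_def B.\<kappa>_def A.\<nu>_def B.\<nu>_def mult_scaleC_left mult_scaleC_right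
        left_diff_distrib right_diff_distrib distrib_left distrib_right)
qed

sublocale trace_calculus matrix_of scalar_of
  by unfold_locales (use scalar_of_commute ad_letter in auto)

end

section \<open>The rewriting relations and the equations for traces\<close>

definition raw_cube :: "leg \<Rightarrow> sc \<Rightarrow> sc \<Rightarrow> raw" where
  "raw_cube x k n = [(1, [], [x, x, x]), (- 1, [k], [x]), (- 1, [n], [])]"

text \<open>\<open>quadratic_relation\<close> with \<open>Q\<close> the other matrix, which has
  trace 3; the leading word is \<open>yxx\<close>. The remaining trace, that of \<open>xxy\<close>,
  is supplied by \<open>raw_baa\<close> as \<open>U\<close> and by \<open>raw_bba\<close> as
  \<open>S - U\<close>.\<close>

definition raw_linear :: "leg \<Rightarrow> leg \<Rightarrow> sc \<Rightarrow> raw" where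
  "raw_linear x y k = [(1, [], [y, x, x]), (1, [], [x, y, x]), (1, [], [x, x, y]), (- 1, [], [y, x]),
     (- 2, [], [x, y]), (1, [], [y]), (- 1, [k], [y]), (6, [], [x]), (- 3, [], [x, x]), (- 1, [T], [x]),
     (1, [T], []), (3, [k], []), (- 3, [], [])]"

text \<open>\<open>quadratic_relation\<close> at \<open>b * b\<close>. Its leading word
  \<open>baba\<close> is not among the terms; it appears when \<open>bbaa\<close> is reduced by the
  relation for \<open>bba\<close>.\<close>

definition raw_quadratic :: raw where
  "raw_quadratic = [(1, [], [Snd, Snd, Fst, Fst]), (1, [], [Fst, Snd, Snd, Fst]),
     (1, [], [Fst, Fst, Snd, Snd]), (1, [], [Snd, Snd]), (4, [K2], [Fst]), (2, [], [Fst]), (1, [S], []),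
     (- 1, [U], []), (2, [K1, K2], []), (1, [K1], []), (- 1, [], [Snd, Snd, Fst]),
     (- 2, [], [Fst, Snd, Snd]), (- 1, [K1], [Snd, Snd]), (- 2, [K2], [Fst, Fst]), (- 1, [], [Fst, Fst]),
     (- 1, [S], [Fst]), (1, [U], [Fst]), (- 2, [K2], []), (- 1, [], []), (- 1, [Y], [])]"

definition "raw_aaa = raw_cube Fst K1 N1"
definition "raw_bbb = raw_cube Snd K2 N2"
definition "raw_baa = (- 1, [U], []) # raw_linear Fst Snd K1"
definition "raw_bba = (- 1, [S], []) # (1, [U], []) # raw_linear Snd Fst K2"

text \<open>A table of reductions only needs the words that arise from a normal word by appending one letter.
  An entry \<open>(v, l, r)\<close> yields the reduction of one of them: \<open>r\<close> is a relation with leading word \<open>l\<close>, to be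
  multiplied by \<open>v\<close> from the left.\<close>

definition relation_steps :: "(word \<times> word \<times> raw) list" where
  "relation_steps =
      [([], [Fst, Fst, Fst], raw_aaa), ([], [Fst, Fst, Snd], raw_baa), ([], [Fst, Snd, Snd], raw_bba),
       ([], [Snd, Snd, Snd], raw_bbb), ([Fst], [Fst, Fst, Snd], raw_baa), ([Fst], [Fst, Snd, Snd], raw_bba),
       ([Fst], [Snd, Snd, Snd], raw_bbb), ([], [Fst, Snd, Fst, Snd], raw_quadratic),
       ([Fst, Fst], [Fst, Fst, Snd], raw_baa), ([Fst, Fst], [Fst, Snd, Snd], raw_bba),
       ([Fst, Fst], [Snd, Snd, Snd], raw_bbb), ([Fst], [Fst, Snd, Fst, Snd], raw_quadratic),
       ([Fst, Snd], [Fst, Snd, Snd], raw_bba), ([Fst, Snd], [Snd, Snd, Snd], raw_bbb),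
       ([Fst, Fst], [Fst, Snd, Fst, Snd], raw_quadratic), ([Fst, Snd, Fst], [Fst, Snd, Snd], raw_bba),
       ([Fst, Snd, Fst], [Snd, Snd, Snd], raw_bbb), ([Fst, Snd, Fst, Fst], [Fst, Snd, Snd], raw_bba),
       ([Fst, Snd, Fst, Fst], [Snd, Snd, Snd], raw_bbb)]"

text \<open>Eleven of the 18 normal words, which are a power \<open>1\<close>, \<open>a\<close>,
  \<open>aa\<close> followed by one of \<open>1\<close>, \<open>b\<close>, \<open>bb\<close>,
  \<open>ba\<close>, \<open>bab\<close>, \<open>babb\<close>. The seven equations in
  \<open>trace_steps\<close> each determine one of the others.\<close>

definition initial_traces :: ttable where
  "initial_traces = [([], [(3, [])]), ([Fst], [(3, [])]), ([Snd], [(3, [])]), ([Fst, Fst], [(1, []), (2, [K1])]),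
     ([Snd, Snd], [(1, []), (2, [K2])]), ([Snd, Fst], [(1, [T])]), ([Fst, Snd], [(1, [T])]),
     ([Snd, Fst, Fst], [(1, [U])]), ([Snd, Snd, Fst], [(1, [S]), (- 1, [U])]),
     ([Snd, Snd, Fst, Fst], [(1, [Y])]), ([Snd, Snd, Fst, Snd, Fst, Fst], [(1, [H])])]"

definition cyc :: "word \<Rightarrow> wpoly" where
  "cyc w = [(1, w @ [Fst]), (1, w @ [Snd]), (- 1, Fst # w), (- 1, Snd # w)]"

text \<open>All these combinations of words have trace zero: every word commutes with \<open>a + b\<close> under the trace,
  and \<open>U\<close> commutes with the traces of \<open>aab\<close> and \<open>abb\<close>.\<close>

definition trace_steps :: "wpoly list" where
  "trace_steps = [cyc [Fst, Fst], cyc [Snd, Snd],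
     cyc [Snd, Fst, Fst] @ wpoly_times (- 1) [] (cyc [Fst, Snd, Fst]), cyc [Snd, Fst, Fst],
     cyc [Snd, Snd, Fst], ad_word U [Snd, Fst, Fst], ad_word U [Snd, Snd, Fst]]"

context gl3_pair
begin

lemmas matrix_eq_simps = diag_simps scaleC_one scaleC_minus_left scaleC_numeral_Bit tr_simps
  matrix_expand

lemma eval_raw_aaa: "eval_raw matrix_of scalar_of raw_aaa = 0"
  using A.cube by (simp add: raw_aaa_def raw_cube_def diag_simps scaleC_one scaleC_minus_left)

lemma eval_raw_bbb: "eval_raw matrix_of scalar_of raw_bbb = 0"
  using B.cube by (simp add: raw_bbb_def raw_cube_def diag_simps scaleC_one scaleC_minus_left)

lemma eval_raw_baa: "eval_raw matrix_of scalar_of raw_baa = 0"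
  using A.quadratic_relation[OF entries_commute] B.tr_self
  by (simp add: raw_baa_def raw_linear_def matrix_eq_simps del: numeral_One)

lemma eval_raw_bba: "eval_raw matrix_of scalar_of raw_bba = 0"
  using B.quadratic_relation[OF entries_commute'] A.tr_self tr_mult_commute[OF entries_commute]
    tr_mult_commute[OF entries_commute_squares(1)]
  by (simp add: raw_bba_def raw_linear_def matrix_eq_simps del: numeral_One)

lemma eval_raw_quadratic: "eval_raw matrix_of scalar_of raw_quadratic = 0"
  using A.quadratic_relation[OF entries_commute_squares(1)] B.tr_square
  by (simp add: raw_quadratic_def matrix_eq_simps del: numeral_One)

lemma movable_raws:
  "movable_raw raw_aaa" "movable_raw raw_bbb" "movable_raw raw_baa" "movable_raw raw_bba"
  "movable_raw raw_quadratic"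
  by (simp_all add: raw_aaa_def raw_bbb_def raw_baa_def raw_bba_def raw_cube_def raw_linear_def raw_quadratic_def)

lemma sound_table: "sound (tables relation_steps [])"
  by (rule sound_tables, simp add: sound_def)
    (simp add: relation_steps_def movable_raws eval_raw_aaa eval_raw_bbb eval_raw_baa eval_raw_bba eval_raw_quadratic)

lemma trace_cyc: "tr (eval_wpoly matrix_of (cyc w)) = 0"
  using trace_d_commute[of w]
  by (simp add: cyc_def eval_word_append d_def tr_simps scaleC_one scaleC_minus_left algebra_simps)

lemma trace_ad_word:
  assumes "movable z" shows "tr (eval_wpoly matrix_of (ad_word z w)) = commutator (scalar_of z) (tr (word_of w))"
proof -
  have "eval_wpoly matrix_of (ad_word z w) = diag (scalar_of z) * word_of w - word_of w * diag (scalar_of z)"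
    using ad_word[OF assms, of w] by (simp add: algebra_simps)
  then show ?thesis by (simp add: tr_simps commutator_def)
qed

lemma trace_sound_table: "trace_sound (ttables (tables relation_steps []) trace_steps initial_traces)"
proof (rule trace_sound_ttables[OF _ sound_table])
  show "trace_sound initial_traces"
    using A.tr_self B.tr_self A.tr_square B.tr_square tr_mult_commute[OF entries_commute]
    by (simp add: trace_sound_def initial_traces_def tr_one scaleC_one scaleC_minus_left add.commute mult.assoc)
  have "commutator (scalar_of U) (tr (word_of [Snd, Fst, Fst])) = 0"
    "commutator (scalar_of U) (tr (word_of [Snd, Snd, Fst])) = 0"
    using scalar_of_commute[of S U] by (simp_all add: commutator_def algebra_simps)
  then show "\<forall>p\<in>set trace_steps. tr (eval_wpoly matrix_of p) = 0"
    by (simp add: trace_steps_def trace_ad_word trace_cyc eval_wpoly_append eval_wpoly_times tr_simps del: ad_word.simps)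
qed

end

section \<open>The relations as polynomial identities\<close>

fun all_known :: "ttable \<Rightarrow> svec \<Rightarrow> bool" where
  "all_known tt [] = True"
| "all_known tt ((w, p) # v) = (known tt w \<and> all_known tt v)"

text \<open>If the words of known trace are closed under appending a letter and reducing, then all traces are
  known.\<close>

fun closed_under :: "table \<Rightarrow> ttable \<Rightarrow> ttable \<Rightarrow> bool" where
  "closed_under tab tt [] = True"
| "closed_under tab tt ((w, p) # xs) = (all_known tt (vrow tab (Fst # w) []) \<and>
     all_known tt (vrow tab (Snd # w) []) \<and> closed_under tab tt xs)"

text \<open>Translates words in the original generators, whose matrices are those of the calculus
  minus the identity.\<close>

fun shift :: "word \<Rightarrow> wpoly" where
  "shift [] = [(1, [])]"
| "shift (x # w) = wpoly_cons x (shift w) @ wpoly_times (- 1) [] (shift w)"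

definition const_poly :: "int \<Rightarrow> spoly" where
  "const_poly c = [(c, [])]"

fun psum :: "spoly list \<Rightarrow> spoly" where
  "psum [] = []"
| "psum (p # ps) = padd p (psum ps)"

fun pprod :: "spoly list \<Rightarrow> spoly" where
  "pprod [] = [(1, [])]"
| "pprod (p # ps) = pmult p (pprod ps)"

text \<open>The commutators of \<open>U\<close> and \<open>Y\<close> with a letter, where \<open>p\<close>, \<open>q\<close>, \<open>r\<close> stand for \<open>[U, Y]\<close>, \<open>[U, H]\<close>, \<open>[Y, H]\<close>.\<close>

fun img :: "spoly \<Rightarrow> spoly \<Rightarrow> spoly \<Rightarrow> sc \<Rightarrow> sc \<Rightarrow> spoly" where
  "img p q r U Y = p"
| "img p q r U H = q"
| "img p q r Y H = r"
| "img p q r Y U = pmult (const_poly (- 1)) p"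
| "img p q r z x = []"

fun mon_deriv :: "spoly \<Rightarrow> spoly \<Rightarrow> spoly \<Rightarrow> sc \<Rightarrow> smon \<Rightarrow> spoly" where
  "mon_deriv p q r z [] = []"
| "mon_deriv p q r z (x # m) = padd (pmult (img p q r z x) [(1, m)]) (pmult [(1, [x])] (mon_deriv p q r z m))"

fun deriv_poly :: "spoly \<Rightarrow> spoly \<Rightarrow> spoly \<Rightarrow> sc \<Rightarrow> spoly \<Rightarrow> spoly" where
  "deriv_poly p q r z [] = []"
| "deriv_poly p q r z ((c, m) # f) = padd (pmult (const_poly c) (mon_deriv p q r z m)) (deriv_poly p q r z f)"

text \<open>A pair is exchanged only at the end of a monomial, where \<open>mult_mon\<close> leaves
  the noncentral letters. A substituted commutator may bring in further pairs, so the sorting can be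
  repeated, as \<open>check\<close> does for the second relation.\<close>

fun sort_mon :: "spoly \<Rightarrow> spoly \<Rightarrow> smon \<Rightarrow> spoly" where
  "sort_mon p q [] = [(1, [])]"
| "sort_mon p q (x # m) =
    (if x # m = [Y, U] then padd [(1, [U, Y])] (pmult (const_poly (- 1)) p)
     else if x # m = [H, U] then padd [(1, [U, H])] (pmult (const_poly (- 1)) q)
     else pmult [(1, [x])] (sort_mon p q m))"

fun sort_poly :: "spoly \<Rightarrow> spoly \<Rightarrow> spoly \<Rightarrow> spoly" where
  "sort_poly p q [] = []"
| "sort_poly p q ((c, m) # f) = padd (pmult (const_poly c) (sort_mon p q m)) (sort_poly p q f)"

fun central_poly :: "spoly \<Rightarrow> bool" where
  "central_poly [] = True"
| "central_poly ((c, m) # p) = (list_all central m \<and> central_poly p)"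

fun linear_coeff :: "sc \<Rightarrow> spoly \<Rightarrow> int" where
  "linear_coeff x [] = 0"
| "linear_coeff x ((c, m) # p) = (if m = [x] then c else linear_coeff x p)"

fun letters_in :: "sc list \<Rightarrow> spoly \<Rightarrow> bool" where
  "letters_in xs [] = True"
| "letters_in xs ((c, m) # p) = (list_all (\<lambda>x. x \<in> set xs) m \<and> letters_in xs p)"

text \<open>Each polynomial in the list is triangular: a nonzero multiple of its letter plus a polynomial in
  the letters that precede it.\<close>

fun solvable_for :: "int \<Rightarrow> sc \<Rightarrow> spoly \<Rightarrow> sc list \<Rightarrow> bool" where
  "solvable_for c x p xs = (c \<noteq> 0 \<and> letters_in xs (padd p [(- c, [x])]))"

fun solvable :: "(sc \<times> spoly) list \<Rightarrow> sc list \<Rightarrow> bool" where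
  "solvable [] xs = True"
| "solvable ((x, p) # ps) xs = (solvable_for (linear_coeff x p) x p xs \<and> solvable ps (x # xs))"

definition trace_poly :: "table \<Rightarrow> ttable \<Rightarrow> wpoly \<Rightarrow> spoly" where
  "trace_poly tab tt p = vtr tt (vwords tab p [])"

definition k_poly :: "table \<Rightarrow> ttable \<Rightarrow> leg list \<Rightarrow> spoly" where
  "k_poly tab tt xs = psum (map (\<lambda>w. trace_poly tab tt (shift w)) (List.n_lists 2 xs))"

text \<open>Twice the element \<open>l\<close>: half the sum of the two cubic Casimir elements is
  the first of them plus 3/2 of the quadratic one.\<close>

definition l_poly :: "table \<Rightarrow> ttable \<Rightarrow> leg list \<Rightarrow> spoly" where
  "l_poly tab tt xs = padd (pmult (const_poly 2) (psum (map (\<lambda>w. trace_poly tab tt (shift w)) (List.n_lists 3 xs))))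
     (pmult (const_poly 3) (k_poly tab tt xs))"

definition X_poly :: "table \<Rightarrow> ttable \<Rightarrow> spoly" where
  "X_poly tab tt = psum [pmult (const_poly 6) (trace_poly tab tt (shift [Snd, Fst, Fst])),
     pmult (const_poly (- 6)) (trace_poly tab tt (shift [Snd, Snd, Fst])),
     pmult (const_poly 2) (l_poly tab tt [Fst]), pmult (const_poly (- 2)) (l_poly tab tt [Snd])]"

definition Y_poly :: "table \<Rightarrow> ttable \<Rightarrow> spoly" where
  "Y_poly tab tt = psum [pmult (const_poly 12) (trace_poly tab tt (shift [Snd, Snd, Fst, Fst])),
     pmult (const_poly 18) (trace_poly tab tt (shift [Snd, Fst, Fst])),
     pmult (const_poly 18) (trace_poly tab tt (shift [Snd, Snd, Fst])),
     pmult (const_poly (- 1)) (pmult (trace_poly tab tt (shift [Snd, Fst])) (trace_poly tab tt (shift [Snd, Fst]))),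
     pmult (const_poly (- 5)) (pmult (trace_poly tab tt (shift [Fst, Fst])) (trace_poly tab tt (shift [Snd, Snd]))),
     pmult (const_poly 30) (trace_poly tab tt (shift [Snd, Fst]))]"

text \<open>The arguments of the symmetrisations defining \<open>6 a\<^sub>5\<close>, \<open>288 a\<^sub>6\<close>, \<open>2304 a\<^sub>8\<close>, \<open>864 a\<^sub>9\<close>,
  in terms of the \<open>k\<^sub>i\<close> and of \<open>m\<^sub>i = 2 l\<^sub>i\<close>.\<close>

definition term5 :: "spoly \<Rightarrow> spoly \<Rightarrow> spoly \<Rightarrow> spoly \<Rightarrow> spoly \<Rightarrow> spoly \<Rightarrow> spoly" where
  "term5 k1 k2 k3 m1 m2 m3 = pmult k2 m1"

definition term6 :: "spoly \<Rightarrow> spoly \<Rightarrow> spoly \<Rightarrow> spoly \<Rightarrow> spoly \<Rightarrow> spoly \<Rightarrow> spoly" where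
  "term6 k1 k2 k3 m1 m2 m3 = psum [pprod [const_poly (- 3), k1, k1, k1], pprod [const_poly 6, k1, k1, k2],
     pprod [const_poly (- 18), k1, k2, k3], pprod [const_poly 18, k1, k1], pprod [const_poly (- 36), k1, k2],
     pprod [const_poly 2, m1, m1], pprod [const_poly (- 20), m1, m2]]"

definition term8 :: "spoly \<Rightarrow> spoly \<Rightarrow> spoly \<Rightarrow> spoly \<Rightarrow> spoly \<Rightarrow> spoly \<Rightarrow> spoly" where
  "term8 k1 k2 k3 m1 m2 m3 = psum [pprod [const_poly 3, k1, k1, k1, k1], pprod [const_poly (- 24), k1, k1, k1, k2],
     pprod [const_poly 18, k1, k1, k2, k2], pprod [const_poly 12, k1, k1, k2, k3],
     pprod [const_poly (- 36), k1, k1, k1], pprod [const_poly 72, k1, k1, k2], pprod [const_poly (- 24), k1, k2, k3],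
     pprod [const_poly (- 4), k1, m1, m1], pprod [const_poly 24, k1, m2, m2], pprod [const_poly (- 16), k1, m1, m2],
     pprod [const_poly 104, k1, m2, m3], pprod [const_poly 48, m1, m1], pprod [const_poly 96, m1, m2]]"

definition term9 :: "spoly \<Rightarrow> spoly \<Rightarrow> spoly \<Rightarrow> spoly \<Rightarrow> spoly \<Rightarrow> spoly \<Rightarrow> spoly" where
  "term9 k1 k2 k3 m1 m2 m3 = psum [pprod [const_poly (- 8), m2, m1, m1], pprod [const_poly 3, m2, k1, k1, k1],
     pprod [const_poly (- 6), m2, k1, k1, k2], pprod [const_poly 3, m2, k1, k2, k2], pprod [const_poly 27, m2, k1, k1, k3],
     pprod [const_poly 36, m2, k1, k1], pprod [const_poly (- 36), m2, k1, k2]]"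

definition symmetrise :: "int \<Rightarrow> (spoly \<Rightarrow> spoly \<Rightarrow> spoly \<Rightarrow> spoly \<Rightarrow> spoly \<Rightarrow> spoly \<Rightarrow> spoly)
    \<Rightarrow> spoly \<Rightarrow> spoly \<Rightarrow> spoly \<Rightarrow> spoly \<Rightarrow> spoly \<Rightarrow> spoly \<Rightarrow> spoly" where
  "symmetrise s f k1 k2 k3 m1 m2 m3 = padd (psum [f k1 k2 k3 m1 m2 m3, f k2 k3 k1 m2 m3 m1, f k3 k1 k2 m3 m1 m2])
     (pmult (const_poly s) (psum [f k2 k1 k3 m2 m1 m3, f k1 k3 k2 m1 m3 m2, f k3 k2 k1 m3 m2 m1]))"

text \<open>The scaling \<open>x = 12 X\<close>, \<open>y = 12 Y\<close> makes all coefficients integral.\<close>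

definition relation1 :: "spoly \<Rightarrow> spoly \<Rightarrow> spoly \<Rightarrow> spoly \<Rightarrow> spoly \<Rightarrow> spoly \<Rightarrow> spoly \<Rightarrow> spoly \<Rightarrow> spoly" where
  "relation1 p q r x y k a5 a8 = psum [pmult (const_poly 2304) (deriv_poly p q r U p), pprod [const_poly 96, y, y],
     pprod [const_poly (- 8), k, x, x], pprod [const_poly (- 32), a5, x], pmult (const_poly (- 1)) a8]"

definition relation2 :: "spoly \<Rightarrow> spoly \<Rightarrow> spoly \<Rightarrow> spoly \<Rightarrow> spoly \<Rightarrow> spoly \<Rightarrow> spoly \<Rightarrow> spoly \<Rightarrow> spoly \<Rightarrow> spoly" where
  "relation2 p q r x y k a5 a6 a9 = psum [pmult (const_poly 3456) (deriv_poly p q r Y p), pprod [const_poly 4, x, x, x],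
     pprod [const_poly 12, k, padd (pmult x y) (pmult y x)], pprod [const_poly 48, a5, y],
     pprod [const_poly (- 1), a6, x], pmult (const_poly (- 4)) a9]"

definition check :: "spoly \<Rightarrow> spoly \<Rightarrow> spoly \<Rightarrow> spoly \<Rightarrow> spoly \<Rightarrow> spoly \<Rightarrow> spoly \<Rightarrow> spoly \<Rightarrow> spoly
    \<Rightarrow> spoly \<Rightarrow> spoly \<Rightarrow> bool" where
  "check p q r k1 k2 k3 m1 m2 m3 x y \<longleftrightarrow>
     central_poly k1 \<and> central_poly k2 \<and> central_poly k3 \<and> central_poly m1 \<and> central_poly m2 \<and> central_poly m3 \<and>
     central_poly (padd x [(- 12, [U])]) \<and> central_poly (padd y [(- 12, [Y])]) \<and>
     solvable [(K1, k1), (K2, k2), (N1, m1), (N2, m2), (T, k3), (S, m3), (U, x), (Y, y), (H, p)] [] \<and>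
     sort_poly p q (relation1 p q r x y (psum [k1, k2, k3]) (symmetrise (- 1) term5 k1 k2 k3 m1 m2 m3)
       (symmetrise 1 term8 k1 k2 k3 m1 m2 m3)) = [] \<and>
     sort_poly p q (sort_poly p q (relation2 p q r x y (psum [k1, k2, k3])
       (symmetrise (- 1) term5 k1 k2 k3 m1 m2 m3) (symmetrise 1 term6 k1 k2 k3 m1 m2 m3)
       (symmetrise (- 1) term9 k1 k2 k3 m1 m2 m3))) = []"

text \<open>The three commutators of \<open>U\<close>, \<open>Y\<close>, \<open>H\<close> need no
  separate data: the commutator of a movable letter with the trace of a word is the trace of the
  derived word.\<close>

definition certificate :: "table \<Rightarrow> ttable \<Rightarrow> bool" where
  "certificate tab tt \<longleftrightarrow> known tt [] \<and> closed_under tab tt tt \<and>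
     check (trace_poly tab tt (ad_word U [Snd, Snd, Fst, Fst]))
       (trace_poly tab tt (ad_word U [Snd, Snd, Fst, Snd, Fst, Fst]))
       (trace_poly tab tt (ad_word Y [Snd, Snd, Fst, Snd, Fst, Fst]))
       (k_poly tab tt [Fst]) (k_poly tab tt [Snd]) (k_poly tab tt [Fst, Snd])
       (l_poly tab tt [Fst]) (l_poly tab tt [Snd]) (pmult (const_poly (- 1)) (l_poly tab tt [Fst, Snd]))
       (X_poly tab tt) (Y_poly tab tt)"

section \<open>Every trace is a polynomial in the nine letters\<close>

lemma all_known_cons_vec: "all_known tt (cons_vec w p v) \<longleftrightarrow> (p \<noteq> [] \<longrightarrow> known tt w) \<and> all_known tt v"
  by (cases p) auto

lemma all_known_vadd: "all_known tt v \<Longrightarrow> all_known tt w \<Longrightarrow> all_known tt (vadd v w)"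
  by (induction v w rule: vadd.induct) (auto simp: all_known_cons_vec)

lemma all_known_vscale: "all_known tt (vscale p v) = all_known tt v"
  by (induction p v rule: vscale.induct) auto

lemma all_known_vrow: "all_known tt (vrow tab w p) = all_known tt (vrow tab w q)"
  by (induction tab w p rule: vrow.induct) (auto simp: all_known_vscale)

lemma closed_underD:
  "closed_under tab tt xs \<Longrightarrow> known xs w \<Longrightarrow> all_known tt (vrow tab (x # w) p)"
proof (induction tab tt xs rule: closed_under.induct)
  case (2 tab tt v q xs)
  then show ?case
    using all_known_vrow[of tt tab "x # w" p "[]"] by (cases x) auto
qed simp

lemma all_known_vstep:
  "closed_under tab tt tt \<Longrightarrow> all_known tt v \<Longrightarrow> all_known tt (vstep tab x v)"
  by (induction tab x v rule: vstep.induct) (auto simp: all_known_vadd closed_underD)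

lemma all_known_vword:
  "known tt [] \<Longrightarrow> closed_under tab tt tt \<Longrightarrow> all_known tt (vword tab w)"
  by (induction tab w rule: vword.induct) (auto simp: all_known_vstep)

lemma all_known_vwords:
  "known tt [] \<Longrightarrow> closed_under tab tt tt \<Longrightarrow> all_known tt (vwords tab p w)"
  by (induction tab p w rule: vwords.induct) (auto intro!: all_known_vadd simp: all_known_vscale all_known_vword)

lemma rest_all_known: "all_known tt v \<Longrightarrow> rest tt v = []"
  by (induction tt v rule: all_known.induct) auto

context trace_calculus
begin

lemma trace_poly:
  assumes "trace_sound tt" "sound tab" "known tt []" "closed_under tab tt tt"
  shows "tr (ewp p) = ep (trace_poly tab tt p)"
  unfolding trace_poly_def
  by (rule trace_wpoly[OF assms(1,2) rest_all_known[OF all_known_vwords[OF assms(3,4)]]])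

lemma eval_shift: "ewp (shift w) = eval_word (\<lambda>x. \<mu> x - 1) w"
  by (induction w)
    (simp_all add: eval_wpoly_append eval_wpoly_cons eval_wpoly_times scaleC_one scaleC_minus_left right_diff_distrib)

lemma eval_const_poly: "ep (const_poly c) = of_int c *\<^sub>C 1"
  by (simp add: const_poly_def)

lemma eval_const_poly_mult: "ep (pmult (const_poly c) p) = of_int c *\<^sub>C ep p"
  by (simp add: eval_pmult eval_const_poly mult_scaleC_left)

lemma eval_psum: "ep (psum ps) = sum_list (map ep ps)"
  by (induction ps) (simp_all add: eval_padd)

lemma eval_pprod: "ep (pprod ps) = prod_list (map ep ps)"
  by (induction ps) (simp_all add: eval_pmult scaleC_one)

declare padd.simps [simp del] pmult.simps [simp del] pmon.simps [simp del] psum.simps [simp del]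
  pprod.simps [simp del] shift.simps [simp del] ad_word.simps [simp del] solvable.simps [simp del]

section \<open>Commutators of polynomials and what the check implies\<close>

lemma eval_mon_deriv:
  assumes "\<And>x. \<sigma> z * \<sigma> x = \<sigma> x * \<sigma> z + ep (img p q r z x)"
  shows "\<sigma> z * em m = em m * \<sigma> z + ep (mon_deriv p q r z m)"
proof (induction m)
  case (Cons x m)
  have "\<sigma> z * em (x # m) = (\<sigma> x * \<sigma> z + ep (img p q r z x)) * em m"
    unfolding assms[symmetric] by (simp add: mult.assoc)
  also have "\<dots> = \<sigma> x * (\<sigma> z * em m) + ep (img p q r z x) * em m"
    by (simp add: distrib_right mult.assoc)
  also have "\<dots> = em (x # m) * \<sigma> z + ep (mon_deriv p q r z (x # m))"
    unfolding Cons by (simp add: eval_padd eval_pmult eval_pmon scaleC_one distrib_left mult.assoc add_ac)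
  finally show ?case .
qed simp

lemma eval_deriv_poly:
  assumes "\<And>x. \<sigma> z * \<sigma> x = \<sigma> x * \<sigma> z + ep (img p q r z x)"
  shows "\<sigma> z * ep f = ep f * \<sigma> z + ep (deriv_poly p q r z f)"
  by (induction f)
    (auto simp: eval_padd eval_const_poly_mult distrib_left distrib_right mult_scaleC_left mult_scaleC_right
      eval_mon_deriv[OF assms] scaleC_add_right add_ac)

lemma eval_sort_mon:
  assumes "\<sigma> U * \<sigma> Y = \<sigma> Y * \<sigma> U + ep p" "\<sigma> U * \<sigma> H = \<sigma> H * \<sigma> U + ep q"
  shows "ep (sort_mon p q m) = em m"
proof (induction m)
  case (Cons x m)
  have "ep (sort_mon p q [Y, U]) = em [Y, U]" "ep (sort_mon p q [H, U]) = em [H, U]"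
    using assms by (simp_all add: eval_padd eval_const_poly_mult scaleC_one scaleC_minus_left)
  moreover have "ep (sort_mon p q (x # m)) = em (x # m)" if "x # m \<noteq> [Y, U]" "x # m \<noteq> [H, U]"
    using that Cons by (subst sort_mon.simps) (simp add: eval_pmult eval_pmon eval_padd scaleC_one del: list.inject)
  ultimately show ?case by metis
qed (simp add: scaleC_one)

lemma eval_sort_poly:
  assumes "\<sigma> U * \<sigma> Y = \<sigma> Y * \<sigma> U + ep p" "\<sigma> U * \<sigma> H = \<sigma> H * \<sigma> U + ep q"
  shows "ep (sort_poly p q f) = ep f"
  by (induction f) (auto simp: eval_padd eval_const_poly_mult eval_sort_mon[OF assms])

lemma central_poly: "central_poly p \<Longrightarrow> ep p * ep f = ep f * ep p"
proof -
  have mon: "list_all central m \<Longrightarrow> em m * em n = em n * em m" for m n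
  proof (induction m)
    case (Cons x m)
    then have "em (x # m) * em n = \<sigma> x * em n * em m" by (simp add: mult.assoc)
    also have "\<sigma> x * em n = em n * \<sigma> x" using Cons.prems by (simp add: central_mon)
    finally show ?case by (simp add: mult.assoc)
  qed simp
  have "list_all central m \<Longrightarrow> em m * ep f = ep f * em m" for m
    by (induction f) (auto simp: distrib_left distrib_right mult_scaleC_left mult_scaleC_right mon)
  then show "central_poly p \<Longrightarrow> ep p * ep f = ep f * ep p"
    by (induction p) (auto simp: distrib_left distrib_right mult_scaleC_left mult_scaleC_right)
qed

text \<open>\<open>x\<close> is a letter plus a central element, so both have the same commutators;
  the factor 12 clears the denominators of \<open>x\<close>.\<close>

lemma commutator_affine:
  assumes x: "12 *\<^sub>C x = ep xp" "central_poly (padd xp [(- 12, [z])])"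
    and z: "\<sigma> z * ep f = ep f * \<sigma> z + g"
  shows "commutator x (ep f) = g"
proof -
  have "12 *\<^sub>C x = ep (padd xp [(- 12, [z])]) + 12 *\<^sub>C \<sigma> z"
    by (simp add: eval_padd x(1) scaleC_minus_left)
  then have "commutator (12 *\<^sub>C x) (ep f) = 12 *\<^sub>C (\<sigma> z * ep f - ep f * \<sigma> z)"
    using central_poly[OF x(2), of f]
    by (simp add: commutator_def distrib_left distrib_right mult_scaleC_left mult_scaleC_right scaleC_diff_right)
  then have "12 *\<^sub>C commutator x (ep f) = 12 *\<^sub>C g"
    using z by (simp add: commutator_def mult_scaleC_left mult_scaleC_right scaleC_diff_right)
  then show ?thesis by (rule scaleC_cancel) simp
qed

lemma solve_scaled:
  assumes "n *\<^sub>C x + r = 0" "n \<noteq> 0" shows "x = (- 1 / n) *\<^sub>C (r :: 'b::complex_vector)"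
proof -
  have "n *\<^sub>C x = n *\<^sub>C ((- 1 / n) *\<^sub>C r)"
    using assms by (simp add: scaleC_scaleC scaleC_minus_left scaleC_minus_right scaleC_one eq_neg_iff_add_eq_0)
  then show ?thesis by (rule scaleC_cancel) fact
qed

lemma relations_of_check:
  assumes check: "check p q r k1 k2 k3 m1 m2 m3 xp yp"
    and UY: "\<sigma> U * \<sigma> Y = \<sigma> Y * \<sigma> U + ep p"
    and UH: "\<sigma> U * \<sigma> H = \<sigma> H * \<sigma> U + ep q"
    and YH: "\<sigma> Y * \<sigma> H = \<sigma> H * \<sigma> Y + ep r"
    and x: "12 *\<^sub>C x = ep xp" and y: "12 *\<^sub>C y = ep yp"
  shows "commutator x y = ep p"
    and "commutator x (commutator x y) = (- 6) *\<^sub>C (y * y) + (1/2) *\<^sub>C ((ep k1 + (ep k2 + ep k3)) * (x * x))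
      + (1/6) *\<^sub>C (ep (symmetrise (- 1) term5 k1 k2 k3 m1 m2 m3) * x)
      + (1/2304) *\<^sub>C ep (symmetrise 1 term8 k1 k2 k3 m1 m2 m3)"
    and "commutator y (commutator x y) = (- 2) *\<^sub>C (x * (x * x))
      + (- 1/2) *\<^sub>C ((ep k1 + (ep k2 + ep k3)) * (x * y + y * x))
      + (- 1/6) *\<^sub>C (ep (symmetrise (- 1) term5 k1 k2 k3 m1 m2 m3) * y)
      + (1/288) *\<^sub>C (ep (symmetrise 1 term6 k1 k2 k3 m1 m2 m3) * x)
      + (1/864) *\<^sub>C ep (symmetrise (- 1) term9 k1 k2 k3 m1 m2 m3)"
proof -
  have U: "\<sigma> U * \<sigma> s = \<sigma> s * \<sigma> U + ep (img p q r U s)" for s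
    using UY UH central[of s U] by (cases s) simp_all
  have Y: "\<sigma> Y * \<sigma> s = \<sigma> s * \<sigma> Y + ep (img p q r Y s)" for s
    using UY YH central[of s Y] by (cases s) (simp_all add: eval_const_poly_mult scaleC_minus_left scaleC_one)
  note c = check[unfolded check_def]
  have xf: "commutator x (ep f) = ep (deriv_poly p q r U f)" for f
    by (rule commutator_affine[OF x _ eval_deriv_poly[OF U]]) (use c in blast)
  have yf: "commutator y (ep f) = ep (deriv_poly p q r Y f)" for f
    by (rule commutator_affine[OF y _ eval_deriv_poly[OF Y]]) (use c in blast)
  \<comment> \<open>\<open>12 *\<^sub>C y\<close> is a central polynomial plus 12 times the letter
    \<open>Y\<close>; \<open>x\<close> commutes with the former and gives \<open>p\<close> with the
    latter.\<close>
  have "commutator x (ep (padd yp [(- 12, [Y])])) = 0"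
    using c central_poly[of "padd yp [(- 12, [Y])]" "[(1, [U])]"]
    by (intro commutator_affine[OF x]) (auto simp: scaleC_one)
  moreover have "commutator x (ep [(1, [Y])]) = ep p"
    using c UY by (intro commutator_affine[OF x]) (auto simp: scaleC_one)
  ultimately have "12 *\<^sub>C commutator x y = 12 *\<^sub>C ep p"
    by (simp add: commutator_def eval_padd scaleC_one scaleC_minus_left mult_scaleC_left mult_scaleC_right
        scaleC_add_right scaleC_diff_right algebra_simps flip: y)
  then show xy: "commutator x y = ep p" by (rule scaleC_cancel) simp
  have "ep (relation1 p q r xp yp (psum [k1, k2, k3]) (symmetrise (- 1) term5 k1 k2 k3 m1 m2 m3)
       (symmetrise 1 term8 k1 k2 k3 m1 m2 m3)) = 0"
    using c eval_sort_poly[OF UY UH] by (metis eval_poly.simps(1))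
  then show "commutator x (commutator x y) = (- 6) *\<^sub>C (y * y) + (1/2) *\<^sub>C ((ep k1 + (ep k2 + ep k3)) * (x * x))
      + (1/6) *\<^sub>C (ep (symmetrise (- 1) term5 k1 k2 k3 m1 m2 m3) * x)
      + (1/2304) *\<^sub>C ep (symmetrise 1 term8 k1 k2 k3 m1 m2 m3)"
    unfolding xy xf relation1_def
    by (simp add: eval_psum eval_const_poly_mult eval_pprod eval_const_poly mult_scaleC_left mult_scaleC_right
        scaleC_scaleC scaleC_one flip: x y)
      (drule solve_scaled, simp, simp add: scaleC_add_right scaleC_scaleC)
  have "ep (relation2 p q r xp yp (psum [k1, k2, k3])
       (symmetrise (- 1) term5 k1 k2 k3 m1 m2 m3) (symmetrise 1 term6 k1 k2 k3 m1 m2 m3)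
       (symmetrise (- 1) term9 k1 k2 k3 m1 m2 m3)) = 0"
    using c eval_sort_poly[OF UY UH] by (metis eval_poly.simps(1))
  then show "commutator y (commutator x y) = (- 2) *\<^sub>C (x * (x * x))
      + (- 1/2) *\<^sub>C ((ep k1 + (ep k2 + ep k3)) * (x * y + y * x))
      + (- 1/6) *\<^sub>C (ep (symmetrise (- 1) term5 k1 k2 k3 m1 m2 m3) * y)
      + (1/288) *\<^sub>C (ep (symmetrise 1 term6 k1 k2 k3 m1 m2 m3) * x)
      + (1/864) *\<^sub>C ep (symmetrise (- 1) term9 k1 k2 k3 m1 m2 m3)"
    unfolding xy yf relation2_def
    by (simp add: eval_psum eval_padd eval_pmult eval_const_poly_mult eval_pprod eval_const_poly mult_scaleC_left mult_scaleC_right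
        scaleC_scaleC scaleC_one flip: x y)
      (drule solve_scaled, simp, simp add: scaleC_add_right scaleC_scaleC mult_scaleC_right distrib_left)
qed

context
  fixes G :: "'a set"
  assumes one: "1 \<in> G" and add: "\<And>x y. x \<in> G \<Longrightarrow> y \<in> G \<Longrightarrow> x + y \<in> G"
    and mult: "\<And>x y. x \<in> G \<Longrightarrow> y \<in> G \<Longrightarrow> x * y \<in> G" and scaleC: "\<And>c x. x \<in> G \<Longrightarrow> c *\<^sub>C x \<in> G"
begin

lemma letters_in_closed:
  "\<forall>x\<in>set xs. \<sigma> x \<in> G \<Longrightarrow> letters_in xs p \<Longrightarrow> ep p \<in> G"
proof (induction xs p rule: letters_in.induct)
  case (1 xs)
  show ?case using scaleC[OF one, of 0] by simp
next
  case (2 xs c m p)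
  have "list_all (\<lambda>x. x \<in> set xs) m \<Longrightarrow> em m \<in> G" for m
  proof (induction m)
    case (Cons x m)
    then show ?case using 2(2) mult[of "\<sigma> x" "em m"] by simp
  qed (simp add: one)
  with 2 show ?case by (auto intro: add scaleC)
qed

lemma solvable_closed:
  "solvable ps xs \<Longrightarrow> \<forall>x\<in>set xs. \<sigma> x \<in> G \<Longrightarrow> \<forall>(x, p)\<in>set ps. ep p \<in> G \<Longrightarrow> \<forall>x\<in>fst ` set ps \<union> set xs. \<sigma> x \<in> G"
proof (induction ps xs rule: solvable.induct)
  case (2 x p ps xs)
  define c where "c = linear_coeff x p"
  have c: "c \<noteq> 0" "letters_in xs (padd p [(- c, [x])])"
    using 2(2) by (simp_all add: c_def solvable.simps)
  have "ep (padd p [(- c, [x])]) \<in> G"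
    using letters_in_closed[OF 2(3) c(2)] .
  \<comment> \<open>The subtracted part involves only letters already known to lie in
    \<open>G\<close>, and \<open>c\<close> can be inverted over the complex numbers.\<close>
  then have "ep p + (- 1) *\<^sub>C ep (padd p [(- c, [x])]) \<in> G"
    using 2(4) by (auto intro: add scaleC)
  then have "of_int c *\<^sub>C \<sigma> x \<in> G"
    by (simp add: eval_padd scaleC_minus_left scaleC_minus_right scaleC_add_right scaleC_one)
  from scaleC[OF this, of "1 / of_int c"] have "\<sigma> x \<in> G"
    using c(1) by (simp add: scaleC_scaleC scaleC_one)
  then show ?case
    using 2 by (auto simp: solvable.simps)
qed simp

end

end

section \<open>The evaluation and its consequences for a pair of matrices\<close>

definition reduction_table :: table where
  "reduction_table = tables relation_steps []"

definition trace_table :: ttable where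
  "trace_table = ttables reduction_table trace_steps initial_traces"

text \<open>Passing the table as an argument has it evaluated only once.\<close>

definition certificate_table :: "table \<Rightarrow> bool" where
  "certificate_table tab = certificate tab (ttables tab trace_steps initial_traces)"

lemma certificate: "certificate reduction_table trace_table"
proof -
  \<comment> \<open>This single evaluation builds both tables, confirms that they are complete, and
    verifies triangularity and the two nontrivial relations.\<close>
  have "certificate_table (tables relation_steps [])"
    by code_simp
  then show ?thesis
    by (simp only: certificate_table_def reduction_table_def trace_table_def)
qed

context gl3_pair
begin

abbreviation "trp \<equiv> trace_poly reduction_table trace_table"

lemma trace_formula: "tr (eval_wpoly matrix_of p) = ep (trp p)"
  using trace_poly[of trace_table reduction_table p] trace_sound_table sound_table certificate
  by (simp add: certificate_def flip: reduction_table_def trace_table_def)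

definition shifted_trace :: "word \<Rightarrow> 'a" where
  "shifted_trace w = tr (eval_word (\<lambda>x. matrix_of x - 1) w)"

lemma trace_shift: "ep (trp (shift w)) = shifted_trace w"
  by (simp add: trace_formula[symmetric] eval_shift shifted_trace_def)

definition k_val :: "leg list \<Rightarrow> 'a" where
  "k_val xs = sum_list (map shifted_trace (List.n_lists 2 xs))"

definition l_val :: "leg list \<Rightarrow> 'a" where
  "l_val xs = sum_list (map shifted_trace (List.n_lists 3 xs)) + (3/2) *\<^sub>C k_val xs"

definition X_val :: 'a where
  "X_val = (1/2) *\<^sub>C (shifted_trace [Snd, Fst, Fst] - shifted_trace [Snd, Snd, Fst])
     + (1/3) *\<^sub>C (l_val [Fst] - l_val [Snd])"

definition Y_val :: 'a where
  "Y_val = shifted_trace [Snd, Snd, Fst, Fst]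
     + (3/2) *\<^sub>C (shifted_trace [Snd, Fst, Fst] + shifted_trace [Snd, Snd, Fst])
     - (1/12) *\<^sub>C (shifted_trace [Snd, Fst])\<^sup>2 - (5/12) *\<^sub>C (shifted_trace [Fst, Fst] * shifted_trace [Snd, Snd])
     + (5/2) *\<^sub>C shifted_trace [Snd, Fst]"

lemma eval_k_poly: "ep (k_poly reduction_table trace_table xs) = k_val xs"
  by (simp add: k_poly_def k_val_def eval_psum comp_def trace_shift)

lemma eval_l_poly: "ep (l_poly reduction_table trace_table xs) = 2 *\<^sub>C l_val xs"
  by (simp add: l_poly_def l_val_def eval_psum comp_def trace_shift eval_k_poly eval_padd eval_const_poly_mult
      scaleC_add_right scaleC_scaleC)

lemma eval_X_poly: "ep (X_poly reduction_table trace_table) = 12 *\<^sub>C X_val"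
  by (simp add: X_poly_def X_val_def eval_psum eval_const_poly_mult trace_shift eval_l_poly
      scaleC_add_right scaleC_diff_right scaleC_scaleC scaleC_minus_left)

lemma eval_Y_poly: "ep (Y_poly reduction_table trace_table) = 12 *\<^sub>C Y_val"
  by (simp add: Y_poly_def Y_val_def eval_psum eval_const_poly eval_pmult trace_shift power2_eq_square
      mult_scaleC_left scaleC_add_right scaleC_diff_right scaleC_scaleC scaleC_minus_left scaleC_one)

lemmas certificate_check = certificate[unfolded certificate_def, THEN conjunct2, THEN conjunct2]

lemma bracket_scalars:
  "scalar_of U * scalar_of Y = scalar_of Y * scalar_of U + ep (trp (ad_word U [Snd, Snd, Fst, Fst]))"
  "scalar_of U * scalar_of H = scalar_of H * scalar_of U + ep (trp (ad_word U [Snd, Snd, Fst, Snd, Fst, Fst]))"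
  "scalar_of Y * scalar_of H = scalar_of H * scalar_of Y + ep (trp (ad_word Y [Snd, Snd, Fst, Snd, Fst, Fst]))"
  using trace_ad_word[of U "[Snd, Snd, Fst, Fst]"] trace_ad_word[of U "[Snd, Snd, Fst, Snd, Fst, Fst]"]
    trace_ad_word[of Y "[Snd, Snd, Fst, Snd, Fst, Fst]"]
  by (simp_all add: commutator_def algebra_simps flip: trace_formula)

definition sym_val :: "int \<Rightarrow> (spoly \<Rightarrow> spoly \<Rightarrow> spoly \<Rightarrow> spoly \<Rightarrow> spoly \<Rightarrow> spoly \<Rightarrow> spoly) \<Rightarrow> 'a" where
  "sym_val s f = ep (symmetrise s f (k_poly reduction_table trace_table [Fst]) (k_poly reduction_table trace_table [Snd])
    (k_poly reduction_table trace_table [Fst, Snd]) (l_poly reduction_table trace_table [Fst])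
    (l_poly reduction_table trace_table [Snd]) (pmult (const_poly (- 1)) (l_poly reduction_table trace_table [Fst, Snd])))"

lemmas check_relations = relations_of_check[OF certificate_check bracket_scalars eval_X_poly[symmetric] eval_Y_poly[symmetric],
  folded sym_val_def, unfolded eval_k_poly]

text \<open>\<open>G\<close> will be the range of the homomorphism. The triangular system recovers
  the nine letters one after another; the commutator of \<open>X_val\<close> and
  \<open>Y_val\<close> is what yields \<open>H\<close>.\<close>

lemma generated:
  assumes one: "1 \<in> G" and add: "\<And>x y. x \<in> G \<Longrightarrow> y \<in> G \<Longrightarrow> x + y \<in> G"
    and mult: "\<And>x y. x \<in> G \<Longrightarrow> y \<in> G \<Longrightarrow> x * y \<in> G" and scaleC: "\<And>c x. x \<in> G \<Longrightarrow> c *\<^sub>C x \<in> G"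
    and vals: "k_val [Fst] \<in> G" "k_val [Snd] \<in> G" "k_val [Fst, Snd] \<in> G"
      "l_val [Fst] \<in> G" "l_val [Snd] \<in> G" "l_val [Fst, Snd] \<in> G" "X_val \<in> G" "Y_val \<in> G" "commutator X_val Y_val \<in> G"
  shows "shifted_trace w \<in> G"
proof -
  note clos = one add mult scaleC
  let ?ps = "[(K1, k_poly reduction_table trace_table [Fst]), (K2, k_poly reduction_table trace_table [Snd]),
    (N1, l_poly reduction_table trace_table [Fst]), (N2, l_poly reduction_table trace_table [Snd]),
    (T, k_poly reduction_table trace_table [Fst, Snd]),
    (S, pmult (const_poly (- 1)) (l_poly reduction_table trace_table [Fst, Snd])),
    (U, X_poly reduction_table trace_table), (Y, Y_poly reduction_table trace_table),
    (H, trp (ad_word U [Snd, Snd, Fst, Fst]))]"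
  have "solvable ?ps []"
    using certificate_check unfolding check_def by blast
  moreover have "\<forall>(x, p)\<in>set ?ps. ep p \<in> G"
    using vals check_relations(1)
    by (simp add: eval_k_poly eval_l_poly eval_X_poly eval_Y_poly eval_const_poly_mult scaleC)
  ultimately have "\<forall>x\<in>fst ` set ?ps \<union> set []. scalar_of x \<in> G"
    by (intro solvable_closed[OF clos]) simp_all
  then have "\<forall>x\<in>set [K1, K2, N1, N2, T, S, U, Y, H]. scalar_of x \<in> G"
    by simp
  moreover have "letters_in [K1, K2, N1, N2, T, S, U, Y, H] p" for p
  proof -
    have "list_all (\<lambda>x. x \<in> set [K1, K2, N1, N2, T, S, U, Y, H]) m" for m
      unfolding list_all_iff using sc.exhaust by auto
    then show ?thesis by (induction p) auto
  qed
  ultimately have "ep p \<in> G" for p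
    using letters_in_closed[OF clos] by blast
  then show ?thesis by (simp flip: trace_shift)
qed

end

section \<open>Evaluation of the structure constants\<close>

lemma sum_permutes_3:
  fixes f :: "(3 \<Rightarrow> 3) \<Rightarrow> 'b::comm_monoid_add"
  shows "(\<Sum>\<pi> | \<pi> permutes UNIV. f \<pi>) =
    f id + f (Transposition.transpose 2 3) + (f (Transposition.transpose 1 2) + f (Transposition.transpose 1 2 \<circ> Transposition.transpose 2 3))
    + (f (Transposition.transpose 1 3) + f (Transposition.transpose 1 3 \<circ> Transposition.transpose 2 3))"
proof -
  have f123: "finite {2::3, 3}" "1 \<notin> {2::3, 3}" by auto
  have f23: "finite {3::3}" "2 \<notin> {3::3}" by auto
  show ?thesis
    unfolding UNIV_3 sum_over_permutations_insert[OF f123] sum_over_permutations_insert[OF f23]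
    by (simp add: add.assoc)
qed

lemma transpose_3_simps:
  "Transposition.transpose 2 3 (1::3) = 1" "Transposition.transpose 1 2 (1::3) = 2" "Transposition.transpose 1 2 (2::3) = 1" "Transposition.transpose 1 2 (3::3) = 3"
  "Transposition.transpose 2 3 (2::3) = 3" "Transposition.transpose 2 3 (3::3) = 2" "Transposition.transpose 1 3 (1::3) = 3" "Transposition.transpose 1 3 (2::3) = 2" "Transposition.transpose 1 3 (3::3) = 1"
  by (simp_all add: Transposition.transpose_def)

lemma sign_3_simps: "sign (Transposition.transpose 2 (3::3)) = -1" "sign (Transposition.transpose 1 (2::3)) = -1" "sign (Transposition.transpose 1 (3::3)) = -1"
  "sign (Transposition.transpose 1 2 \<circ> Transposition.transpose 2 (3::3)) = 1" "sign (Transposition.transpose 1 3 \<circ> Transposition.transpose 2 (3::3)) = 1"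
  by (simp_all add: sign_compose permutation_swap_id sign_swap_id)

text \<open>Makes monomials multiplicative in a noncommutative algebra when the values commute
  pairwise. Lists fix an order of the factors, as products over sets require commutativity of the
  whole algebra.\<close>

lemma prod_list_power_commute:
  fixes p :: "'v \<Rightarrow> 'a::monoid_mult"
  assumes "\<And>v w. p v * p w = p w * p v"
  shows "prod_list (map (\<lambda>v. p v ^ (a v + b v)) vs) =
    prod_list (map (\<lambda>v. p v ^ a v) vs) * prod_list (map (\<lambda>v. p v ^ b v) vs)"
proof (induction vs)
  case (Cons v vs)
  have powers: "p v ^ n * p w ^ k = p w ^ k * p v ^ n" for w n k
    using power_commuting_commutes[OF power_commuting_commutes[OF assms, symmetric], of w k v n] by simp
  have comm: "p v ^ n * prod_list (map (\<lambda>w. p w ^ a w) ws) = prod_list (map (\<lambda>w. p w ^ a w) ws) * p v ^ n" for n ws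
  proof (induction ws)
    case (Cons w ws)
    have "p v ^ n * (p w ^ a w * prod_list (map (\<lambda>w. p w ^ a w) ws)) = p w ^ a w * (p v ^ n * prod_list (map (\<lambda>w. p w ^ a w) ws))"
      by (simp add: powers flip: mult.assoc)
    then show ?case by (simp add: Cons mult.assoc)
  qed simp
  have "p v ^ b v * (prod_list (map (\<lambda>w. p w ^ a w) vs) * M) = prod_list (map (\<lambda>w. p w ^ a w) vs) * (p v ^ b v * M)" for M
    by (simp add: comm flip: mult.assoc)
  then show ?case
    by (simp add: Cons power_add[of "p v"] mult.assoc)
qed simp

section \<open>Polynomials in the central parameters under homomorphisms\<close>

lemma complex_algebra_hom_sum:
  assumes "complex_algebra_hom f" shows "f (sum g A) = (\<Sum>x\<in>A. f (g x))"
  by (induction A rule: infinite_finite_induct)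
    (simp_all add: complex_algebra_hom_zero[OF assms] complex_algebra_hom_add[OF assms])

lemma complex_algebra_hom_power:
  assumes "complex_algebra_hom f" shows "f (x ^ n) = f x ^ n"
  by (induction n) (simp_all add: complex_algebra_hom_one[OF assms] complex_algebra_hom_mult[OF assms])

lemma numeral_eq_scaleC: "numeral n = numeral n *\<^sub>C (1 :: 'a::{complex_algebra, numeral})"
proof (induction n)
  case One
  show ?case by (simp add: scaleC_one)
next
  case (Bit0 n)
  then show ?case by (metis numeral_Bit0 scaleC_add_left)
next
  case (Bit1 n)
  then show ?case by (metis numeral_Bit1 scaleC_add_left scaleC_one)
qed

lemma complex_algebra_hom_numeral:
  fixes f :: "'a::{complex_algebra, numeral} \<Rightarrow> 'b::complex_algebra"
  assumes "complex_algebra_hom f" shows "f (numeral n) = numeral n *\<^sub>C 1"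
  by (metis numeral_eq_scaleC complex_algebra_hom_scaleC[OF assms] complex_algebra_hom_one[OF assms])

lemma complex_algebra_hom_uminus:
  assumes "complex_algebra_hom f" shows "f (- x) = - f x"
  using complex_algebra_hom_diff[OF assms, of 0 x] complex_algebra_hom_zero[OF assms] by simp

lemma complex_algebra_hom_comp:
  "complex_algebra_hom f \<Longrightarrow> complex_algebra_hom g \<Longrightarrow> complex_algebra_hom (f \<circ> g)"
  by (simp add: complex_algebra_hom_def)

definition params :: "param list" where
  "params = [K 1, K 2, K 3, L 1, L 2, L 3]"

definition param_eval :: "(param \<Rightarrow> 'a::complex_algebra) \<Rightarrow> ppoly \<Rightarrow> 'a" where
  "param_eval p = linear_extension (\<lambda>m. prod_list (map (\<lambda>v. p v ^ Poly_Mapping.lookup m v) params))"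

lemma complex_algebra_hom_param_eval:
  assumes "\<And>v w. p v * p w = p w * p v"
  shows "complex_algebra_hom (param_eval p)"
  unfolding param_eval_def
  by (rule complex_algebra_hom_linear_extension)
    (simp add: params_def, simp add: lookup_add prod_list_power_commute[OF assms])

lemma param_eval_var: "param_eval p (var v) = p v"
proof -
  have "K i \<in> set params" "L i \<in> set params" for i
    using exhaust_3[of i] by (auto simp: params_def)
  then have "v \<in> set params" by (cases v) auto
  then show ?thesis
    by (auto simp: params_def param_eval_def var_def lookup_single when_def scaleC_one)
qed

definition arg5 :: ppoly where
  "arg5 = 2 * k\<^sub>2 * l\<^sub>1"

definition arg6 :: ppoly where
  "arg6 = (1/16) *\<^sub>C (- (k\<^sub>1^3) + 2 * k\<^sub>1^2 * k\<^sub>2 - 6 * k\<^sub>1 * k\<^sub>2 * k\<^sub>3)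
     + (3/8) *\<^sub>C (k\<^sub>1^2 - 2 * k\<^sub>1 * k\<^sub>2) + (1/6) *\<^sub>C l\<^sub>1^2 - (5/3) *\<^sub>C (l\<^sub>1 * l\<^sub>2)"

definition arg8 :: ppoly where
  "arg8 = (1/128) *\<^sub>C (k\<^sub>1^4 - 8 * k\<^sub>1^3 * k\<^sub>2 + 6 * k\<^sub>1^2 * k\<^sub>2^2 + 4 * k\<^sub>1^2 * k\<^sub>2 * k\<^sub>3)
     - (1/32) *\<^sub>C (3 * k\<^sub>1^3 - 6 * k\<^sub>1^2 * k\<^sub>2 + 2 * k\<^sub>1 * k\<^sub>2 * k\<^sub>3)
     - (1/24) *\<^sub>C (k\<^sub>1 * (l\<^sub>1^2 - 6 * l\<^sub>2^2 + 4 * l\<^sub>1 * l\<^sub>2 - 26 * l\<^sub>2 * l\<^sub>3))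
     + (1/2) *\<^sub>C l\<^sub>1^2 + l\<^sub>1 * l\<^sub>2"

definition arg9 :: ppoly where
  "arg9 = l\<^sub>2 * ((- 4/9) *\<^sub>C l\<^sub>1^2
     + (1/24) *\<^sub>C (k\<^sub>1^3 - 2 * k\<^sub>1^2 * k\<^sub>2 + k\<^sub>1 * k\<^sub>2^2 + 9 * k\<^sub>1^2 * k\<^sub>3)
     + (1/2) *\<^sub>C (k\<^sub>1^2 - k\<^sub>1 * k\<^sub>2))"

context trace_calculus
begin

text \<open>The \<open>q\<close> polynomials are twice the images of the \<open>l\<close> variables,
  as in \<open>term5\<close> to \<open>term9\<close>. Keeping all six polynomials arbitrary allows
  the same computation for every permutation of the indices.\<close>

definition represents :: "spoly \<Rightarrow> spoly \<Rightarrow> spoly \<Rightarrow> spoly \<Rightarrow> spoly \<Rightarrow> spoly \<Rightarrow> (ppoly \<Rightarrow> 'a) \<Rightarrow> bool" where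
  "represents p1 p2 p3 q1 q2 q3 h \<longleftrightarrow> complex_algebra_hom h \<and>
     h k\<^sub>1 = ep p1 \<and> h k\<^sub>2 = ep p2 \<and> h k\<^sub>3 = ep p3 \<and>
     h l\<^sub>1 = (1/2) *\<^sub>C ep q1 \<and> h l\<^sub>2 = (1/2) *\<^sub>C ep q2 \<and> h l\<^sub>3 = (1/2) *\<^sub>C ep q3"

lemma hom_arg:
  assumes "represents p1 p2 p3 q1 q2 q3 h"
  shows "h arg5 = ep (term5 p1 p2 p3 q1 q2 q3)"
    and "h arg6 = (1/48) *\<^sub>C ep (term6 p1 p2 p3 q1 q2 q3)"
    and "h arg8 = (1/384) *\<^sub>C ep (term8 p1 p2 p3 q1 q2 q3)"
    and "h arg9 = (1/144) *\<^sub>C ep (term9 p1 p2 p3 q1 q2 q3)"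
proof -
  have h: "complex_algebra_hom h" using assms by (simp add: represents_def)
  note homs = complex_algebra_hom_add[OF h] complex_algebra_hom_diff[OF h] complex_algebra_hom_uminus[OF h]
    complex_algebra_hom_mult[OF h] complex_algebra_hom_scaleC[OF h] complex_algebra_hom_numeral[OF h] complex_algebra_hom_power[OF h]
  have v: "h k\<^sub>1 = ep p1" "h k\<^sub>2 = ep p2" "h k\<^sub>3 = ep p3"
    "h l\<^sub>1 = (1/2) *\<^sub>C ep q1" "h l\<^sub>2 = (1/2) *\<^sub>C ep q2" "h l\<^sub>3 = (1/2) *\<^sub>C ep q3"
    using assms by (simp_all add: represents_def)
  note rules = homs v eval_psum eval_pprod eval_pmult eval_const_poly power2_eq_square power3_eq_cube power4_eq_xxxx
    mult_scaleC_left mult_scaleC_right scaleC_scaleC scaleC_one scaleC_add_right scaleC_diff_right scaleC_minus_right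
    scaleC_minus_left mult.assoc distrib_left right_diff_distrib
  show "h arg5 = ep (term5 p1 p2 p3 q1 q2 q3)"
    by (simp add: arg5_def term5_def rules)
  show "h arg6 = (1/48) *\<^sub>C ep (term6 p1 p2 p3 q1 q2 q3)"
    by (simp add: arg6_def term6_def rules algebra_simps)
  show "h arg8 = (1/384) *\<^sub>C ep (term8 p1 p2 p3 q1 q2 q3)"
    by (simp add: arg8_def term8_def rules algebra_simps)
  show "h arg9 = (1/144) *\<^sub>C ep (term9 p1 p2 p3 q1 q2 q3)"
    by (simp only: arg9_def term9_def homs v) (simp add: rules algebra_simps)
qed

lemma
  assumes h: "\<And>\<pi>. represents (kp (\<pi> 1)) (kp (\<pi> 2)) (kp (\<pi> 3)) (mp (\<pi> 1)) (mp (\<pi> 2)) (mp (\<pi> (3::3))) (h \<circ> perm_act \<pi>)"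
    and hom: "complex_algebra_hom h"
    and g: "\<And>p1 p2 p3 q1 q2 q3 h. represents p1 p2 p3 q1 q2 q3 h \<Longrightarrow> h g = c *\<^sub>C ep (t p1 p2 p3 q1 q2 q3)"
  shows hom_sym_plus: "h (sym_plus g) = (c/6) *\<^sub>C ep (symmetrise 1 t (kp 1) (kp 2) (kp 3) (mp 1) (mp 2) (mp 3))"
    and hom_sym_minus: "h (sym_minus g) = (c/6) *\<^sub>C ep (symmetrise (- 1) t (kp 1) (kp 2) (kp 3) (mp 1) (mp 2) (mp 3))"
proof -
  have *: "h (perm_act \<pi> g) = c *\<^sub>C ep (t (kp (\<pi> 1)) (kp (\<pi> 2)) (kp (\<pi> 3)) (mp (\<pi> 1)) (mp (\<pi> 2)) (mp (\<pi> 3)))" for \<pi>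
    using g[OF h[of \<pi>]] by simp
  note rules = * sum_permutes_3 transpose_3_simps sign_3_simps complex_algebra_hom_scaleC[OF hom]
    complex_algebra_hom_add[OF hom] complex_algebra_hom_uminus[OF hom] complex_algebra_hom_diff[OF hom]
    symmetrise_def eval_psum eval_padd eval_const_poly_mult scaleC_one scaleC_minus_left
    scaleC_add_right scaleC_diff_right scaleC_scaleC scaleC_minus_right
  show "h (sym_plus g) = (c/6) *\<^sub>C ep (symmetrise 1 t (kp 1) (kp 2) (kp 3) (mp 1) (mp 2) (mp 3))"
    by (simp add: sym_plus_def rules add_ac)
  show "h (sym_minus g) = (c/6) *\<^sub>C ep (symmetrise (- 1) t (kp 1) (kp 2) (kp 3) (mp 1) (mp 2) (mp 3))"
    by (simp add: sym_minus_def rules algebra_simps)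
qed

end

section \<open>Transport of matrices along homomorphisms\<close>

lemma ent_map_mat3 [simp]: "ent (map_mat3 h M) i j = h (ent M i j)"
  by (cases M) simp

lemma hom_mat3:
  assumes h: "complex_algebra_hom h"
  shows hom_mat3_mult: "map_mat3 h (M * N) = map_mat3 h M * map_mat3 h N"
    and hom_tr: "h (tr M) = tr (map_mat3 h M)"
  by (auto intro!: mat3_eqI simp: ent_mult tr_def complex_algebra_hom_sum[OF h] complex_algebra_hom_mult[OF h])

lemma hom_tensor_op:
  assumes h: "complex_algebra_hom h" and "tensor_op M N" shows "tensor_op (map_mat3 h M) (map_mat3 h N)"
  unfolding tensor_op_def
proof (intro allI)
  fix p q i j
  have "h (ent M p q * ent N i j) = h (ent N i j * ent M p q + (if p = j then ent N i q else 0) - (if i = q then ent N p j else 0))"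
    by (simp only: tensor_opD[OF assms(2)])
  then show "ent (map_mat3 h M) p q * ent (map_mat3 h N) i j = ent (map_mat3 h N) i j * ent (map_mat3 h M) p q
      + (if p = j then ent (map_mat3 h N) i q else 0) - (if i = q then ent (map_mat3 h N) p j else 0)"
    by (simp only: ent_map_mat3 complex_algebra_hom_mult[OF h] complex_algebra_hom_add[OF h]
      complex_algebra_hom_diff[OF h] complex_algebra_hom_zero[OF h] if_distrib[of h])
qed

lemma tensor_op_add_one: "tensor_op M M \<Longrightarrow> tensor_op (M + 1) (M + 1)"
  unfolding tensor_op_def
proof (intro allI)
  fix p q i j
  assume "\<forall>p q i j. ent M p q * ent M i j = ent M i j * ent M p q + (if p = j then ent M i q else 0)
    - (if i = q then ent M p j else 0)"
  then have "ent M p q * ent M i j = ent M i j * ent M p q + (if p = j then ent M i q else 0)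
    - (if i = q then ent M p j else 0)"
    by blast
  then show "ent (M + 1) p q * ent (M + 1) i j = ent (M + 1) i j * ent (M + 1) p q
      + (if p = j then ent (M + 1) i q else 0) - (if i = q then ent (M + 1) p j else 0)"
    by (cases "p = j"; cases "i = q") (simp_all add: distrib_left distrib_right)
qed

section \<open>The algebra \<open>Z\<^sub>2(sl(3))\<close>\<close>

lemma uea_of_zero: "uea_of 0 = 0"
  using uea_of_scaleC[of 0 0] by simp

lemma uea_of_diff: "uea_of (x - y) = uea_of x - uea_of y"
  using uea_of_add[of "x - y" y] by (simp add: algebra_simps)

lemma E_commute:
  "E p q * E r s = E r s * E p q + (if q = r then E p s else 0) - (if s = p then E r q else 0)"
proof -
  have "commutator (E p q) (E r s) = (if q = r then E p s else 0) - (if s = p then E r q else 0)"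
    by (simp add: E_def uea_of_bracket bracket_e_sl3 uea_of_diff uea_of_zero)
  then show ?thesis by (simp add: commutator_def algebra_simps)
qed

text \<open>The transpose turns the index pattern of polarised traces and of \<open>casimir3\<close>
  into ordinary matrix multiplication.\<close>

definition E_mat :: "sl3 uea mat3" where
  "E_mat = Mat (\<lambda>i j. E j i)"

lemma tensor_op_E_mat: "tensor_op E_mat E_mat"
  unfolding tensor_op_def E_mat_def mat3.sel by (intro allI E_commute)

lemma tr_E_mat: "tr E_mat = 0"
proof -
  have "tr E_mat = uea_of (e_sl3 1 1 + e_sl3 2 2 + e_sl3 3 3)"
    by (simp only: tr_def E_mat_def mat3.sel sum_3 E_def uea_of_add)
  then show ?thesis by (simp only: e_sl3_trace uea_of_zero)
qed

lemma casimir2_eq: "casimir2 = tr (E_mat * E_mat)"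
  by (simp add: casimir2_def tr_def ent_mult E_mat_def)

lemma casimir3_eq: "casimir3 = tr (E_mat * E_mat * E_mat)"
proof -
  have "casimir3 = (\<Sum>i\<^sub>1\<in>UNIV. \<Sum>i\<^sub>3\<in>UNIV. \<Sum>i\<^sub>2\<in>UNIV. E i\<^sub>2 i\<^sub>1 * E i\<^sub>3 i\<^sub>2 * E i\<^sub>1 i\<^sub>3)"
    unfolding casimir3_def by (intro sum.cong refl sum.swap)
  then show ?thesis
    by (simp add: tr_def ent_mult E_mat_def sum_distrib_right)
qed

lemma casimir3_bar_eq: "casimir3_bar = casimir3 + 3 *\<^sub>C casimir2"
proof -
  have "casimir3_bar = (\<Sum>i\<^sub>3\<in>UNIV. \<Sum>i\<^sub>1\<in>UNIV. \<Sum>i\<^sub>2\<in>UNIV. E i\<^sub>1 i\<^sub>2 * E i\<^sub>2 i\<^sub>3 * E i\<^sub>3 i\<^sub>1)"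
  proof -
    have "casimir3_bar = (\<Sum>i\<^sub>1\<in>UNIV. \<Sum>i\<^sub>3\<in>UNIV. \<Sum>i\<^sub>2\<in>UNIV. E i\<^sub>1 i\<^sub>2 * E i\<^sub>2 i\<^sub>3 * E i\<^sub>3 i\<^sub>1)"
      unfolding casimir3_bar_def by (intro sum.cong refl sum.swap)
    then show ?thesis by (rule trans) (rule sum.swap)
  qed
  \<comment> \<open>The opposite index pattern is a reversed product; restoring the order costs
    \<open>3 *\<^sub>C E_mat\<close> and a trace, which is zero.\<close>
  also have "\<dots> = tr ((E_mat \<odot> E_mat) * E_mat)"
    by (simp add: tr_def ent_mult ent_rmult E_mat_def sum_distrib_right)
  also have "\<dots> = casimir3 + 3 *\<^sub>C casimir2"
    by (simp add: rmult_tensor_op[OF tensor_op_E_mat] tr_E_mat casimir2_eq casimir3_eq diag_simps distrib_right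
        mult_scaleC_left tr_simps)
  finally show ?thesis .
qed

definition F_mat :: "leg \<Rightarrow> usl3_2 mat3" where
  "F_mat x = Mat (\<lambda>i j. E_leg x j i)"

lemma complex_algebra_hom_tens:
  "complex_algebra_hom (\<lambda>x. x \<otimes> 1)" "complex_algebra_hom (\<lambda>x. 1 \<otimes> x)"
  by (simp_all add: complex_algebra_hom_def tens_one tens_add_left tens_add_right tens_mult
      tens_scaleC_left tens_scaleC_right)

text \<open>By the last equation, Casimir elements under \<open>coproduct\<close> are traces of
  powers of the sum of both matrices, hence sums over all words of a given length; this accounts for
  index 3.\<close>

lemma F_mat_eq: "F_mat Fst = map_mat3 (\<lambda>x. x \<otimes> 1) E_mat" "F_mat Snd = map_mat3 (\<lambda>x. 1 \<otimes> x) E_mat"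
  "F_mat Fst + F_mat Snd = map_mat3 coproduct E_mat"
  by (rule mat3_eqI; simp add: F_mat_def E_mat_def E_def)+

lemma tensor_op_F_mat: "tensor_op (F_mat x) (F_mat x)"
  by (cases x) (simp_all add: F_mat_eq hom_tensor_op complex_algebra_hom_tens tensor_op_E_mat)

lemma tr_F_mat: "tr (F_mat x) = 0"
proof -
  have "tr (map_mat3 h E_mat) = 0" if "complex_algebra_hom h" for h :: "sl3 uea \<Rightarrow> usl3_2"
    using hom_tr[OF that, of E_mat] complex_algebra_hom_zero[OF that] by (simp add: tr_E_mat)
  then show ?thesis
    by (cases x) (simp_all add: F_mat_eq complex_algebra_hom_tens)
qed

interpretation Z2: gl3_pair "F_mat Fst + 1" "F_mat Snd + 1"
proof unfold_locales
  show "tensor_op (F_mat Fst + 1) (F_mat Fst + 1)" "tensor_op (F_mat Snd + 1) (F_mat Snd + 1)"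
    by (intro tensor_op_add_one tensor_op_F_mat)+
  show "tr (F_mat Fst + 1) = 3 *\<^sub>C 1" "tr (F_mat Snd + 1) = 3 *\<^sub>C 1"
    by (simp_all add: tr_simps tr_one tr_F_mat)
  show "entries_commute (F_mat Fst + 1) (F_mat Snd + 1)"
    by (auto simp: entries_commute_def F_mat_def distrib_left distrib_right tens_mult add_ac)
qed

lemma matrix_of_minus_one: "(\<lambda>x. Z2.matrix_of x - 1) = F_mat"
proof
  show "Z2.matrix_of x - 1 = F_mat x" for x by (cases x) simp_all
qed

lemma shifted_trace_eq: "Z2.shifted_trace w = tr (eval_word F_mat w)"
  by (simp add: Z2.shifted_trace_def matrix_of_minus_one)

section \<open>Polarised traces as traces of words\<close>

lemma sum_lists_Suc:
  fixes f :: "'k::finite list \<Rightarrow> 'b::comm_monoid_add"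
  shows "(\<Sum>ks | length ks = Suc n. f ks) = (\<Sum>k\<in>UNIV. \<Sum>ks | length ks = n. f (k # ks))"
proof -
  have img: "{ks :: 'k list. length ks = Suc n} = (\<lambda>(k, ks). k # ks) ` (UNIV \<times> {ks. length ks = n})"
    by (auto simp: length_Suc_conv image_iff)
  have inj: "inj_on (\<lambda>(k, ks). k # ks) (UNIV \<times> {ks :: 'k list. length ks = n})"
    by (auto simp: inj_on_def)
  have "(\<Sum>ks | length ks = Suc n. f ks) = (\<Sum>p\<in>UNIV \<times> {ks. length ks = n}. f (case p of (k, ks) \<Rightarrow> k # ks))"
    unfolding img by (rule trans[OF sum.reindex[OF inj]]) (simp add: comp_def)
  also have "\<dots> = (\<Sum>(k, ks)\<in>UNIV \<times> {ks. length ks = n}. f (k # ks))"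
    by (rule sum.cong) auto
  also have "\<dots> = (\<Sum>k\<in>UNIV. \<Sum>ks | length ks = n. f (k # ks))"
    by (rule sum.cartesian_product[symmetric])
  finally show ?thesis .
qed

text \<open>A sum over paths: \<open>ks\<close> lists the vertices visited after \<open>i\<close>,
  the last of which has to be \<open>j\<close>. The reversal undoes the storage order of
  words.\<close>

lemma ent_word_product:
  "ent (eval_word \<mu> (rev as)) i j = (\<Sum>ks | length ks = length as. if last (i # ks) = j
     then prod_list (map (\<lambda>m. ent (\<mu> (as ! m)) ((i # ks) ! m) (ks ! m)) [0..<length as]) else 0)"
proof (induction as arbitrary: i)
  case Nil
  have "{ks :: 3 list. ks = []} = {[]}" by auto
  then show ?case by simp
next
  case (Cons x as)
  have "ent (eval_word \<mu> (rev (x # as))) i j = (\<Sum>k\<in>UNIV. ent (\<mu> x) i k * ent (eval_word \<mu> (rev as)) k j)"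
    by (simp add: eval_word_append ent_mult)
  also have "\<dots> = (\<Sum>k\<in>UNIV. \<Sum>ks | length ks = length as. if last (i # k # ks) = j
     then prod_list (map (\<lambda>m. ent (\<mu> ((x # as) ! m)) ((i # k # ks) ! m) ((k # ks) ! m)) [0..<length (x # as)]) else 0)"
    unfolding Cons sum_distrib_left
    by (intro sum.cong refl) (simp add: map_upt_Suc del: upt_Suc)
  finally show ?case
    by (simp only: length_Cons sum_lists_Suc)
qed

lemma polarised_trace_eq:
  assumes "as \<noteq> []" shows "polarised_trace as = tr (eval_word F_mat (rev as))"
proof -
  define n where "n = length as"
  have n: "n > 0" using assms by (simp add: n_def)
  define f where "f ks = prod_list (map (\<lambda>m. ent (F_mat (as ! m)) ((last ks # ks) ! m) (ks ! m)) [0..<n])" for ks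
  have fin: "finite {ks :: 3 list. length ks = n}"
    using finite_lists_length_eq[of "UNIV :: 3 set" n] by simp
  have "tr (eval_word F_mat (rev as)) = (\<Sum>i\<in>UNIV. \<Sum>ks | length ks = n. if last ks = i then f ks else 0)"
    unfolding tr_def ent_word_product n_def[symmetric] using n
    by (intro sum.cong refl) (auto simp: f_def)
  also have "\<dots> = (\<Sum>ks | length ks = n. f ks)"
    by (subst sum.swap) simp
  \<comment> \<open>A closed path lists its vertices as i_2, ..., i_d, i_1, whereas the polarised
    trace lists them as i_1, ..., i_d.\<close>
  also have "\<dots> = (\<Sum>js | length js = n. f (rotate1 js))"
  proof (rule sum.reindex_bij_betw[symmetric])
    have "inj_on rotate1 {js :: 3 list. length js = n}"
    proof (rule inj_onI)
      fix xs ys :: "3 list"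
      assume "rotate1 xs = rotate1 ys"
      then show "xs = ys" by (cases xs; cases ys) simp_all
    qed
    moreover have "rotate1 ` {js :: 3 list. length js = n} \<subseteq> {ks. length ks = n}" by auto
    ultimately show "bij_betw rotate1 {js :: 3 list. length js = n} {ks. length ks = n}"
      unfolding bij_betw_def using endo_inj_surj[OF fin] by blast
  qed
  also have "\<dots> = polarised_trace as"
    unfolding polarised_trace_def n_def[symmetric]
  proof (intro sum.cong refl)
    fix js :: "3 list" assume js: "js \<in> {js. length js = n}"
    have 1: "rotate1 js ! m = js ! (Suc m mod n)" if "m < n" for m
      using that js by (simp add: nth_rotate1)
    have 2: "(last (rotate1 js) # rotate1 js) ! m = js ! m" if "m < n" for m
    proof (cases m)
      case 0
      then show ?thesis using js n by (cases js) auto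
    next
      case (Suc k)
      then show ?thesis using 1[of k] that by simp
    qed
    have E: "E_leg x q p = ent (F_mat x) p q" for x p q
      by (simp add: F_mat_def)
    show "f (rotate1 js) = prod_list (map (\<lambda>m. E_leg (as ! m) (js ! (Suc m mod n)) (js ! m)) [0..<n])"
      unfolding f_def E by (intro arg_cong[of _ _ prod_list] map_cong refl) (simp add: 1 2)
  qed
  finally show ?thesis ..
qed

lemma shifted_trace_rev: "as \<noteq> [] \<Longrightarrow> Z2.shifted_trace (rev as) = polarised_trace as"
  by (simp add: shifted_trace_eq polarised_trace_eq)

lemma k_elem_eq: "k_elem 1 = Z2.k_val [Fst]" "k_elem 2 = Z2.k_val [Snd]" "k_elem 3 = Z2.k_val [Fst, Snd]"
proof -
  have "h casimir2 = tr (map_mat3 h E_mat * map_mat3 h E_mat)" if "complex_algebra_hom h"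
    for h :: "sl3 uea \<Rightarrow> usl3_2"
    by (simp add: casimir2_eq hom_tr[OF that] hom_mat3_mult[OF that])
  note h = this[OF complex_algebra_hom_tens(1)] this[OF complex_algebra_hom_tens(2)] this[OF complex_algebra_hom_coproduct]
  show "k_elem 1 = Z2.k_val [Fst]" "k_elem 2 = Z2.k_val [Snd]"
    by (simp_all add: k_elem_def Z2.k_val_def shifted_trace_eq numeral_2_eq_2 h flip: F_mat_eq)
  show "k_elem 3 = Z2.k_val [Fst, Snd]"
    by (simp add: k_elem_def Z2.k_val_def shifted_trace_eq numeral_2_eq_2 h flip: F_mat_eq)
      (simp add: distrib_left distrib_right tr_simps add_ac)
qed

lemma l_elem_eq: "l_elem 1 = Z2.l_val [Fst]" "l_elem 2 = Z2.l_val [Snd]" "l_elem 3 = - Z2.l_val [Fst, Snd]"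
proof -
  have "h casimir3 = tr (map_mat3 h E_mat * map_mat3 h E_mat * map_mat3 h E_mat)" if "complex_algebra_hom h"
    for h :: "sl3 uea \<Rightarrow> usl3_2"
    by (simp add: casimir3_eq hom_tr[OF that] hom_mat3_mult[OF that])
  note h = this[OF complex_algebra_hom_tens(1)] this[OF complex_algebra_hom_tens(2)] this[OF complex_algebra_hom_coproduct]
  have c: "(1/2) *\<^sub>C (casimir3 + casimir3_bar) = casimir3 + (3/2) *\<^sub>C casimir2"
    by (simp add: casimir3_bar_eq scaleC_add_right scaleC_scaleC scaleC_one flip: scaleC_add_left add.assoc)
  have l: "l_elem 1 = casimir3 \<otimes> 1 + (3/2) *\<^sub>C k_elem 1" "l_elem 2 = 1 \<otimes> casimir3 + (3/2) *\<^sub>C k_elem 2"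
    "l_elem 3 = - (coproduct casimir3 + (3/2) *\<^sub>C k_elem 3)"
    by (simp_all add: l_elem_def k_elem_def c tens_add_left tens_add_right tens_scaleC_left tens_scaleC_right
        complex_algebra_hom_add[OF complex_algebra_hom_coproduct] complex_algebra_hom_scaleC[OF complex_algebra_hom_coproduct])
  show "l_elem 1 = Z2.l_val [Fst]" "l_elem 2 = Z2.l_val [Snd]"
    by (simp_all add: l k_elem_eq Z2.l_val_def shifted_trace_eq numeral_3_eq_3 h flip: F_mat_eq)
  show "l_elem 3 = - Z2.l_val [Fst, Snd]"
    by (simp add: l k_elem_eq Z2.l_val_def shifted_trace_eq numeral_3_eq_3 h flip: F_mat_eq)
      (simp add: distrib_left distrib_right tr_simps add_ac mult.assoc)
qed

lemma X_elem_eq: "X_elem = Z2.X_val"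
  using shifted_trace_rev[of "[Fst, Fst, Snd]"] shifted_trace_rev[of "[Fst, Snd, Snd]"]
  by (simp add: X_elem_def Z2.X_val_def l_elem_eq)

lemma Y_elem_eq: "Y_elem = Z2.Y_val"
  using shifted_trace_rev[of "[Fst, Fst, Snd]"] shifted_trace_rev[of "[Fst, Snd, Snd]"] shifted_trace_rev[of "[Fst, Fst, Snd, Snd]"]
    shifted_trace_rev[of "[Fst, Snd]"] shifted_trace_rev[of "[Fst, Fst]"] shifted_trace_rev[of "[Snd, Snd]"]
  by (simp add: Y_elem_def Z2.Y_val_def)

section \<open>Construction of the homomorphism\<close>

fun param_image :: "param \<Rightarrow> usl3_2" where
  "param_image (K i) = k_elem i"
| "param_image (L i) = l_elem i"

fun gen_image :: "A_gen \<Rightarrow> usl3_2" where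
  "gen_image GenA = X_elem"
| "gen_image GenB = Y_elem"
| "gen_image GenC = Z_elem"

text \<open>Functions of the index, so that permuting the parameters is composition. The sign for
  index 3 in \<open>lp\<close> is the one in \<open>l_elem\<close>.\<close>

abbreviation (input) "kp \<equiv> \<lambda>i::3. k_poly reduction_table trace_table (if i = 1 then [Fst] else if i = 2 then [Snd] else [Fst, Snd])"

abbreviation (input) "lp \<equiv> \<lambda>i::3. if i = 1 then l_poly reduction_table trace_table [Fst]
  else if i = 2 then l_poly reduction_table trace_table [Snd]
  else pmult (const_poly (- 1)) (l_poly reduction_table trace_table [Fst, Snd])"

lemma param_image_eq:
  "param_image (K i) = Z2.ep (kp i)" "param_image (L i) = (1/2) *\<^sub>C Z2.ep (lp i)"
  using exhaust_3[of i]
  by (auto simp: Z2.eval_k_poly Z2.eval_l_poly Z2.eval_const_poly_mult k_elem_eq l_elem_eq scaleC_scaleC scaleC_one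
      scaleC_minus_left scaleC_minus_right)

text \<open>The check has verified that the polynomials of all six parameters contain only central
  letters.\<close>

lemma central_param_image: "param_image v * Z2.ep f = Z2.ep f * param_image v"
proof -
  have "central_poly (kp i)" "central_poly (lp i)" for i
    using Z2.certificate_check unfolding check_def by simp_all
  then show ?thesis
    using Z2.central_poly[of "kp i" f for i] Z2.central_poly[of "lp i" f for i]
    by (cases v) (simp_all only: param_image_eq mult_scaleC_left mult_scaleC_right)
qed

lemma gen_image_eq: "12 *\<^sub>C gen_image GenA = Z2.ep (X_poly reduction_table trace_table)"
  "12 *\<^sub>C gen_image GenB = Z2.ep (Y_poly reduction_table trace_table)"
  "gen_image GenC = Z2.ep (trace_poly reduction_table trace_table (ad_word U [Snd, Snd, Fst, Fst]))"
  by (simp_all add: X_elem_eq Y_elem_eq Z_elem_def Z2.eval_X_poly Z2.eval_Y_poly Z2.check_relations(1))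

lemma param_image_gen_commute: "param_image v * gen_image g = gen_image g * param_image v"
proof (cases g)
  case GenC
  show ?thesis by (simp only: GenC gen_image_eq(3) central_param_image)
next
  case GenA
  have "12 *\<^sub>C (param_image v * gen_image g) = 12 *\<^sub>C (gen_image g * param_image v)"
    using central_param_image[of v "X_poly reduction_table trace_table"] GenA
    unfolding gen_image_eq(1)[symmetric] by (simp only: mult_scaleC_left mult_scaleC_right)
  then show ?thesis by (rule scaleC_cancel) simp
next
  case GenB
  have "12 *\<^sub>C (param_image v * gen_image g) = 12 *\<^sub>C (gen_image g * param_image v)"
    using central_param_image[of v "Y_poly reduction_table trace_table"] GenB
    unfolding gen_image_eq(2)[symmetric] by (simp only: mult_scaleC_left mult_scaleC_right)
  then show ?thesis by (rule scaleC_cancel) simp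
qed

lemma param_image_commute: "param_image v * param_image w = param_image w * param_image v"
  by (cases w) (simp_all only: param_image_eq mult_scaleC_left mult_scaleC_right central_param_image)

abbreviation "\<rho> \<equiv> param_eval param_image"

lemmas hom_rho = complex_algebra_hom_param_eval[OF param_image_commute]

lemma represents_perm:
  "Z2.represents (kp (\<pi> 1)) (kp (\<pi> 2)) (kp (\<pi> 3)) (lp (\<pi> 1)) (lp (\<pi> 2)) (lp (\<pi> 3)) (\<rho> \<circ> perm_act \<pi>)"
  unfolding Z2.represents_def comp_def perm_act_var param_eval_var param_image_eq
  using complex_algebra_hom_comp[OF hom_rho complex_algebra_hom_perm_act] by (simp add: comp_def)

lemmas rho_sym = Z2.hom_sym_plus[OF represents_perm hom_rho] Z2.hom_sym_minus[OF represents_perm hom_rho]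

lemma coefficients_eq:
  "a\<^sub>5 = sym_minus arg5" "a\<^sub>6 = sym_plus arg6" "a\<^sub>8 = sym_plus arg8" "a\<^sub>9 = sym_minus arg9"
  by (simp_all only: a\<^sub>5_def arg5_def a\<^sub>6_def arg6_def a\<^sub>8_def arg8_def a\<^sub>9_def arg9_def)

lemma rho_coefficients:
  "\<rho> a\<^sub>2 = (1/2) *\<^sub>C (k_elem 1 + (k_elem 2 + k_elem 3))"
  "\<rho> a\<^sub>5 = (1/6) *\<^sub>C Z2.sym_val (- 1) term5"
  "\<rho> a\<^sub>6 = (1/288) *\<^sub>C Z2.sym_val 1 term6"
  "\<rho> a\<^sub>8 = (1/2304) *\<^sub>C Z2.sym_val 1 term8"
  "\<rho> a\<^sub>9 = (1/864) *\<^sub>C Z2.sym_val (- 1) term9"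
proof -
  show "\<rho> a\<^sub>2 = (1/2) *\<^sub>C (k_elem 1 + (k_elem 2 + k_elem 3))"
    by (simp add: a\<^sub>2_def complex_algebra_hom_scaleC[OF hom_rho] complex_algebra_hom_add[OF hom_rho] param_eval_var add.assoc)
  show "\<rho> a\<^sub>5 = (1/6) *\<^sub>C Z2.sym_val (- 1) term5"
    using rho_sym(2)[of arg5 1 term5] Z2.hom_arg(1)
    by (simp add: coefficients_eq Z2.sym_val_def scaleC_one)
  show "\<rho> a\<^sub>6 = (1/288) *\<^sub>C Z2.sym_val 1 term6"
    using rho_sym(1)[of arg6 "1/48" term6] Z2.hom_arg(2)
    by (simp add: coefficients_eq Z2.sym_val_def)
  show "\<rho> a\<^sub>8 = (1/2304) *\<^sub>C Z2.sym_val 1 term8"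
    using rho_sym(1)[of arg8 "1/384" term8] Z2.hom_arg(3)
    by (simp add: coefficients_eq Z2.sym_val_def)
  show "\<rho> a\<^sub>9 = (1/864) *\<^sub>C Z2.sym_val (- 1) term9"
    using rho_sym(2)[of arg9 "1/144" term9] Z2.hom_arg(4)
    by (simp add: coefficients_eq Z2.sym_val_def)
qed

lemma rho_commute: "\<rho> c * gen_image g = gen_image g * \<rho> c"
proof (induction c rule: poly_mapping_single_induct)
  case (single m c)
  have pow: "param_image v ^ n * gen_image g = gen_image g * param_image v ^ n" for v n
    by (rule power_commuting_commutes[OF param_image_gen_commute])
  have "prod_list (map (\<lambda>v. param_image v ^ Poly_Mapping.lookup m v) vs) * gen_image g
    = gen_image g * prod_list (map (\<lambda>v. param_image v ^ Poly_Mapping.lookup m v) vs)" for vs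
  proof (induction vs)
    case (Cons v vs)
    have "param_image v ^ n * prod_list ws * gen_image g = gen_image g * (param_image v ^ n * prod_list ws)"
      if "prod_list ws * gen_image g = gen_image g * prod_list ws" for n ws
    proof -
      have "param_image v ^ n * prod_list ws * gen_image g = param_image v ^ n * gen_image g * prod_list ws"
        by (simp only: mult.assoc that)
      then show ?thesis by (simp only: pow mult.assoc)
    qed
    then show ?case using Cons by simp
  qed simp
  then show ?case
    by (simp add: param_eval_def mult_scaleC_left mult_scaleC_right)
next
  case (add p q)
  then show ?case
    by (simp add: complex_algebra_hom_add[OF hom_rho] distrib_left distrib_right)
qed

text \<open>The analogue of \<open>linear_extension\<close> with polynomial coefficients, evaluated
  by \<open>\<rho>\<close>. It is multiplicative because the values of \<open>\<rho>\<close> commute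
  with the images of the generators.\<close>

definition free_A_eval :: "free_A \<Rightarrow> usl3_2" where
  "free_A_eval f = (\<Sum>w\<in>Poly_Mapping.keys f. \<rho> (Poly_Mapping.lookup f w) * prod_list (map gen_image (letters w)))"

lemma free_A_eval_single: "free_A_eval (Poly_Mapping.single w c) = \<rho> c * prod_list (map gen_image (letters w))"
  by (simp add: free_A_eval_def complex_algebra_hom_zero[OF hom_rho])

lemma free_A_eval_add: "free_A_eval (f + g) = free_A_eval f + free_A_eval g"
  unfolding free_A_eval_def
  by (rule setsum_keys_plus_distrib)
    (simp_all add: complex_algebra_hom_zero[OF hom_rho] complex_algebra_hom_add[OF hom_rho] distrib_right)

lemma complex_algebra_hom_free_A_eval: "complex_algebra_hom free_A_eval"
proof -
  have comm: "prod_list (map gen_image xs) * \<rho> c = \<rho> c * prod_list (map gen_image xs)" for xs c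
  proof (induction xs)
    case (Cons x xs)
    have "prod_list (map gen_image (x # xs)) * \<rho> c = gen_image x * (prod_list (map gen_image xs) * \<rho> c)"
      by (simp add: mult.assoc)
    also have "\<dots> = (gen_image x * \<rho> c) * prod_list (map gen_image xs)"
      by (simp only: Cons mult.assoc)
    also have "\<dots> = \<rho> c * prod_list (map gen_image (x # xs))"
      by (simp only: rho_commute[symmetric] list.map prod_list.Cons mult.assoc)
    finally show ?case .
  qed simp
  have "free_A_eval (p * q) = free_A_eval p * free_A_eval q" for p q
  proof (induction p rule: poly_mapping_single_induct)
    case (single m c)
    show ?case
    proof (induction q rule: poly_mapping_single_induct)
      case (single n d)
      have "\<rho> c * \<rho> d * (prod_list (map gen_image (letters m)) * prod_list (map gen_image (letters n)))
        = \<rho> c * (prod_list (map gen_image (letters m)) * \<rho> d) * prod_list (map gen_image (letters n))"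
        by (simp add: comm mult.assoc)
      then show ?case
        by (simp add: mult_single free_A_eval_single complex_algebra_hom_mult[OF hom_rho] plus_fword_def mult.assoc)
    qed (simp add: distrib_left free_A_eval_add)
  qed (simp add: distrib_right free_A_eval_add)
  moreover have "free_A_eval 1 = 1"
    using free_A_eval_single[of "0 :: A_gen fword" 1]
    by (simp only: complex_algebra_hom_one[OF hom_rho] single_one) (simp add: zero_fword_def)
  moreover have "free_A_eval (c *\<^sub>C p) = c *\<^sub>C free_A_eval p" for c p
    by (induction p rule: poly_mapping_single_induct)
      (simp_all add: free_A_eval_single complex_algebra_hom_scaleC[OF hom_rho] mult_scaleC_left scaleC_add_right free_A_eval_add)
  ultimately show ?thesis
    by (simp add: complex_algebra_hom_def free_A_eval_add)
qed

lemma free_A_eval_free_gen: "free_A_eval (free_gen g) = gen_image g"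
  by (simp add: free_gen_def free_A_eval_single complex_algebra_hom_one[OF hom_rho])

lemma free_A_eval_const: "free_A_eval (const c) = \<rho> c"
  by (simp add: const_def free_A_eval_single zero_fword_def)

lemma free_A_eval_relations:
  assumes "r \<in> A_relations" shows "free_A_eval r = 0"
proof -
  note h = complex_algebra_hom_free_A_eval
  note homs = complex_algebra_hom_add[OF h] complex_algebra_hom_diff[OF h] complex_algebra_hom_uminus[OF h]
    complex_algebra_hom_mult[OF h] complex_algebra_hom_numeral[OF h] complex_algebra_hom_power[OF h]
    free_A_eval_free_gen free_A_eval_const commutator_def
  note rels = Z2.check_relations(2,3)[folded X_elem_eq Y_elem_eq k_elem_eq Z_elem_def, unfolded commutator_def]
  show ?thesis
    using assms rels unfolding A_relations_def Let_def
    by (elim insertE emptyE)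
      (simp_all add: homs rho_coefficients Z_elem_def[unfolded commutator_def] power2_eq_square power3_eq_cube
        mult_scaleC_left mult_scaleC_right scaleC_minus_left mult.assoc)
qed

lift_definition eval_A :: "alg_A \<Rightarrow> usl3_2" is free_A_eval
  by (rule hom_cong_ideal[OF complex_algebra_hom_free_A_eval free_A_eval_relations])

lemma complex_algebra_hom_eval_A: "complex_algebra_hom eval_A"
proof -
  note h = complex_algebra_hom_free_A_eval
  have "eval_A 1 = 1" by transfer (rule complex_algebra_hom_one[OF h])
  moreover have "eval_A (x + y) = eval_A x + eval_A y" for x y
    by transfer (rule complex_algebra_hom_add[OF h])
  moreover have "eval_A (x * y) = eval_A x * eval_A y" for x y
    by transfer (rule complex_algebra_hom_mult[OF h])
  moreover have "eval_A (c *\<^sub>C x) = c *\<^sub>C eval_A x" for c x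
    by transfer (rule complex_algebra_hom_scaleC[OF h])
  ultimately show ?thesis by (simp add: complex_algebra_hom_def)
qed

lemma eval_A_gen: "eval_A (gen_A g) = gen_image g"
  by transfer (rule free_A_eval_free_gen)

lemma eval_A_central: "eval_A (central_A v) = param_image v"
  by transfer (simp add: free_A_eval_const param_eval_var)

section \<open>The image of the homomorphism\<close>

lemma polarised_trace_in_Z2: "as \<noteq> [] \<Longrightarrow> polarised_trace as \<in> Z2_sl3"
  unfolding Z2_sl3_def by (rule subalgebra_generated.generator) blast

lemma Z2_zero: "0 \<in> Z2_sl3"
  using subalgebra_generated.scaleC[OF subalgebra_generated.one, of 0] by (simp add: Z2_sl3_def)

lemma Z2_add: "x \<in> Z2_sl3 \<Longrightarrow> y \<in> Z2_sl3 \<Longrightarrow> x + y \<in> Z2_sl3"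
  and Z2_mult: "x \<in> Z2_sl3 \<Longrightarrow> y \<in> Z2_sl3 \<Longrightarrow> x * y \<in> Z2_sl3"
  and Z2_scaleC: "x \<in> Z2_sl3 \<Longrightarrow> c *\<^sub>C x \<in> Z2_sl3"
  and Z2_one: "1 \<in> Z2_sl3"
  unfolding Z2_sl3_def
  by (fact subalgebra_generated.add subalgebra_generated.mult subalgebra_generated.scaleC subalgebra_generated.one)+

lemma Z2_diff: "x \<in> Z2_sl3 \<Longrightarrow> y \<in> Z2_sl3 \<Longrightarrow> x - y \<in> Z2_sl3"
  using Z2_add[OF _ Z2_scaleC[of y "- 1"], of x] by (simp add: scaleC_minus_left scaleC_one)

lemma Z2_sum_list: "(\<And>x. x \<in> set xs \<Longrightarrow> x \<in> Z2_sl3) \<Longrightarrow> sum_list xs \<in> Z2_sl3"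
  by (induction xs) (auto intro: Z2_zero Z2_add)

lemma Z2_prod_list: "(\<And>x. x \<in> set xs \<Longrightarrow> x \<in> Z2_sl3) \<Longrightarrow> prod_list xs \<in> Z2_sl3"
  by (induction xs) (auto intro: Z2_one Z2_mult)

lemma Z2_power: "x \<in> Z2_sl3 \<Longrightarrow> x ^ n \<in> Z2_sl3"
  by (induction n) (auto intro: Z2_one Z2_mult)

lemma shifted_trace_in_Z2: "w \<noteq> [] \<Longrightarrow> Z2.shifted_trace w \<in> Z2_sl3"
  using shifted_trace_rev[of "rev w"] polarised_trace_in_Z2[of "rev w"] by simp

lemma param_image_in_Z2: "param_image v \<in> Z2_sl3"
proof -
  have k: "Z2.k_val xs \<in> Z2_sl3" for xs
    unfolding Z2.k_val_def by (rule Z2_sum_list) (auto simp: set_n_lists intro!: shifted_trace_in_Z2)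
  have l: "Z2.l_val xs \<in> Z2_sl3" for xs
    unfolding Z2.l_val_def
    by (intro Z2_add Z2_scaleC k Z2_sum_list) (auto simp: set_n_lists intro!: shifted_trace_in_Z2)
  have "param_image (K i) \<in> Z2_sl3" "param_image (L i) \<in> Z2_sl3" for i
  proof -
    have "- x \<in> Z2_sl3" if "x \<in> Z2_sl3" for x using Z2_diff[OF Z2_zero that] by simp
    then show "param_image (K i) \<in> Z2_sl3" "param_image (L i) \<in> Z2_sl3"
      using exhaust_3[of i] k l by (auto simp only: param_image.simps k_elem_eq l_elem_eq)
  qed
  then show ?thesis by (cases v) simp_all
qed

lemma gen_image_in_Z2: "gen_image g \<in> Z2_sl3"
proof -
  have l: "l_elem i \<in> Z2_sl3" for i using param_image_in_Z2[of "L i"] by simp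
  have X: "X_elem \<in> Z2_sl3"
    unfolding X_elem_def by (intro Z2_add Z2_diff Z2_scaleC polarised_trace_in_Z2 l) simp_all
  have Y: "Y_elem \<in> Z2_sl3"
    unfolding Y_elem_def by (intro Z2_add Z2_diff Z2_scaleC Z2_power Z2_mult polarised_trace_in_Z2) simp_all
  show ?thesis
    using X Y by (cases g) (simp_all add: Z_elem_def commutator_def Z2_diff Z2_mult)
qed

lemma free_A_eval_in_Z2: "free_A_eval f \<in> Z2_sl3"
proof (induction f rule: poly_mapping_single_induct)
  case (single w c)
  have "\<rho> c \<in> Z2_sl3"
  proof (induction c rule: poly_mapping_single_induct)
    case (single m c)
    show ?case
      by (simp add: param_eval_def) (auto intro!: Z2_scaleC Z2_prod_list Z2_power param_image_in_Z2)
  qed (auto simp: complex_algebra_hom_add[OF hom_rho] intro: Z2_add)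
  then show ?case
    by (auto simp: free_A_eval_single intro!: Z2_mult Z2_prod_list gen_image_in_Z2)
qed (auto simp: free_A_eval_add intro: Z2_add)

lemma range_eval_A: "range eval_A = Z2_sl3"
proof (intro subset_antisym subsetI)
  fix z assume "z \<in> range eval_A"
  then show "z \<in> Z2_sl3"
  proof
    fix x assume "z = eval_A x"
    moreover have "eval_A x \<in> Z2_sl3" by transfer (rule free_A_eval_in_Z2)
    ultimately show ?thesis by simp
  qed
next
  note h = complex_algebra_hom_eval_A
  have one: "1 \<in> range eval_A"
    using rangeI[of eval_A 1] by (simp only: complex_algebra_hom_one[OF h])
  have add: "x + y \<in> range eval_A" and mult: "x * y \<in> range eval_A"
    if xy: "x \<in> range eval_A" "y \<in> range eval_A" for x y
  proof -
    obtain p q where "x = eval_A p" "y = eval_A q" using xy by blast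
    then show "x + y \<in> range eval_A" "x * y \<in> range eval_A"
      using rangeI[of eval_A "p + q"] rangeI[of eval_A "p * q"]
      by (simp_all only: complex_algebra_hom_add[OF h] complex_algebra_hom_mult[OF h])
  qed
  have scaleC: "c *\<^sub>C x \<in> range eval_A" if x: "x \<in> range eval_A" for c x
  proof -
    obtain p where "x = eval_A p" using x by blast
    then show ?thesis
      using rangeI[of eval_A "c *\<^sub>C p"] by (simp only: complex_algebra_hom_scaleC[OF h])
  qed
  have gen: "gen_image g \<in> range eval_A" and par: "param_image v \<in> range eval_A" for g v
    unfolding eval_A_gen[symmetric] eval_A_central[symmetric] by (rule rangeI)+
  have k: "k_elem i \<in> range eval_A" and l: "l_elem i \<in> range eval_A" for i
    using par[of "K i"] par[of "L i"] by simp_all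
  have "Z2.l_val [Fst, Snd] \<in> range eval_A"
    using scaleC[OF l[of 3], of "- 1"] by (simp add: l_elem_eq scaleC_minus_left scaleC_one)
  moreover have "commutator X_elem Y_elem \<in> range eval_A"
    using gen[of GenC] by (simp add: Z_elem_def)
  \<comment> \<open>The nine elements required by \<open>generated\<close> are images of generators,
    up to the sign of the third cubic one.\<close>
  ultimately have trace: "Z2.shifted_trace w \<in> range eval_A" for w
    using k[of 1] k[of 2] k[of 3] l[of 1] l[of 2] gen[of GenA] gen[of GenB]
    by (intro Z2.generated one add mult scaleC) (simp_all add: k_elem_eq l_elem_eq X_elem_eq Y_elem_eq)
  fix z assume "z \<in> Z2_sl3"
  then show "z \<in> range eval_A"
    unfolding Z2_sl3_def
  proof (induction rule: subalgebra_generated.induct)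
    case (generator x)
    then obtain as where as: "as \<noteq> []" "x = polarised_trace as" by blast
    then show ?case using trace[of "rev as"] unfolding shifted_trace_rev[OF as(1)] by simp
  qed (intro one add mult scaleC; assumption)+
qed

theorem proposition4p2:
  shows "\<exists>\<phi> :: alg_A \<Rightarrow> usl3_2.
    complex_algebra_hom \<phi> \<and>
    \<phi> (gen_A GenA) = X_elem \<and> \<phi> (gen_A GenB) = Y_elem \<and> \<phi> (gen_A GenC) = Z_elem \<and>
    (\<forall>i. \<phi> (central_A (K i)) = k_elem i) \<and>
    (\<forall>i. \<phi> (central_A (L i)) = l_elem i) \<and>
    range \<phi> = Z2_sl3"
  using complex_algebra_hom_eval_A range_eval_A
  by (intro exI[of _ eval_A]) (simp add: eval_A_gen eval_A_central)

end
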